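(* For every integer $m\ge1$, $$E_m(x)=\Omega_{\pm}(x^{m-\frac34})\qquad\text{as } x\to\infty,$$ that is, $\limsup_{x\to\infty}E_m(x)/x^{m-\frac34}>0$ and $\liminf_{x\to\infty}E_m(x)/x^{m-\frac34}<0$.
   Context: Throughout $p$ denotes a prime and $\gamma_E=0.5772\ldots$ is the Euler–Mascheroni constant. Let $C_2=\prod_{p>2}\left(1-\frac{1}{(p-1)^2}\right)$. For integers $k\ge 1$ define $\mathfrak{S}(k)=2C_2\prod_{p\mid k,\ p>2}\frac{p-1}{p-2}$ if $k$ is even and $\mathfrak{S}(k)=0$ if $k$ is odd. For an integer $m\ge1$ let $$S_m(x)=\sum_{k\le x}(x-k)^m\mathfrak{S}(k),\qquad H_m=\sum_{n=1}^m\frac1n,$$ and define $E_m(x)$ by $$S_m(x)=\frac{1}{m+1}x^{m+1}-\frac12x^m\left(\log x-H_m+\gamma_E+\log 2\pi\right)+E_m(x).$$ *)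

theory Defs
  imports "HOL-Analysis.Analysis" "HOL-Computational_Algebra.Primes"
begin

definition twin_prime_const :: real where
  "twin_prime_const =
     (\<Prod>p. if prime p \<and> p > 2 then 1 - 1 / (real p - 1)\<^sup>2 else 1)"

text \<open>The infinite product converges, so the constant is not an arbitrary default value.\<close>

lemma convergent_prod_twin_prime_const:
  "convergent_prod (\<lambda>p. if prime p \<and> p > 2 then 1 - 1 / (real p - 1)\<^sup>2 else 1)"
    (is "convergent_prod ?f")
proof -
  have bound: "norm (?f n - 1) \<le> 4 * inverse (real n ^ 2)" for n
  proof (cases "n > 2")
    case True
    then have "(real n / 2)\<^sup>2 \<le> (real n - 1)\<^sup>2"
      by (intro power_mono) auto
    with True have "1 / (real n - 1)\<^sup>2 \<le> 1 / (real n / 2)\<^sup>2"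
      by (intro divide_left_mono) auto
    with True show ?thesis
      by (auto simp: power_divide field_simps)
  qed simp
  have "summable (\<lambda>n. 4 * inverse (real n ^ 2))"
    by (intro summable_mult inverse_power_summable) auto
  then have "summable (\<lambda>n. norm (?f n - 1))"
    by (rule summable_comparison_test'[where N = 0]) (use bound in simp)
  then show ?thesis
    by (intro abs_convergent_prod_imp_convergent_prod summable_imp_abs_convergent_prod)
qed

definition singular_series :: "nat \<Rightarrow> real" where
  "singular_series k =
     (if even k
      then 2 * twin_prime_const *
             (\<Prod>p | prime p \<and> p dvd k \<and> p > 2. (real p - 1) / (real p - 2))
      else 0)"

definition S_sum :: "nat \<Rightarrow> real \<Rightarrow> real" where
  "S_sum m x = (\<Sum>k | 1 \<le> k \<and> real k \<le> x. (x - real k) ^ m * singular_series k)"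

definition E_err :: "nat \<Rightarrow> real \<Rightarrow> real" where
  "E_err m x = S_sum m x -
     (x ^ (m + 1) / (real m + 1)
       - x ^ m / 2 * (ln x - harm m + euler_mascheroni + ln (2 * pi)))"

end

theory Submission
  imports Defs "HOL-Complex_Analysis.Complex_Analysis"
begin

text \<open>
Write \<open>\<zeta>\<close> for the Riemann zeta function and \<open>D(s)\<close> for the Dirichlet series with the singular
series as coefficients. Its Euler product gives \<open>D(s) = 2 C\<^sub>2 \<zeta>(s) \<zeta>(s+1) L(s)\<close>, where
\<open>L(s) = 2\<^bsup>-s\<^esup> (1 + 5\<^bsup>-s\<^esup> / 3) K(s) / \<zeta>(2s+2)\<close> and \<open>K\<close> is an absolutely convergent product
for \<open>Re s > -1\<close>. The prime \<open>5\<close> is split off because it is the only prime whose factor has zeros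
with \<open>-3/4 \<le> Re s \<le> -1/2\<close>.

Termwise integration shows that the integral of \<open>E\<^sub>m(x) x\<^bsup>-m-1-s\<^esup>\<close> over \<open>x \<ge> 1\<close> is
\<open>m! D(s) / (s (s+1) \<dots> (s+m))\<close> minus the transform of the main term. The main term is exactly
what removes the pole at \<open>1\<close> and the double pole at \<open>0\<close>; this uses \<open>\<zeta>(0)\<close>, \<open>\<zeta>'(0)\<close> and the
constant term of \<open>\<zeta>\<close> at \<open>1\<close>. What remains is meromorphic for \<open>Re s > -1\<close>, its poles can only
lie at the points \<open>\<rho>/2 - 1\<close> with \<open>\<zeta>(\<rho>) = 0\<close>, and it has no real pole with \<open>s \<ge> -3/4\<close>
(lemma \<open>E_err_continuation\<close>).

Suppose that \<open>E\<^sub>m(x) \<le> c x\<^bsup>m-3/4\<^esup>\<close> held eventually for every \<open>c > 0\<close> (or the same for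
\<open>-E\<^sub>m\<close>). By Landau's theorem on integrals of functions of constant sign the integral would then
converge for \<open>Re s > -3/4\<close> and be \<open>o(1/h)\<close> at distance \<open>h\<close> from the boundary line, along every
horizontal line (lemma \<open>Landau_oscillation\<close>). Hence there could be no pole with
\<open>Re s \<ge> -3/4\<close>. By the functional equation there is a zero \<open>\<rho>\<close> with \<open>Re \<rho> \<ge> 1/2\<close> as soon as
there is any, so the real question is whether the zero of the denominator at \<open>\<rho>/2 - 1\<close> is
cancelled by the numerator. There the numerator vanishes to the order of \<open>\<zeta>\<close> at \<open>\<rho>/2\<close>, which
is its order at \<open>1 - \<rho>/2\<close>, plus one if the factor at \<open>5\<close> vanishes.

Not all zeros can be cancelled (theorem \<open>xi_uncancelled_zero\<close>). If they were, then \<open>\<rho> \<mapsto> 1 - \<rho>/2\<close>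
would map every zero with \<open>Re \<rho> \<ge> 1/2\<close> to another such zero, unless the factor at \<open>5\<close> vanishes
at \<open>\<rho>/2 - 1\<close>. Iterates of this map converge to \<open>2/3\<close>, where \<open>\<zeta>\<close> is not zero, so every orbit
would meet the zeros of \<open>1 + 5\<^bsup>-s\<^esup> / 3\<close>. These form one arithmetic progression on a vertical line. The zeros of
\<open>\<xi>\<close> would therefore be simple and lie in finitely many arithmetic progressions, and an entire
function of order below \<open>2\<close>, symmetric about \<open>1/2\<close> and with so few zeros, grows at most like
\<open>exp (C |s|)\<close> on the real axis. But \<open>\<xi>(2M) \<ge> M! / \<pi>\<^bsup>M\<^esup>\<close>.

The zeta function itself is built from the Mellin transform of \<open>1 / (e\<^sup>x - 1)\<close>, and its functional
equation comes from the partial fractions of the cotangent.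
\<close>

section \<open>Exponential transforms\<close>

text \<open>Expanding \<open>exp (-(s - c) h)\<close> into its power series may be done under the integral sign,
because the hypothesis bounds the integral of the absolute values of all terms at once.
The transform covers the Laplace transform, the Mellin transform (\<open>h = \<plusminus> ln\<close>), and
Dirichlet series.\<close>

lemma exp_transform_sums:
  fixes f :: "'a \<Rightarrow> complex" and h :: "'a \<Rightarrow> real"
  assumes [measurable]: "f \<in> borel_measurable M" "h \<in> borel_measurable M"
    and int: "integrable M (\<lambda>x. norm (f x) * exp (- Re c * h x + r * \<bar>h x\<bar>))"
    and s: "norm (s - c) \<le> r"
  shows "integrable M (\<lambda>x. f x * exp (- s * h x))"
    and "(\<lambda>k. (LINT x|M. f x * exp (- c * h x) * (- h x) ^ k / fact k) * (s - c) ^ k)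
           sums (LINT x|M. f x * exp (- s * h x))"
proof -
  have r: "r \<ge> 0" using s norm_ge_zero order_trans by blast
  define F where "F = (\<lambda>k x. f x * exp (- c * h x) * (- h x) ^ k / fact k * (s - c) ^ k)"
  have [measurable]: "F k \<in> borel_measurable M" for k
    unfolding F_def by measurable
  have nF: "norm (F k x) = norm (f x) * exp (- Re c * h x) * ((\<bar>h x\<bar> * norm (s - c)) ^ k / fact k)" for k x
    by (simp add: F_def norm_mult norm_divide norm_power power_mult_distrib field_simps)
  have sF: "(\<lambda>k. norm (F k x)) sums (norm (f x) * exp (- Re c * h x + \<bar>h x\<bar> * norm (s - c)))" for x
    unfolding nF exp_add mult.assoc[symmetric]
    by (intro sums_mult) (use exp_converges[of "\<bar>h x\<bar> * norm (s - c)"] in \<open>simp add: field_simps\<close>)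
  have le: "norm (f x) * exp (- Re c * h x + \<bar>h x\<bar> * norm (s - c))
           \<le> norm (f x) * exp (- Re c * h x + r * \<bar>h x\<bar>)" for x
    using mult_left_mono[OF s abs_ge_zero[of "h x"]] by (intro mult_left_mono) (auto simp: mult.commute)
  have intF: "integrable M (F k)" for k
  proof (rule Bochner_Integration.integrable_bound[OF int])
    show "AE x in M. norm (F k x) \<le> norm (norm (f x) * exp (- Re c * h x + r * \<bar>h x\<bar>))"
    proof (rule AE_I2)
      fix x
      have "norm (F k x) \<le> (\<Sum>k. norm (F k x))"
        using sum_le_suminf[of "\<lambda>k. norm (F k x)" "{k}"] sF[of x] by (auto simp: sums_iff)
      also have "\<dots> = norm (f x) * exp (- Re c * h x + \<bar>h x\<bar> * norm (s - c))"
        using sF[of x] by (simp add: sums_iff)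
      also note le
      finally show "norm (F k x) \<le> norm (norm (f x) * exp (- Re c * h x + r * \<bar>h x\<bar>))"
        by simp
    qed
  qed simp
  have exps: "(\<lambda>k. F k x) sums (f x * exp (- s * h x))" for x
  proof -
    have "(\<lambda>k. f x * exp (- c * h x) * ((- h x * (s - c)) ^ k /\<^sub>R fact k)) sums
            (f x * exp (- c * h x) * exp (- h x * (s - c)))"
      by (intro sums_mult exp_converges)
    moreover have "f x * exp (- c * h x) * exp (- h x * (s - c)) = f x * exp (- s * h x)"
      by (simp add: mult.assoc flip: exp_add) (simp add: algebra_simps)
    moreover have "f x * exp (- c * h x) * ((- h x * (s - c)) ^ k /\<^sub>R fact k) = F k x" for k
      unfolding F_def power_mult_distrib scaleR_conv_of_real by (simp add: field_simps)
    ultimately show ?thesis by (simp only:)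
  qed
  have sumint: "summable (\<lambda>k. LINT x|M. norm (F k x))"
  proof (rule bounded_imp_summable)
    fix n
    have "(\<Sum>k\<le>n. LINT x|M. norm (F k x)) = (LINT x|M. (\<Sum>k\<le>n. norm (F k x)))"
      by (rule Bochner_Integration.integral_sum[symmetric]) (use intF in auto)
    also have "\<dots> \<le> (LINT x|M. norm (f x) * exp (- Re c * h x + r * \<bar>h x\<bar>))"
    proof (rule integral_mono[OF _ int])
      fix x
      have "(\<Sum>k\<le>n. norm (F k x)) \<le> (\<Sum>k. norm (F k x))"
        by (rule sum_le_suminf) (use sF[of x] in \<open>auto simp: sums_iff\<close>)
      also have "\<dots> = norm (f x) * exp (- Re c * h x + \<bar>h x\<bar> * norm (s - c))"
        using sF[of x] by (simp add: sums_iff)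
      finally show "(\<Sum>k\<le>n. norm (F k x)) \<le> norm (f x) * exp (- Re c * h x + r * \<bar>h x\<bar>)"
        using le order_trans by blast
    qed (use intF in auto)
    finally show "(\<Sum>k\<le>n. LINT x|M. norm (F k x)) \<le> (LINT x|M. norm (f x) * exp (- Re c * h x + r * \<bar>h x\<bar>))" .
  qed auto
  have AEs: "AE x in M. summable (\<lambda>k. norm (F k x))"
    using sF by (auto simp: sums_iff)
  have eq: "(\<lambda>x. \<Sum>k. F k x) = (\<lambda>x. f x * exp (- s * h x))"
    using exps by (auto simp: sums_iff)
  show "integrable M (\<lambda>x. f x * exp (- s * h x))"
    using integrable_suminf[OF intF AEs sumint] unfolding eq .
  have "(\<lambda>k. integral\<^sup>L M (F k)) sums (LINT x|M. (\<Sum>k. F k x))"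
    using sums_integral[OF intF AEs sumint] .
  moreover have "integral\<^sup>L M (F k) = (LINT x|M. f x * exp (- c * h x) * (- h x) ^ k / fact k) * (s - c) ^ k" for k
    unfolding F_def by simp
  ultimately show "(\<lambda>k. (LINT x|M. f x * exp (- c * h x) * (- h x) ^ k / fact k) * (s - c) ^ k)
           sums (LINT x|M. f x * exp (- s * h x))"
    unfolding eq by simp
qed

text \<open>Near the centre \<open>c\<close> of a small disc, \<open>exp (r \<bar>h\<bar>) \<le> exp (r h) + exp (- r h)\<close> turns the
assumed integrability on two vertical lines into the majorant needed for the power series.\<close>

lemma exp_transform_holomorphic:
  fixes f :: "'a \<Rightarrow> complex" and h :: "'a \<Rightarrow> real"
  assumes [measurable]: "f \<in> borel_measurable M" "h \<in> borel_measurable M"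
    and int: "\<And>\<sigma>. a < \<sigma> \<Longrightarrow> \<sigma> < b \<Longrightarrow> integrable M (\<lambda>x. norm (f x) * exp (- \<sigma> * h x))"
  shows "(\<lambda>s. LINT x|M. f x * exp (- s * h x)) holomorphic_on {s. a < Re s \<and> Re s < b}"
proof -
  let ?g = "\<lambda>s. LINT x|M. f x * exp (- s * complex_of_real (h x))"
  have "\<exists>r>0. ?g holomorphic_on ball c r" if c: "a < Re c" "Re c < b" for c
  proof -
    define r where "r = min (Re c - a) (b - Re c) / 2"
    have r: "r > 0" "a < Re c - r" "Re c + r < b" using c by (auto simp: r_def min_def field_simps)
    have "integrable M (\<lambda>x. norm (f x) * exp (- Re c * h x + r * \<bar>h x\<bar>))"
    proof (rule Bochner_Integration.integrable_bound)
      show "integrable M (\<lambda>x. norm (f x) * exp (- (Re c - r) * h x) + norm (f x) * exp (- (Re c + r) * h x))"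
        by (intro Bochner_Integration.integrable_add int) (use r in auto)
      show "AE x in M. norm (norm (f x) * exp (- Re c * h x + r * \<bar>h x\<bar>))
              \<le> norm (norm (f x) * exp (- (Re c - r) * h x) + norm (f x) * exp (- (Re c + r) * h x))"
      proof (rule AE_I2)
        fix x
        have "exp (- Re c * h x + r * \<bar>h x\<bar>) \<le> exp (- (Re c - r) * h x) + exp (- (Re c + r) * h x)"
          by (auto simp: abs_if algebra_simps)
        then have "norm (f x) * exp (- Re c * h x + r * \<bar>h x\<bar>)
            \<le> norm (f x) * (exp (- (Re c - r) * h x) + exp (- (Re c + r) * h x))"
          by (intro mult_left_mono) auto
        then show "norm (norm (f x) * exp (- Re c * h x + r * \<bar>h x\<bar>))
              \<le> norm (norm (f x) * exp (- (Re c - r) * h x) + norm (f x) * exp (- (Re c + r) * h x))"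
          by (simp add: distrib_left)
      qed
    qed measurable
    note * = exp_transform_sums(2)[OF assms(1,2) this]
    have "?g holomorphic_on ball c r"
    proof (rule power_series_holomorphic)
      fix w assume "w \<in> ball c r"
      then have "norm (w - c) \<le> r" by (auto simp: dist_norm norm_minus_commute)
      from *[OF this] show "(\<lambda>n. (LINT x|M. f x * exp (- c * h x) * (- h x) ^ n / fact n) * (w - c) ^ n) sums ?g w" .
    qed
    with r show ?thesis by blast
  qed
  then have "?g analytic_on {s. a < Re s \<and> Re s < b}"
    unfolding analytic_on_def by auto
  then show ?thesis by (rule analytic_imp_holomorphic)
qed

lemma exp_transform_holomorphic_halfplane:
  fixes f :: "'a \<Rightarrow> complex" and h :: "'a \<Rightarrow> real"
  assumes "f \<in> borel_measurable M" "h \<in> borel_measurable M"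
    and int: "\<And>\<sigma>. a < \<sigma> \<Longrightarrow> integrable M (\<lambda>x. norm (f x) * exp (- \<sigma> * h x))"
  shows "(\<lambda>s. LINT x|M. f x * exp (- s * h x)) holomorphic_on {s. a < Re s}"
proof -
  let ?g = "\<lambda>s. LINT x|M. f x * exp (- s * complex_of_real (h x))"
  have hol: "?g holomorphic_on {s. a < Re s \<and> Re s < b}" for b
    by (rule exp_transform_holomorphic) (use assms in auto)
  have "\<exists>e>0. ?g holomorphic_on ball s e" if "Re s > a" for s
  proof -
    have "open {z. a < Re z \<and> Re z < Re s + 1}"
      using open_Int[OF open_halfspace_Re_gt open_halfspace_Re_lt] by (simp add: Int_def)
    then obtain e where "e > 0" "ball s e \<subseteq> {z. a < Re z \<and> Re z < Re s + 1}"
      by (rule openE[of _ s]) (use \<open>Re s > a\<close> in simp)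
    then show ?thesis using hol holomorphic_on_subset by blast
  qed
  then have "?g analytic_on {s. Re s > a}" unfolding analytic_on_def by auto
  then show ?thesis by (rule analytic_imp_holomorphic)
qed

lemma holomorphic_eq_if_eq_on_real_interval:
  assumes "f holomorphic_on S" "g holomorphic_on S" "open S" "connected S"
    and "p < q" and sub: "\<And>x. p < x \<Longrightarrow> x < q \<Longrightarrow> complex_of_real x \<in> S"
    and eq: "\<And>x. p < x \<Longrightarrow> x < q \<Longrightarrow> f (of_real x) = g (of_real x)"
    and "z \<in> S"
  shows "f z = g z"
proof -
  let ?U = "complex_of_real ` {p<..<q}"
  have "complex_of_real ((p + q) / 2) islimpt ?U"
  proof -
    have "(p + q) / 2 islimpt {p<..<q}"
      using \<open>p < q\<close> by (intro interior_limit_point) auto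
    then show ?thesis
      unfolding islimpt_approachable
      by (simp add: dist_of_real del: of_real_divide of_real_add)
  qed
  moreover have "complex_of_real ((p + q) / 2) \<in> S"
    using \<open>p < q\<close> by (intro sub) auto
  moreover have "?U \<subseteq> S" using sub by auto
  moreover have "(\<lambda>z. f z - g z) holomorphic_on S"
    using assms(1,2) by (intro holomorphic_intros)
  ultimately have "f z - g z = 0"
    using analytic_continuation[of "\<lambda>z. f z - g z" S ?U _ z] assms(3,4,8) eq by force
  then show ?thesis by simp
qed

text \<open>Comparing coefficients of two expansions with possibly different radii is how the moments of a
transform will be identified with derivatives of its continuation.\<close>

lemma powser_coeffs_unique:
  fixes F :: "complex \<Rightarrow> complex"
  assumes "r > 0" "\<And>w. norm w < r \<Longrightarrow> (\<lambda>n. a n * w ^ n) sums F w"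
    and "r' > 0" "\<And>w. norm w < r' \<Longrightarrow> (\<lambda>n. b n * w ^ n) sums F w"
  shows "a = b"
proof -
  have ev: "F has_fps_expansion Abs_fps d" if "t > 0" "\<And>w. norm w < t \<Longrightarrow> (\<lambda>n. d n * w ^ n) sums F w" for t d
    using that by (auto intro!: has_fps_expansionI exI[of _ t] simp: eventually_nhds_metric dist_norm)
  have "F has_fps_expansion Abs_fps a" "F has_fps_expansion Abs_fps b"
    using ev assms by blast+
  then have "Abs_fps a = Abs_fps b" by (rule fps_expansion_unique_complex)
  then show ?thesis by (simp add: fps_eq_iff fun_eq_iff)
qed

text \<open>Landau's theorem: a transform of a nonnegative function cannot be continued analytically
along the real axis past its abscissa of convergence \<open>s\<close>. The Taylor coefficients at a point \<open>c\<close>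
just to the right of \<open>s\<close> have alternating signs, so at the real point \<open>c - t < s\<close> the Taylor
series of the continuation is a series of nonnegative moments; summing it under the integral sign
yields convergence of the integral at \<open>c - t\<close>.\<close>

lemma Landau_nonneg_transform:
  fixes f h :: "'a \<Rightarrow> real" and \<Psi> :: "complex \<Rightarrow> complex"
  assumes meas [measurable]: "f \<in> borel_measurable M" "h \<in> borel_measurable M"
    and nonneg: "\<And>x. f x \<ge> 0" "\<And>x. x \<in> space M \<Longrightarrow> h x \<ge> 0"
    and "a < b" and int: "\<And>\<sigma>. b < \<sigma> \<Longrightarrow> integrable M (\<lambda>x. f x * exp (- \<sigma> * h x))"
    and U: "open U" "\<And>\<sigma>. a < \<sigma> \<Longrightarrow> complex_of_real \<sigma> \<in> U"
    and hol: "\<Psi> holomorphic_on U"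
    and eq: "\<And>\<sigma>. b < \<sigma> \<Longrightarrow> \<Psi> (of_real \<sigma>) = of_real (LINT x|M. f x * exp (- \<sigma> * h x))"
    and "a < \<sigma>"
  shows "integrable M (\<lambda>x. f x * exp (- \<sigma> * h x))"
proof (rule ccontr)
  assume not: "\<not> integrable M (\<lambda>x. f x * exp (- \<sigma> * h x))"
  define I where "I = {t. integrable M (\<lambda>x. f x * exp (- t * h x))}"
  have up: "t' \<in> I" if "t \<in> I" "t \<le> t'" for t t'
    unfolding I_def mem_Collect_eq
  proof (rule Bochner_Integration.integrable_bound)
    show "integrable M (\<lambda>x. f x * exp (- t * h x))" using that by (simp add: I_def)
    show "AE x in M. norm (f x * exp (- t' * h x)) \<le> norm (f x * exp (- t * h x))"
      using that nonneg by (intro AE_I2) (auto simp: abs_mult intro!: mult_left_mono mult_right_mono)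
  qed measurable
  have lower: "\<sigma> \<le> t" if "t \<in> I" for t
    using up[OF that, of \<sigma>] not by (force simp: I_def)
  have bI: "t \<in> I" if "b < t" for t using int[OF that] by (simp add: I_def)
  define s where "s = Inf I"
  have ne: "I \<noteq> {}" "bdd_below I" using bI[of "b+1"] lower by (auto simp: bdd_below_def)
  have s_ge: "\<sigma> \<le> s" unfolding s_def using ne lower by (intro cInf_greatest) auto
  have s_le: "s \<le> t" if "t \<in> I" for t unfolding s_def using that ne by (intro cInf_lower)
  have sb: "s \<le> b" by (rule dense_ge) (use bI s_le in auto)
  have inI: "t \<in> I" if "s < t" for t
    using that ne up unfolding s_def by (metis cInf_lessD less_imp_le)
  have "a < s" using s_ge \<open>a < \<sigma>\<close> by simp
  have "compact (complex_of_real ` {s..b+1})"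
    by (intro compact_continuous_image continuous_intros) auto
  moreover have "complex_of_real ` {s..b+1} \<subseteq> U" using U(2) \<open>a < s\<close> by auto
  ultimately obtain e0 where e0: "e0 > 0" "(\<Union>x\<in>complex_of_real ` {s..b+1}. ball x e0) \<subseteq> U"
    using compact_subset_open_imp_ball_epsilon_subset U(1) by metis
  define e where "e = min 1 e0"
  have e: "e > 0" "e \<le> 1" using e0 by (auto simp: e_def)
  have eU: "z \<in> U" if "x \<in> {s..b+1}" "norm (z - of_real x) < e" for x z
    using e0(2) that unfolding e_def by (force simp: dist_norm norm_minus_commute)
  define \<phi> where "\<phi> = (\<lambda>z. LINT x|M. complex_of_real (f x) * exp (- z * of_real (h x)))"
  have mf: "(\<lambda>x. complex_of_real (f x)) \<in> borel_measurable M" by measurable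
  define V where "V = {z. s < Re z \<and> Re z < b + 1 \<and> \<bar>Im z\<bar> < e}"
  have V: "V = {z. s < Re z} \<inter> {z. Re z < b + 1} \<inter> {z. Im z < e} \<inter> {z. - e < Im z}"
    by (auto simp: V_def)
  have oV: "open V" unfolding V
    by (intro open_Int open_halfspace_Re_gt open_halfspace_Re_lt open_halfspace_Im_gt open_halfspace_Im_lt)
  have cV: "connected V" unfolding V
    by (intro convex_connected convex_Int convex_halfspace_Re_gt convex_halfspace_Re_lt
         convex_halfspace_Im_gt convex_halfspace_Im_lt)
  have VU: "V \<subseteq> U"
  proof
    fix z assume "z \<in> V"
    then show "z \<in> U" using eU[of "Re z" z] by (auto simp: V_def cmod_eq_Im)
  qed
  have \<phi>hol: "\<phi> holomorphic_on V"
    unfolding \<phi>_def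
  proof (rule holomorphic_on_subset[OF exp_transform_holomorphic[of _ _ _ s "b+1"]])
    fix t assume "s < t"
    then show "integrable M (\<lambda>x. norm (complex_of_real (f x)) * exp (- t * h x))"
      using inI[of t] nonneg by (simp add: I_def abs_of_nonneg)
  qed (auto simp: V_def)
  have \<phi>\<Psi>: "\<phi> z = \<Psi> z" if "z \<in> V" for z
  proof (rule holomorphic_eq_if_eq_on_real_interval[OF \<phi>hol _ oV cV, of \<Psi> b "b+1"])
    show "\<Psi> holomorphic_on V" using hol VU holomorphic_on_subset by blast
    fix x assume x: "b < x" "x < b + 1"
    then show "complex_of_real x \<in> V" using sb e by (auto simp: V_def)
    have "\<phi> (of_real x) = (LINT y|M. complex_of_real (f y * exp (- x * h y)))"
      by (simp add: \<phi>_def flip: exp_of_real)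
    also have "\<dots> = of_real (LINT y|M. f y * exp (- x * h y))" by (rule integral_complex_of_real)
    finally show "\<phi> (of_real x) = \<Psi> (of_real x)" using eq x by simp
  qed (use that in auto)
  (* The continuation is holomorphic within distance e/2 of c, while the integral is only known to
     the right of s = c - e/4; the point c - t with t = 3 e / 8 lies between these two limits. *)
  define c where "c = s + e / 4"
  have sc: "s < c - e/8" using e by (simp add: c_def)
  define A where "A = (\<lambda>k. LINT x|M. f x * exp (- c * h x) * h x ^ k / fact k)"
  have intc: "integrable M (\<lambda>x. norm (complex_of_real (f x)) * exp (- Re (of_real c) * h x + e/8 * \<bar>h x\<bar>))"
  proof -
    have "integrable M (\<lambda>x. f x * exp (- (c - e/8) * h x))"
      using inI[OF sc] unfolding I_def mem_Collect_eq .
    then show ?thesis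
      by (rule Bochner_Integration.integrable_cong[THEN iffD1, rotated -1])
         (use nonneg in \<open>auto simp: algebra_simps\<close>)
  qed
  (* two expansions of the continuation about c: by moments, and by Taylor's theorem on a larger disc *)
  have A1: "(\<lambda>k. of_real ((-1)^k * A k) * w ^ k) sums \<Psi> (of_real c + w)" if "norm w < e / 8" for w
  proof -
    have "norm (of_real c + w - of_real c) \<le> e/8" using that by simp
    note * = exp_transform_sums(2)[OF mf meas(2) intc this]
    have "of_real c + w \<in> V"
      using that e sb abs_Re_le_cmod[of w] abs_Im_le_cmod[of w]
      by (auto simp: V_def c_def field_simps abs_le_iff)
    then have "(LINT x|M. complex_of_real (f x) * exp (- (of_real c + w) * of_real (h x))) = \<Psi> (of_real c + w)"
      by (rule \<phi>\<Psi>[unfolded \<phi>_def])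
    moreover have "(LINT x|M. complex_of_real (f x) * exp (- complex_of_real c * of_real (h x)) * of_real ((- h x) ^ k) / fact k)
       = of_real ((-1)^k * A k)" for k
    proof -
      have "(LINT x|M. complex_of_real (f x) * exp (- complex_of_real c * of_real (h x)) * of_real ((- h x) ^ k) / fact k)
        = (LINT x|M. complex_of_real ((-1)^k * (f x * exp (- c * h x) * h x ^ k / fact k)))"
        by (intro Bochner_Integration.integral_cong) (auto simp: exp_of_real[symmetric] power_minus[of "h _"] power_minus[of "complex_of_real (h _)"])
      also have "\<dots> = of_real ((-1)^k * A k)" unfolding A_def
        by (subst integral_complex_of_real, subst integral_mult_right_zero, rule refl)
      finally show ?thesis .
    qed
    ultimately show ?thesis using * by simp
  qed
  have ballU: "ball (of_real c) (e/2) \<subseteq> U"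
  proof
    fix z assume "z \<in> ball (complex_of_real c) (e/2)"
    then show "z \<in> U" using eU[of c z] e sb by (auto simp: c_def dist_norm norm_minus_commute)
  qed
  have A2: "(\<lambda>k. (deriv ^^ k) \<Psi> (of_real c) / fact k * w ^ k) sums \<Psi> (of_real c + w)" if "norm w < e / 2" for w
    using holomorphic_power_series[OF holomorphic_on_subset[OF hol ballU], of "of_real c + w"] that
    by (simp add: dist_norm)
  have coeff: "(\<lambda>k. of_real ((-1)^k * A k)) = (\<lambda>k. (deriv ^^ k) \<Psi> (of_real c) / fact k)"
    by (rule powser_coeffs_unique[of "e/8" _ _ "e/2", OF _ A1 _ A2]) (use e in auto)
  define t where "t = 3 * e / 8"
  have t: "t > 0" "c - t < s" using e by (auto simp: t_def c_def)
  have "(\<lambda>k. of_real ((-1)^k * A k) * (- complex_of_real t) ^ k) sums \<Psi> (of_real c - of_real t)"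
    using A2[of "- complex_of_real t"] e unfolding fun_cong[OF coeff, symmetric] by (simp add: t_def)
  moreover have "of_real ((-1)^k * A k) * (- complex_of_real t) ^ k = of_real (A k * t ^ k)" for k
    by (cases "even k") simp_all
  ultimately have "summable (\<lambda>k. complex_of_real (A k * t ^ k))"
    by (simp only: sums_iff)
  then have sumA: "summable (\<lambda>k. A k * t ^ k)" by (simp only: summable_complex_of_real)
  have icoef: "integrable M (\<lambda>x. f x * exp (- c * h x) * h x ^ k / fact k * t ^ k)" for k
  proof -
    have "integrable M (\<lambda>x. f x * exp (- (c - e/8) * h x) * (fact k / (e/8)^k * (1 / fact k * t^k)))"
      using inI[OF sc] unfolding I_def mem_Collect_eq by (intro integrable_mult_left)
    then show ?thesis
    proof (rule Bochner_Integration.integrable_bound)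
      show "AE x in M. norm (f x * exp (- c * h x) * h x ^ k / fact k * t ^ k)
         \<le> norm (f x * exp (- (c - e/8) * h x) * (fact k / (e/8)^k * (1 / fact k * t^k)))"
      proof (rule AE_I2)
        fix x assume x: "x \<in> space M"
        have "(e/8 * h x) ^ k / fact k \<le> exp (e/8 * h x)"
        proof -
          have "(\<lambda>n. (e/8 * h x) ^ n / fact n) sums exp (e/8 * h x)"
            using exp_converges[of "e/8 * h x"] by (simp add: field_simps)
          then show ?thesis
            using sum_le_suminf[of "\<lambda>n. (e/8 * h x) ^ n / fact n" "{k}"] nonneg(2)[OF x] e
            by (auto simp: sums_iff)
        qed
        then have "h x ^ k \<le> fact k / (e/8)^k * exp (e/8 * h x)"
          using e by (simp add: power_mult_distrib field_simps)
        then have "f x * exp (- c * h x) * h x ^ k * (1 / fact k * t^k)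
          \<le> f x * exp (- c * h x) * (fact k / (e/8)^k * exp (e/8 * h x)) * (1 / fact k * t^k)"
          using nonneg t by (intro mult_right_mono mult_left_mono) auto
        also have "\<dots> = f x * exp (- (c - e/8) * h x) * (fact k / (e/8)^k * (1 / fact k * t^k))"
        proof -
          have "exp (- (c - e/8) * h x) = exp (- c * h x) * exp (e/8 * h x)"
            by (simp add: algebra_simps flip: exp_add)
          then show ?thesis by (simp add: mult_ac)
        qed
        finally show "norm (f x * exp (- c * h x) * h x ^ k / fact k * t ^ k)
         \<le> norm (f x * exp (- (c - e/8) * h x) * (fact k / (e/8)^k * (1 / fact k * t^k)))"
          using nonneg(1)[of x] nonneg(2)[OF x] t e by (simp add: abs_mult mult_ac)
      qed
    qed measurable
  qed
  have ser: "(\<lambda>k. f x * exp (- c * h x) * h x ^ k / fact k * t ^ k) sums (f x * exp (- (c - t) * h x))" for x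
  proof -
    have "(\<lambda>k. f x * exp (- c * h x) * ((h x * t) ^ k /\<^sub>R fact k)) sums (f x * exp (- c * h x) * exp (h x * t))"
      by (intro sums_mult exp_converges)
    then show ?thesis
      by (simp add: power_mult_distrib field_simps flip: exp_add)
  qed
  have "integrable M (\<lambda>x. \<Sum>k. f x * exp (- c * h x) * h x ^ k / fact k * t ^ k)"
  proof (rule integrable_suminf[OF icoef])
    show "AE x in M. summable (\<lambda>k. norm (f x * exp (- c * h x) * h x ^ k / fact k * t ^ k))"
    proof (rule AE_I2)
      fix x assume x: "x \<in> space M"
      have "norm (f x * exp (- c * h x) * h x ^ k / fact k * t ^ k) = f x * exp (- c * h x) * h x ^ k / fact k * t ^ k" for k
        using nonneg(1)[of x] nonneg(2)[OF x] t by simp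
      then show "summable (\<lambda>k. norm (f x * exp (- c * h x) * h x ^ k / fact k * t ^ k))"
        using ser[of x] by (simp add: sums_iff)
    qed
    have "(LINT x|M. norm (f x * exp (- c * h x) * h x ^ k / fact k * t ^ k)) = A k * t ^ k" for k
    proof -
      have "(LINT x|M. norm (f x * exp (- c * h x) * h x ^ k / fact k * t ^ k)) = (LINT x|M. f x * exp (- c * h x) * h x ^ k / fact k * t ^ k)"
        using nonneg t by (intro Bochner_Integration.integral_cong) auto
      then show ?thesis by (simp add: A_def)
    qed
    then show "summable (\<lambda>k. LINT x|M. norm (f x * exp (- c * h x) * h x ^ k / fact k * t ^ k))"
      using sumA by simp
  qed
  also have "(\<lambda>x. \<Sum>k. f x * exp (- c * h x) * h x ^ k / fact k * t ^ k) = (\<lambda>x. f x * exp (- (c - t) * h x))"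
    by (intro ext sums_unique[symmetric] ser)
  finally have "c - t \<in> I" unfolding I_def mem_Collect_eq .
  with s_le[of "c - t"] t show False by simp
qed

section \<open>Partial fractions and Gamma integrals\<close>

text \<open>This is the logarithmic derivative of the reflection formula for the Gamma function.\<close>

lemma Digamma_cot:
  fixes z :: complex
  assumes "z \<notin> \<int>"
  shows "Digamma (1 + z) - Digamma (1 - z) = 1 / z - of_real pi * cos (of_real pi * z) / sin (of_real pi * z)"
proof -
  have z: "z \<notin> \<int>\<^sub>\<le>\<^sub>0" "1 - z \<notin> \<int>\<^sub>\<le>\<^sub>0" "z \<noteq> 0"
    using assms by (auto dest: nonpos_Ints_Int)
  have refl: "rGamma w * rGamma (1 - w) = sin (of_real pi * w) / of_real pi" for w :: complex
    by (rule rGamma_reflection_complex)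
  have "((\<lambda>w. rGamma w * rGamma (1 - w)) has_field_derivative
     - rGamma z * Digamma z * rGamma (1 - z) + rGamma z * (rGamma (1 - z) * Digamma (1 - z))) (at z)"
    by (auto intro!: derivative_eq_intros simp: z algebra_simps)
  moreover have "((\<lambda>w. rGamma w * rGamma (1 - w)) has_field_derivative cos (of_real pi * z)) (at z)"
    unfolding refl by (auto intro!: derivative_eq_intros)
  ultimately have "- rGamma z * Digamma z * rGamma (1 - z) + rGamma z * (rGamma (1 - z) * Digamma (1 - z)) = cos (of_real pi * z)"
    by (rule DERIV_unique)
  then have "(rGamma z * rGamma (1 - z)) * (Digamma (1 - z) - Digamma z) = cos (of_real pi * z)"
    by (simp add: algebra_simps)
  moreover have "sin (of_real pi * z) \<noteq> 0"
    using assms by (auto simp: sin_eq_0 complex_is_Int_iff)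
  ultimately have "Digamma (1 - z) - Digamma z = of_real pi * cos (of_real pi * z) / sin (of_real pi * z)"
    unfolding refl by (simp add: field_simps)
  then show ?thesis using Digamma_plus1[OF z(3)] by (simp add: algebra_simps)
qed

lemma cot_partial_fractions:
  fixes z :: complex
  assumes "z \<notin> \<int>"
  shows "(\<lambda>n. 2 * z / (of_nat (Suc n) ^ 2 - z ^ 2)) sums
           (1 / z - of_real pi * cos (of_real pi * z) / sin (of_real pi * z))"
proof -
  have nz: "of_nat (Suc n) + z \<noteq> 0" "of_nat (Suc n) - z \<noteq> 0" for n
    using assms by (metis Ints_minus Ints_of_nat add.inverse_inverse add_eq_0_iff, metis Ints_of_nat eq_iff_diff_eq_0)
  have z: "1 + z \<noteq> 0" "1 - z \<noteq> 0" using nz[of 0] by auto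
  have s: "(\<lambda>n. inverse (of_nat (Suc n)) - inverse (w + of_nat n)) sums (Digamma w + euler_mascheroni)"
    if "w \<noteq> 0" for w :: complex
    using summable_Digamma[OF that] by (simp add: Digamma_def sums_iff)
  have "(\<lambda>n. (inverse (of_nat (Suc n)) - inverse (1 + z + of_nat n)) - (inverse (of_nat (Suc n)) - inverse (1 - z + of_nat n)))
     sums ((Digamma (1 + z) + euler_mascheroni) - (Digamma (1 - z) + euler_mascheroni))"
    by (intro sums_diff s z)
  moreover have "(inverse (of_nat (Suc n)) - inverse (1 + z + of_nat n)) - (inverse (of_nat (Suc n)) - inverse (1 - z + of_nat n))
     = 2 * z / (of_nat (Suc n) ^ 2 - z ^ 2)" for n
  proof -
    have "of_nat (Suc n) ^ 2 - z ^ 2 = (of_nat (Suc n) + z) * (of_nat (Suc n) - z)"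
      by (simp add: power2_eq_square algebra_simps)
    then show ?thesis using nz[of n] by (simp add: field_simps)
  qed
  ultimately show ?thesis using Digamma_cot[OF assms] by simp
qed

text \<open>The cotangent at an imaginary argument is a hyperbolic cotangent, that is, an affine function of
\<open>1 / (exp x - 1)\<close>. This expansion is the source of the functional equation of zeta.\<close>

lemma bose_partial_fractions:
  fixes x :: real
  assumes "x > 0"
  shows "(\<lambda>n. 2 * x / (x\<^sup>2 + (2 * pi * real (Suc n))\<^sup>2)) sums (1 / (exp x - 1) - 1 / x + 1 / 2)"
proof -
  define y where "y = x / (2 * pi)"
  have y: "y > 0" using assms by (simp add: y_def)
  let ?z = "\<i> * complex_of_real y"
  have nI: "?z \<notin> \<int>" using y by (auto simp: complex_is_Int_iff)
  have ex: "exp x > 1" using assms by simp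
  have sinz: "sin (of_real pi * ?z) = \<i> * of_real ((exp (x/2) - exp (-x/2)) / 2)"
    and cosz: "cos (of_real pi * ?z) = of_real ((exp (x/2) + exp (-x/2)) / 2)"
    using assms by (simp_all add: y_def sin_exp_eq cos_exp_eq exp_of_real[symmetric] field_simps)
  have "(\<lambda>n. 2 * ?z / (of_nat (Suc n) ^ 2 - ?z ^ 2)) sums
           (1 / ?z - of_real pi * cos (of_real pi * ?z) / sin (of_real pi * ?z))"
    by (rule cot_partial_fractions[OF nI])
  then have "(\<lambda>n. (2 * ?z / (of_nat (Suc n) ^ 2 - ?z ^ 2)) * (- \<i> / (2 * of_real pi))) sums
           ((1 / ?z - of_real pi * cos (of_real pi * ?z) / sin (of_real pi * ?z)) * (- \<i> / (2 * of_real pi)))"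
    by (rule sums_mult2)
  moreover have "(2 * ?z / (of_nat (Suc n) ^ 2 - ?z ^ 2)) * (- \<i> / (2 * of_real pi)) =
      of_real (2 * x / (x\<^sup>2 + (2 * pi * real (Suc n))\<^sup>2))" for n
  proof -
    have "(2 * ?z / (of_nat (Suc n) ^ 2 - ?z ^ 2)) * (- \<i> / (2 * of_real pi)) = of_real (y / (pi * (real (Suc n) ^ 2 + y ^ 2)))"
    proof -
      have "of_nat (Suc n) ^ 2 - ?z ^ 2 = of_real (real (Suc n) ^ 2 + y ^ 2)"
        by (simp add: power_mult_distrib)
      moreover have "2 * ?z / w * (- \<i> / (2 * of_real pi)) = of_real y / (of_real pi * w)" for w
        by (simp add: field_simps)
      ultimately show ?thesis by (simp only: of_real_divide of_real_mult)
    qed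
    also have "y / (pi * (real (Suc n) ^ 2 + y ^ 2)) = 2 * x / (x\<^sup>2 + (2 * pi * real (Suc n))\<^sup>2)"
    proof -
      have "pi * (real (Suc n) ^ 2 + y ^ 2) > 0" "x\<^sup>2 + (2 * pi * real (Suc n))\<^sup>2 > 0"
        using y assms by (auto intro!: mult_pos_pos add_nonneg_pos add_pos_nonneg)
      then show ?thesis unfolding y_def
        by (simp add: divide_simps) (simp add: algebra_simps power2_eq_square)
    qed
    finally show ?thesis .
  qed
  moreover have "(1 / ?z - of_real pi * cos (of_real pi * ?z) / sin (of_real pi * ?z)) * (- \<i> / (2 * of_real pi))
     = of_real (1 / (exp x - 1) - 1 / x + 1 / 2)"
  proof -
    have e: "exp (x/2) * exp (x/2) = exp x" "exp (-x/2) = 1 / exp (x/2)" 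
      by (simp_all add: exp_minus field_simps flip: exp_add)
    have gt: "exp (x/2) > 1" using assms by simp
    have gen: "(1 / (\<i> * of_real y) - of_real pi * of_real C / (\<i> * of_real S)) * (- \<i> / (2 * of_real pi))
      = complex_of_real (- 1 / (2 * pi * y) + C / S / 2)" if "S \<noteq> 0" for C S
      using that y by (simp add: field_simps)
    have "exp (x/2) > exp (-x/2)" using assms by simp
    then have "(1 / ?z - of_real pi * cos (of_real pi * ?z) / sin (of_real pi * ?z)) * (- \<i> / (2 * of_real pi))
      = of_real (- 1 / (2 * pi * y) + ((exp (x/2) + exp (-x/2)) / 2) / ((exp (x/2) - exp (-x/2)) / 2) / 2)"
      unfolding sinz cosz by (intro gen) simp
    also have "- 1 / (2 * pi * y) = - 1 / x" by (simp add: y_def)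
    also have "((exp (x/2) + exp (-x/2)) / 2) / ((exp (x/2) - exp (-x/2)) / 2) = (exp x + 1) / (exp x - 1)"
      using gt ex unfolding e(2) by (simp add: field_simps e(1))
    also have "- 1 / x + (exp x + 1) / (exp x - 1) / 2 = 1 / (exp x - 1) - 1 / x + 1 / 2"
      using ex by (simp add: field_simps)
    finally show ?thesis .
  qed
  ultimately have "(\<lambda>n. complex_of_real (2 * x / (x\<^sup>2 + (2 * pi * real (Suc n))\<^sup>2))) sums
      of_real (1 / (exp x - 1) - 1 / x + 1 / 2)" by simp
  then show ?thesis by (simp only: sums_of_real_iff)
qed

lemma nn_integral_Gamma_scaled:
  assumes "q > 0" "c > (0::real)"
  shows "(\<integral>\<^sup>+u. ennreal (indicator {0<..} u * (u powr (q - 1) * exp (- c * u))) \<partial>lborel) = ennreal (Gamma q * c powr (- q))"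
proof -
  let ?f = "\<lambda>t. indicator {0..} t * t powr (q - 1) / exp t"
  have "ennreal (Gamma q) = (\<integral>\<^sup>+t. ennreal (?f t) \<partial>lborel)"
    using Gamma_conv_nn_integral_real[OF assms(1)] .
  also have "\<dots> = ennreal \<bar>c\<bar> * (\<integral>\<^sup>+u. ennreal (?f (0 + c * u)) \<partial>lborel)"
    using assms by (intro nn_integral_real_affine) auto
  also have "(\<integral>\<^sup>+u. ennreal (?f (0 + c * u)) \<partial>lborel) =
     (\<integral>\<^sup>+u. ennreal (c powr (q - 1)) * ennreal (indicator {0<..} u * (u powr (q - 1) * exp (- c * u))) \<partial>lborel)"
  proof (intro nn_integral_cong)
    fix u :: real
    show "ennreal (?f (0 + c * u)) = ennreal (c powr (q - 1)) * ennreal (indicator {0<..} u * (u powr (q - 1) * exp (- c * u)))"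
      using assms by (auto simp: indicator_def powr_mult exp_minus field_simps zero_le_mult_iff ennreal_mult' simp flip: ennreal_mult')
  qed
  also have "\<dots> = ennreal (c powr (q - 1)) * (\<integral>\<^sup>+u. ennreal (indicator {0<..} u * (u powr (q - 1) * exp (- c * u))) \<partial>lborel)" (is "_ = _ * ?I")
    by (rule nn_integral_cmult) measurable
  finally have *: "ennreal (Gamma q) = ennreal (c powr q) * ?I"
    using assms by (simp add: mult.assoc[symmetric] ennreal_mult'[symmetric] powr_mult_base)
  have "ennreal (Gamma q * c powr (- q)) = ennreal (c powr (- q)) * ennreal (Gamma q)"
    using assms by (simp add: ennreal_mult' mult.commute)
  also have "\<dots> = ennreal (c powr (-q) * c powr q) * ?I"
    unfolding * using assms by (simp add: mult.assoc[symmetric] ennreal_mult')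
  also have "c powr (-q) * c powr q = 1" using assms by (simp flip: powr_add)
  finally show ?thesis by simp
qed

lemma nn_integral_square_substitution:
  fixes f :: "real \<Rightarrow> real"
  assumes [measurable]: "f \<in> borel_measurable borel" and nn: "\<And>x. f x \<ge> 0"
    and I: "(\<integral>\<^sup>+v. ennreal (indicator {0<..} v * f v) \<partial>lborel) = ennreal I" "I \<ge> 0"
  shows "(\<integral>\<^sup>+x. ennreal (indicator {0<..} x * (2 * x * f (x\<^sup>2))) \<partial>lborel) = ennreal I"
proof -
  have im: "(\<lambda>x::real. x\<^sup>2) ` {0<..} = {0<..}"
  proof safe
    fix x :: real assume "x > 0"
    then show "x \<in> (\<lambda>x. x\<^sup>2) ` {0<..}" by (intro image_eqI[of _ _ "sqrt x"]) auto
  qed auto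
  have "((\<lambda>v. indicator {0<..} v * f v) has_integral I) UNIV"
    by (rule nn_integral_has_integral) (use nn I in auto)
  then have hi: "(f has_integral I) {0<..}"
    using has_integral_restrict_UNIV[of "{0<..}" f I] by (simp add: indicator_def of_bool_def if_distrib[of "\<lambda>c. c * _"] cong: if_cong)
  then have a1: "f absolutely_integrable_on {0<..} \<and> integral {0<..} f = I"
    using nn by (auto intro!: nonnegative_absolutely_integrable_1 simp: integrable_on_def)
  have "(\<lambda>x. \<bar>2 * x\<bar> * f (x\<^sup>2)) absolutely_integrable_on {0<..} \<and> integral {0<..} (\<lambda>x. \<bar>2 * x\<bar> * f (x\<^sup>2)) = I"
  proof -
    have "((\<lambda>x. x\<^sup>2) has_real_derivative 2 * x) (at x within {0<..})" for x :: real
      by (auto intro!: derivative_eq_intros)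
    moreover have "inj_on (\<lambda>x::real. x\<^sup>2) {0<..}" by (auto simp: inj_on_def)
    ultimately show ?thesis
      using has_absolute_integral_change_of_variables_1'[of "{0<..}" "\<lambda>x. x\<^sup>2" "\<lambda>x. 2 * x" f I] a1
      by (simp only: im) simp
  qed
  then have "((\<lambda>x. \<bar>2 * x\<bar> * f (x\<^sup>2)) has_integral I) {0<..}"
    by (simp add: absolutely_integrable_on_def has_integral_iff)
  then have "((\<lambda>x. if x \<in> {0<..} then \<bar>2 * x\<bar> * f (x\<^sup>2) else 0) has_integral I) UNIV"
    by (simp only: has_integral_restrict_UNIV)
  also have "(\<lambda>x. if x \<in> {0<..} then \<bar>2 * x\<bar> * f (x\<^sup>2) else 0) = (\<lambda>x. indicator {0<..} x * (2 * x * f (x\<^sup>2)))"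
    by (auto simp: indicator_def)
  finally show ?thesis
    by (intro nn_integral_has_integral_lborel) (use nn in \<open>auto simp: indicator_def\<close>)
qed

text \<open>Write \<open>1 / (x\<^sup>2 + a\<^sup>2)\<close> as the integral of \<open>exp (-(x\<^sup>2 + a\<^sup>2) u)\<close> over \<open>u > 0\<close> and exchange the
integrations; everything is nonnegative, so Tonelli applies. The value comes out as the product of two Gamma values, the form in which the functional equation is symmetric.\<close>

lemma nn_integral_powr_over_sum_squares:
  assumes s: "-1 < s" "s < 1" and a: "a > (0::real)"
  shows "(\<integral>\<^sup>+x. ennreal (indicator {0<..} x * (2 * x powr s / (x\<^sup>2 + a\<^sup>2))) \<partial>lborel)
     = ennreal (Gamma ((1 + s) / 2) * Gamma ((1 - s) / 2) * a powr (s - 1))"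
proof -
  define g where "g = (\<lambda>x u. indicator {0<..} x * indicator {0<..} u * (2 * x powr s * exp (- (x\<^sup>2 + a\<^sup>2) * u)) :: real)"
  have [measurable]: "(\<lambda>(x, u). g x u) \<in> borel_measurable (lborel \<Otimes>\<^sub>M lborel)"
    unfolding g_def by measurable
  have 1: "(\<integral>\<^sup>+u. ennreal (g x u) \<partial>lborel) = ennreal (indicator {0<..} x * (2 * x powr s / (x\<^sup>2 + a\<^sup>2)))" for x
  proof (cases "x > 0")
    case True
    have "(\<integral>\<^sup>+u. ennreal (g x u) \<partial>lborel) = (\<integral>\<^sup>+u. ennreal (2 * x powr s) * ennreal (indicator {0<..} u * (u powr (1 - 1) * exp (- (x\<^sup>2 + a\<^sup>2) * u))) \<partial>lborel)"
      using True by (intro nn_integral_cong) (auto simp: g_def indicator_def simp flip: ennreal_mult')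
    also have "\<dots> = ennreal (2 * x powr s) * ennreal (Gamma 1 * (x\<^sup>2 + a\<^sup>2) powr (- 1))"
      using a by (subst nn_integral_cmult, measurable, subst nn_integral_Gamma_scaled) (auto intro: add_nonneg_pos)
    also have "\<dots> = ennreal (2 * x powr s / (x\<^sup>2 + a\<^sup>2))"
    proof -
      have "x\<^sup>2 + a\<^sup>2 > 0" using a by (auto intro: add_nonneg_pos)
      then show ?thesis by (simp add: powr_minus divide_inverse flip: ennreal_mult')
    qed
    finally show ?thesis using True by simp
  qed (simp add: g_def)
  have 2: "(\<integral>\<^sup>+x. ennreal (g x u) \<partial>lborel) = ennreal (Gamma ((1 + s) / 2)) * ennreal (indicator {0<..} u * (u powr ((1 - s) / 2 - 1) * exp (- a\<^sup>2 * u)))" for u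
  proof (cases "u > 0")
    case True
    let ?f = "\<lambda>v. v powr ((1 + s) / 2 - 1) * exp (- u * v)"
    have "(\<integral>\<^sup>+x. ennreal (indicator {0<..} x * (2 * x * ?f (x\<^sup>2))) \<partial>lborel) = ennreal (Gamma ((1 + s) / 2) * u powr (- ((1 + s) / 2)))"
      using s True by (intro nn_integral_square_substitution nn_integral_Gamma_scaled) (auto intro!: mult_nonneg_nonneg Gamma_real_nonneg)
    moreover have "(\<integral>\<^sup>+x. ennreal (g x u) \<partial>lborel) = (\<integral>\<^sup>+x. ennreal (exp (- a\<^sup>2 * u)) * ennreal (indicator {0<..} x * (2 * x * ?f (x\<^sup>2))) \<partial>lborel)"
    proof (intro nn_integral_cong)
      fix x :: real
      show "ennreal (g x u) = ennreal (exp (- a\<^sup>2 * u)) * ennreal (indicator {0<..} x * (2 * x * ?f (x\<^sup>2)))"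
      proof (cases "x > 0")
        case xpos: True
        have "(x\<^sup>2) powr ((1 + s) / 2 - 1) = x powr (2 * ((1 + s) / 2 - 1))"
          using xpos by (simp add: powr_powr flip: powr_numeral)
        then have "x * (x\<^sup>2) powr ((1 + s) / 2 - 1) = x powr s"
          using xpos by (simp add: powr_mult_base) (simp add: diff_divide_distrib)
        then have "g x u = exp (- a\<^sup>2 * u) * (2 * x * ?f (x\<^sup>2))"
        proof -
          have "exp (- (x\<^sup>2 + a\<^sup>2) * u) = exp (- a\<^sup>2 * u) * exp (- u * x\<^sup>2)"
            by (simp add: algebra_simps flip: exp_add)
          then show ?thesis
            using xpos True \<open>x * (x\<^sup>2) powr ((1 + s) / 2 - 1) = x powr s\<close>[symmetric] by (simp add: g_def)
        qed
        then show ?thesis using xpos by (simp flip: ennreal_mult')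
      qed (simp add: g_def)
    qed
    ultimately have "(\<integral>\<^sup>+x. ennreal (g x u) \<partial>lborel) = ennreal (exp (- a\<^sup>2 * u)) * ennreal (Gamma ((1 + s) / 2) * u powr (- ((1 + s) / 2)))"
      by (simp only:) (subst nn_integral_cmult, measurable)
    moreover have "(1 - s) / 2 - 1 = - ((1 + s) / 2)" by (simp add: field_simps)
    ultimately show ?thesis using True s
      by (simp add: mult_ac flip: ennreal_mult')
  qed (simp add: g_def)
  have "(\<integral>\<^sup>+x. ennreal (indicator {0<..} x * (2 * x powr s / (x\<^sup>2 + a\<^sup>2))) \<partial>lborel) = (\<integral>\<^sup>+x. \<integral>\<^sup>+u. ennreal (g x u) \<partial>lborel \<partial>lborel)"
    by (simp only: 1)
  also have "\<dots> = (\<integral>\<^sup>+u. \<integral>\<^sup>+x. ennreal (g x u) \<partial>lborel \<partial>lborel)"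
    by (rule lborel_pair.Fubini') measurable
  also have "\<dots> = ennreal (Gamma ((1 + s) / 2)) * (\<integral>\<^sup>+u. ennreal (indicator {0<..} u * (u powr ((1 - s) / 2 - 1) * exp (- a\<^sup>2 * u))) \<partial>lborel)"
    unfolding 2 by (rule nn_integral_cmult) measurable
  also have "\<dots> = ennreal (Gamma ((1 + s) / 2)) * ennreal (Gamma ((1 - s) / 2) * (a\<^sup>2) powr (- ((1 - s) / 2)))"
    using s a by (subst nn_integral_Gamma_scaled) auto
  also have "(a\<^sup>2) powr (- ((1 - s) / 2)) = a powr (s - 1)"
    using a by (simp add: powr_powr diff_divide_distrib flip: powr_numeral)
  also have "ennreal (Gamma ((1 + s) / 2)) * ennreal (Gamma ((1 - s) / 2) * a powr (s - 1)) = ennreal (Gamma ((1 + s) / 2) * Gamma ((1 - s) / 2) * a powr (s - 1))"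
    using s by (simp add: mult.assoc flip: ennreal_mult')
  finally show ?thesis .
qed

section \<open>The zeta function to the right of \<open>-1\<close>\<close>

text \<open>Subtracting the first two terms of the expansion at \<open>0\<close>, on \<open>(0, 1]\<close> only, makes the Mellin
transform converge for \<open>Re s > -1\<close> without spoiling the decay at infinity.\<close>

definition bose_kernel :: "real \<Rightarrow> real" where
  "bose_kernel x = 1 / (exp x - 1) - (if x \<le> 1 then 1 / x - 1 / 2 else 0)"

definition bose_mellin :: "complex \<Rightarrow> complex" where
  "bose_mellin s = (LINT x|lborel. of_real (indicator {0<..} x * bose_kernel x / x) * exp (- s * of_real (- ln x)))"

text \<open>The function \<open>(s - 1) \<zeta>(s)\<close>. Restoring the subtracted terms adds
\<open>1 / ((s - 1) \<Gamma>(s)) - 1 / (2 s \<Gamma>(s))\<close> to \<open>bose_mellin s / \<Gamma>(s)\<close>; reciprocal Gamma values keep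
the formula free of poles.\<close>

definition zeta1 :: "complex \<Rightarrow> complex" where
  "zeta1 s = (s - 1) * (rGamma s * bose_mellin s - rGamma (s + 1) / 2) + rGamma s"

lemma bose_kernel_measurable [measurable]: "bose_kernel \<in> borel_measurable borel"
  unfolding bose_kernel_def by measurable

lemma has_bochner_integral_powr_0_1:
  assumes "a > (-1::real)"
  shows "has_bochner_integral lborel (\<lambda>x. indicator {0<..1} x * x powr a) (1 / (a + 1))"
proof -
  have "integral\<^sup>N lborel (\<lambda>x. indicator {0..1} x * x powr a) = ennreal (1 / (a + 1))"
    using nn_integral_has_integral_lebesgue[OF _ has_integral_powr_from_0[OF assms, of 1]] by simp
  moreover have "indicator {0..1} x * x powr a = indicator {0<..1} x * x powr a" for x :: real
    by (auto simp: indicator_def)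
  ultimately show ?thesis
    using assms by (intro has_bochner_integral_nn_integral) auto
qed

lemma has_bochner_integral_powr_atLeast:
  assumes "a < (-1::real)" "c > 0"
  shows "has_bochner_integral lborel (\<lambda>x. indicator {c..} x * x powr a) (c powr (a + 1) / (- (a + 1)))"
proof -
  have "integral\<^sup>N lborel (\<lambda>x. indicator {c..} x * x powr a) = ennreal (c powr (a + 1) / (- (a + 1)))"
    using nn_integral_has_integral_lebesgue[OF _ has_integral_powr_to_inf[OF assms]] unfolding minus_divide_right[symmetric] minus_divide_left by simp
  then show ?thesis
    using assms by (intro has_bochner_integral_nn_integral) (auto simp: divide_nonneg_neg)
qed

lemma has_bochner_integral_powr_1_inf:
  assumes "a < (-1::real)"
  shows "has_bochner_integral lborel (\<lambda>x. indicator {1<..} x * x powr a) (- 1 / (a + 1))"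
proof -
  have "has_bochner_integral lborel (\<lambda>x. indicator {1..} x * x powr a) (- 1 / (a + 1))"
    using has_bochner_integral_powr_atLeast[OF assms, of 1] by (simp add: minus_divide_right)
  moreover have "AE x in lborel. indicator {1<..} x * x powr a = indicator {1..} x * x powr a"
    using AE_lborel_singleton[of "1::real"] by eventually_elim (auto simp: indicator_def)
  ultimately show ?thesis
    by (subst has_bochner_integral_cong_AE) auto
qed

lemma integrable_Gamma_weight:
  assumes "q > (0::real)"
  shows "integrable lborel (\<lambda>x. indicator {0<..} x * (x powr (q - 1) * exp (- x)))"
proof -
  have "has_bochner_integral lborel (\<lambda>x. indicator {0<..} x * (x powr (q - 1) * exp (- 1 * x))) (Gamma q * 1 powr (- q))"
    using assms nn_integral_Gamma_scaled[OF assms, of 1]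
    by (intro has_bochner_integral_nn_integral) auto
  then show ?thesis by (simp add: has_bochner_integral_iff)
qed

text \<open>All terms of the partial fraction expansion are positive, and they are at most the terms of
\<open>\<zeta>(2)\<close> times \<open>x / (2 \<pi>\<^sup>2)\<close>.\<close>

lemma bose_kernel_nonneg_bounds:
  assumes "x > (0::real)"
  shows "0 \<le> 1 / (exp x - 1) - 1 / x + 1 / 2" "1 / (exp x - 1) - 1 / x + 1 / 2 \<le> x"
proof -
  let ?b = "\<lambda>n. 2 * x / (x\<^sup>2 + (2 * pi * real (Suc n))\<^sup>2)"
  have s: "?b sums (1 / (exp x - 1) - 1 / x + 1 / 2)" by (rule bose_partial_fractions[OF assms])
  show "0 \<le> 1 / (exp x - 1) - 1 / x + 1 / 2"
    using sums_le[OF _ sums_zero s] assms by simp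
  have b_le: "?b n \<le> x / (2 * pi\<^sup>2) * (1 / (real n + 1)\<^sup>2)" for n
  proof -
    have "?b n \<le> 2 * x / (2 * pi * real (Suc n))\<^sup>2"
      using assms by (intro divide_left_mono mult_pos_pos add_nonneg_pos) auto
    also have "\<dots> = x / (2 * pi\<^sup>2) * (1 / (real n + 1)\<^sup>2)"
      by (simp add: power_mult_distrib add.commute)
    finally show ?thesis .
  qed
  have x_sums: "(\<lambda>n. x / (2 * pi\<^sup>2) * (1 / (real n + 1)\<^sup>2)) sums (x / (2 * pi\<^sup>2) * (pi\<^sup>2 / 6))"
    using inverse_squares_sums by (intro sums_mult) (simp add: add.commute)
  have "1 / (exp x - 1) - 1 / x + 1 / 2 \<le> x / (2 * pi\<^sup>2) * (pi\<^sup>2 / 6)"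
    by (rule sums_le[OF b_le s x_sums])
  also have "\<dots> = x / 12" by simp
  finally show "1 / (exp x - 1) - 1 / x + 1 / 2 \<le> x" using assms by simp
qed

lemma bose_kernel_bound:
  assumes "x > 0"
  shows "\<bar>bose_kernel x\<bar> \<le> (if x \<le> 1 then x else 2 * exp (- x))"
proof (cases "x \<le> 1")
  case True
  then show ?thesis using bose_kernel_nonneg_bounds[OF assms] by (simp add: bose_kernel_def)
next
  case False
  have "exp x \<ge> 1 + x" by (rule exp_ge_add_one_self)
  then have x2: "exp x \<ge> 2" using False by linarith
  then have "1 / (exp x - 1) \<le> 1 / (exp x / 2)" using assms by (intro divide_left_mono mult_pos_pos) auto
  also have "\<dots> = 2 * exp (- x)" by (simp only: exp_minus inverse_eq_divide) simp
  finally have "1 / (exp x - 1) \<le> 2 * exp (- x)" .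
  moreover have "1 / (exp x - 1) \<ge> 0" using assms by simp
  ultimately show ?thesis using False by (simp add: bose_kernel_def)
qed

lemma bose_mellin_integrable:
  assumes "\<sigma> > (-1::real)"
  shows "integrable lborel (\<lambda>x. norm (complex_of_real (indicator {0<..} x * bose_kernel x / x)) * exp (- \<sigma> * (- ln x)))"
proof (rule Bochner_Integration.integrable_bound)
  define q where "q = max \<sigma> 1"
  show "integrable lborel (\<lambda>x. 3 * (indicator {0<..} x * (x powr ((\<sigma> + 1) - 1) * exp (- x))) + 2 * (indicator {0<..} x * (x powr (q - 1) * exp (- x))) :: real)"
    using assms by (intro Bochner_Integration.integrable_add integrable_mult_right integrable_Gamma_weight) (auto simp: q_def)
  show "AE x in lborel. norm (norm (complex_of_real (indicator {0<..} x * bose_kernel x / x)) * exp (- \<sigma> * (- ln x)))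
     \<le> norm (3 * (indicator {0<..} x * (x powr ((\<sigma> + 1) - 1) * exp (- x))) + 2 * (indicator {0<..} x * (x powr (q - 1) * exp (- x))) :: real)"
  proof (rule AE_I2)
    fix x :: real
    show "norm (norm (complex_of_real (indicator {0<..} x * bose_kernel x / x)) * exp (- \<sigma> * (- ln x)))
     \<le> norm (3 * (indicator {0<..} x * (x powr ((\<sigma> + 1) - 1) * exp (- x))) + 2 * (indicator {0<..} x * (x powr (q - 1) * exp (- x))) :: real)"
    proof (cases "x > 0")
      case True
      have L: "norm (norm (complex_of_real (indicator {0<..} x * bose_kernel x / x)) * exp (- \<sigma> * (- ln x)))
         = \<bar>bose_kernel x\<bar> / x * x powr \<sigma>"
        using True by (simp add: norm_divide norm_mult powr_def abs_mult)
      have R: "norm (3 * (indicator {0<..} x * (x powr ((\<sigma> + 1) - 1) * exp (- x))) + 2 * (indicator {0<..} x * (x powr (q - 1) * exp (- x))) :: real)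
         = 3 * (x powr \<sigma> * exp (- x)) + 2 * (x powr (q - 1) * exp (- x))"
        using True by (simp add: abs_of_nonneg)
      show ?thesis
      proof (cases "x \<le> 1")
        case le: True
        have "exp x \<le> 3" using exp_le le by (meson exp_le_cancel_iff order_trans)
        then have "1 \<le> 3 * exp (- x)" by (simp add: exp_minus field_simps)
        then have "x powr \<sigma> * 1 \<le> x powr \<sigma> * (3 * exp (- x))" by (intro mult_left_mono) auto
        moreover have "\<bar>bose_kernel x\<bar> / x * x powr \<sigma> \<le> 1 * x powr \<sigma>"
          using bose_kernel_bound[OF True] le True by (intro mult_right_mono) auto
        ultimately show ?thesis unfolding L R by (simp add: add_increasing2)
      next
        case False
        have "\<bar>bose_kernel x\<bar> / x * x powr \<sigma> = \<bar>bose_kernel x\<bar> * x powr (\<sigma> - 1)"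
          using True by (simp add: powr_diff)
        also have "\<dots> \<le> 2 * exp (- x) * x powr (q - 1)"
          using bose_kernel_bound[OF True] False by (intro mult_mono powr_mono) (auto simp: q_def)
        finally show ?thesis unfolding L R by (simp add: add_increasing mult_ac)
      qed
    qed simp
  qed
qed measurable

lemma bose_mellin_holomorphic: "bose_mellin holomorphic_on {s. Re s > -1}"
  unfolding bose_mellin_def
  by (rule exp_transform_holomorphic_halfplane) (use bose_mellin_integrable in auto)

lemma zeta1_holomorphic: "zeta1 holomorphic_on {s. Re s > -1}"
  unfolding zeta1_def
  by (intro holomorphic_on_add holomorphic_on_mult holomorphic_on_diff holomorphic_on_divide
        holomorphic_rGamma' holomorphic_on_ident holomorphic_on_const bose_mellin_holomorphic) auto

lemma bose_mellin_of_real: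
  "bose_mellin (of_real s) = of_real (LINT x|lborel. indicator {0<..} x * bose_kernel x * x powr (s - 1))"
proof -
  have "bose_mellin (of_real s) = (LINT x|lborel. complex_of_real (indicator {0<..} x * bose_kernel x * x powr (s - 1)))"
    unfolding bose_mellin_def
  proof (intro Bochner_Integration.integral_cong refl)
    fix x :: real
    show "complex_of_real (indicator {0<..} x * bose_kernel x / x) * exp (- of_real s * of_real (- ln x))
       = complex_of_real (indicator {0<..} x * bose_kernel x * x powr (s - 1))"
    proof (cases "x > 0")
      case True
      then have "complex_of_real (x powr (s - 1)) = exp (complex_of_real s * of_real (ln x)) / of_real x"
        by (simp add: powr_diff) (simp add: powr_def exp_of_real[symmetric])
      then show ?thesis using True by simp
    qed simp
  qed
  then show ?thesis by (simp only: integral_complex_of_real)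
qed

lemma rGamma_of_real_pos: "x > 0 \<Longrightarrow> rGamma (complex_of_real x) = of_real (1 / Gamma x)"
  by (simp add: rGamma_inverse_Gamma inverse_eq_divide Gamma_complex_of_real)

lemma summable_powr_Suc: "s > 1 \<Longrightarrow> summable (\<lambda>n. real (Suc n) powr (- s))"
  using summable_Suc_iff[of "\<lambda>n. real n powr (- s)"] summable_real_powr_iff[of "- s"] by simp

lemma has_bochner_integral_bose:
  assumes s: "s > (1::real)"
  shows "has_bochner_integral lborel (\<lambda>x. indicator {0<..} x * (x powr (s - 1) / (exp x - 1)))
           (Gamma s * (\<Sum>n. real (Suc n) powr (- s)))"
proof (rule has_bochner_integral_nn_integral)
  define g where "g = (\<lambda>n x. indicator {0<..} x * (x powr (s - 1) * exp (- real (Suc n) * x)) :: real)"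
  have gs: "(\<lambda>n. g n x) sums (indicator {0<..} x * (x powr (s - 1) / (exp x - 1)))" for x
  proof (cases "x > 0")
    case True
    have "(\<lambda>n. exp (- x) * exp (- x) ^ n) sums (exp (- x) * (1 / (1 - exp (- x))))"
      using True by (intro sums_mult geometric_sums) simp
    moreover have "exp (- x) * (1 / (1 - exp (- x))) = 1 / (exp x - 1)"
      using True by (simp add: exp_minus field_simps)
    moreover have "exp (- x) * exp (- x) ^ n = exp (- real (Suc n) * x)" for n
      by (simp add: algebra_simps flip: exp_of_nat_mult exp_add)
    ultimately have "(\<lambda>n. exp (- real (Suc n) * x)) sums (1 / (exp x - 1))" by simp
    from sums_mult[OF this, of "x powr (s - 1)"] True show ?thesis by (simp add: g_def)
  qed (simp add: g_def)
  have "(\<integral>\<^sup>+x. ennreal (indicator {0<..} x * (x powr (s - 1) / (exp x - 1))) \<partial>lborel)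
     = (\<integral>\<^sup>+x. (\<Sum>n. ennreal (g n x)) \<partial>lborel)"
    by (intro nn_integral_cong, subst suminf_ennreal_eq[OF _ gs]) (auto simp: g_def)
  also have "\<dots> = (\<Sum>n. \<integral>\<^sup>+x. ennreal (g n x) \<partial>lborel)"
    by (rule nn_integral_suminf) (simp add: g_def)
  also have "\<dots> = (\<Sum>n. ennreal (Gamma s * real (Suc n) powr (- s)))"
    unfolding g_def using s by (subst nn_integral_Gamma_scaled) auto
  also have "\<dots> = ennreal (\<Sum>n. Gamma s * real (Suc n) powr (- s))"
    using s summable_powr_Suc[OF s] by (intro suminf_ennreal2 summable_mult) auto
  also have "(\<Sum>n. Gamma s * real (Suc n) powr (- s)) = Gamma s * (\<Sum>n. real (Suc n) powr (- s))"
    using summable_powr_Suc[OF s] by (rule suminf_mult)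
  finally show "(\<integral>\<^sup>+x. ennreal (indicator {0<..} x * (x powr (s - 1) / (exp x - 1))) \<partial>lborel)
     = ennreal (Gamma s * (\<Sum>n. real (Suc n) powr (- s)))" .
  show "AE x in lborel. 0 \<le> indicator {0<..} x * (x powr (s - 1) / (exp x - 1))"
    by (auto simp: indicator_def)
  show "0 \<le> Gamma s * (\<Sum>n. real (Suc n) powr (- s))"
    using s summable_powr_Suc[OF s] by (intro mult_nonneg_nonneg suminf_nonneg) auto
qed measurable

lemma zeta1_real_gt_1:
  assumes s: "s > (1::real)"
  shows "zeta1 (of_real s) = of_real ((s - 1) * (\<Sum>n. real (Suc n) powr (- s)))"
proof -
  let ?Z = "\<Sum>n. real (Suc n) powr (- s)"
  have "has_bochner_integral lborel (\<lambda>x. indicator {0<..1} x * x powr (s - 2) - 1/2 * (indicator {0<..1} x * x powr (s - 1)))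
         (1 / (s - 2 + 1) - 1/2 * (1 / (s - 1 + 1)))"
    using s by (intro has_bochner_integral_diff has_bochner_integral_mult_right has_bochner_integral_powr_0_1) auto
  from has_bochner_integral_diff[OF has_bochner_integral_bose[OF s] this]
  have "has_bochner_integral lborel (\<lambda>x. indicator {0<..} x * (x powr (s - 1) / (exp x - 1)) -
     (indicator {0<..1} x * x powr (s - 2) - 1/2 * (indicator {0<..1} x * x powr (s - 1)))) (Gamma s * ?Z - (1 / (s - 1) - 1 / (2 * s)))"
    by simp
  moreover have "indicator {0<..} x * (x powr (s - 1) / (exp x - 1)) -
     (indicator {0<..1} x * x powr (s - 2) - 1/2 * (indicator {0<..1} x * x powr (s - 1)))
      = indicator {0<..} x * bose_kernel x * x powr (s - 1)" for x
  proof (cases "x > 0")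
    case True
    have "x powr (s - 2) = x powr (s - 1) / x"
      using True powr_diff[of x "s - 1" 1] by simp
    then show ?thesis using True by (auto simp: bose_kernel_def algebra_simps)
  qed simp
  ultimately have "(LINT x|lborel. indicator {0<..} x * bose_kernel x * x powr (s - 1)) = Gamma s * ?Z - (1 / (s - 1) - 1 / (2 * s))"
    by (simp add: has_bochner_integral_iff)
  then have B: "bose_mellin (of_real s) = of_real (Gamma s * ?Z - (1 / (s - 1) - 1 / (2 * s)))"
    by (simp add: bose_mellin_of_real)
  have G: "Gamma s > 0" "Gamma (s + 1) = s * Gamma s"
    using s Gamma_plus1[of s] nonpos_Ints_nonpos[of s] by force+
  have "zeta1 (of_real s) = of_real ((s - 1) * (1 / Gamma s * (Gamma s * ?Z - (1 / (s - 1) - 1 / (2 * s))) - 1 / Gamma (s + 1) / 2) + 1 / Gamma s)"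
    using s rGamma_of_real_pos[of s] rGamma_of_real_pos[of "s + 1"] by (simp add: zeta1_def B)
  also have "(s - 1) * (1 / Gamma s * (Gamma s * ?Z - (1 / (s - 1) - 1 / (2 * s))) - 1 / Gamma (s + 1) / 2) + 1 / Gamma s
     = (s - 1) * ?Z"
  proof -
    have "(s - 1) * (1 / G * (G * Z - (1 / (s - 1) - 1 / (2 * s))) - 1 / (s * G) / 2) + 1 / G = (s - 1) * Z" if "G > 0" for G Z
      using that s by (simp add: divide_simps) (simp add: algebra_simps)
    then show ?thesis unfolding G(2) using G(1) by blast
  qed
  finally show ?thesis .
qed

lemma has_bochner_integral_bose_neg:
  assumes s: "-1 < s" "s < (0::real)"
  shows "has_bochner_integral lborel (\<lambda>x. indicator {0<..} x * ((1 / (exp x - 1) - 1 / x + 1 / 2) * x powr (s - 1)))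
           (Gamma ((1 + s) / 2) * Gamma ((1 - s) / 2) * (2 * pi) powr (s - 1) * (\<Sum>n. real (Suc n) powr (- (1 - s))))"
proof (rule has_bochner_integral_nn_integral)
  let ?G = "Gamma ((1 + s) / 2) * Gamma ((1 - s) / 2) * (2 * pi) powr (s - 1)"
  have G: "?G \<ge> 0" using s by (intro mult_nonneg_nonneg Gamma_real_nonneg) auto
  define g where "g = (\<lambda>n x. indicator {0<..} x * (2 * x powr s / (x\<^sup>2 + (2 * pi * real (Suc n))\<^sup>2)) :: real)"
  have gs: "(\<lambda>n. g n x) sums (indicator {0<..} x * ((1 / (exp x - 1) - 1 / x + 1 / 2) * x powr (s - 1)))" for x
  proof (cases "x > 0")
    case True
    have "x * x powr (s - 1) = x powr s" using True by (simp add: powr_mult_base)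
    then have "2 * x / d * x powr (s - 1) = 2 * x powr s / d" for d by (metis mult.assoc mult.commute times_divide_eq_left)
    with sums_mult2[OF bose_partial_fractions[OF True], of "x powr (s - 1)"]
    have "(\<lambda>n. 2 * x powr s / (x\<^sup>2 + (2 * pi * real (Suc n))\<^sup>2)) sums ((1 / (exp x - 1) - 1 / x + 1 / 2) * x powr (s - 1))"
      by (simp only:)
    then show ?thesis using True by (simp add: g_def)
  qed (simp add: g_def)
  have sm: "summable (\<lambda>n. real (Suc n) powr (- (1 - s)))" using s by (intro summable_powr_Suc) auto
  have "(\<integral>\<^sup>+x. ennreal (indicator {0<..} x * ((1 / (exp x - 1) - 1 / x + 1 / 2) * x powr (s - 1))) \<partial>lborel)
     = (\<integral>\<^sup>+x. (\<Sum>n. ennreal (g n x)) \<partial>lborel)"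
    by (intro nn_integral_cong, subst suminf_ennreal_eq[OF _ gs]) (auto simp: g_def indicator_def)
  also have "\<dots> = (\<Sum>n. \<integral>\<^sup>+x. ennreal (g n x) \<partial>lborel)"
    by (rule nn_integral_suminf) (simp add: g_def)
  also have "\<dots> = (\<Sum>n. ennreal (?G * real (Suc n) powr (- (1 - s))))"
  proof (intro suminf_cong)
    fix n
    have "(2 * pi * real (Suc n)) powr (s - 1) = (2 * pi) powr (s - 1) * real (Suc n) powr (- (1 - s))"
      by (subst powr_mult) auto
    then show "(\<integral>\<^sup>+x. ennreal (g n x) \<partial>lborel) = ennreal (?G * real (Suc n) powr (- (1 - s)))"
      unfolding g_def using s by (subst nn_integral_powr_over_sum_squares) (auto simp: mult.assoc)
  qed
  also have "\<dots> = ennreal (\<Sum>n. ?G * real (Suc n) powr (- (1 - s)))"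
    by (rule suminf_ennreal2[OF mult_nonneg_nonneg[OF G powr_ge_zero] summable_mult[OF sm]])
  also have "(\<Sum>n. ?G * real (Suc n) powr (- (1 - s))) = ?G * (\<Sum>n. real (Suc n) powr (- (1 - s)))"
    using sm by (rule suminf_mult)
  finally show "(\<integral>\<^sup>+x. ennreal (indicator {0<..} x * ((1 / (exp x - 1) - 1 / x + 1 / 2) * x powr (s - 1))) \<partial>lborel)
     = ennreal (?G * (\<Sum>n. real (Suc n) powr (- (1 - s))))" .
  show "AE x in lborel. 0 \<le> indicator {0<..} x * ((1 / (exp x - 1) - 1 / x + 1 / 2) * x powr (s - 1))"
    using bose_kernel_nonneg_bounds(1) by (intro AE_I2) (simp add: indicator_def)
  show "0 \<le> ?G * (\<Sum>n. real (Suc n) powr (- (1 - s)))"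
    by (rule mult_nonneg_nonneg[OF G suminf_nonneg[OF sm]]) (rule powr_ge_zero)
qed measurable

text \<open>For \<open>-1 < s < 0\<close> the terms removed on \<open>(0, 1]\<close> are integrable on \<open>(1, \<infinity>)\<close> instead, so
\<open>bose_kernel\<close> can be replaced by the combination that has a partial fraction expansion.
Integrating the latter termwise produces the series for \<open>\<zeta>(1 - s)\<close>.\<close>

lemma zeta1_real_neg:
  assumes s: "-1 < s" "s < (0::real)"
  shows "zeta1 (of_real s) = of_real ((s - 1) * (Gamma ((1 + s) / 2) * Gamma ((1 - s) / 2) * (2 * pi) powr (s - 1) *
           (\<Sum>n. real (Suc n) powr (- (1 - s))))) * rGamma (of_real s)"
proof -
  let ?Z = "Gamma ((1 + s) / 2) * Gamma ((1 - s) / 2) * (2 * pi) powr (s - 1) * (\<Sum>n. real (Suc n) powr (- (1 - s)))"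
  have "has_bochner_integral lborel (\<lambda>x. indicator {1<..} x * x powr (s - 2) - 1/2 * (indicator {1<..} x * x powr (s - 1)))
         (- 1 / (s - 2 + 1) - 1/2 * (- 1 / (s - 1 + 1)))"
    using s by (intro has_bochner_integral_diff has_bochner_integral_mult_right has_bochner_integral_powr_1_inf) auto
  from has_bochner_integral_add[OF has_bochner_integral_bose_neg[OF s] this]
  have "has_bochner_integral lborel (\<lambda>x. indicator {0<..} x * ((1 / (exp x - 1) - 1 / x + 1 / 2) * x powr (s - 1)) +
     (indicator {1<..} x * x powr (s - 2) - 1/2 * (indicator {1<..} x * x powr (s - 1)))) (?Z + (- 1 / (s - 1) + 1 / (2 * s)))"
    by simp
  moreover have "indicator {0<..} x * ((1 / (exp x - 1) - 1 / x + 1 / 2) * x powr (s - 1)) +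
     (indicator {1<..} x * x powr (s - 2) - 1/2 * (indicator {1<..} x * x powr (s - 1)))
      = indicator {0<..} x * bose_kernel x * x powr (s - 1)" for x
  proof (cases "x > 0")
    case True
    have "x powr (s - 2) = x powr (s - 1) / x"
      using True powr_diff[of x "s - 1" 1] by simp
    then show ?thesis using True by (auto simp: bose_kernel_def algebra_simps)
  qed simp
  ultimately have "(LINT x|lborel. indicator {0<..} x * bose_kernel x * x powr (s - 1)) = ?Z + (- 1 / (s - 1) + 1 / (2 * s))"
    by (simp add: has_bochner_integral_iff)
  then have B: "bose_mellin (of_real s) = of_real (?Z + (- 1 / (s - 1) + 1 / (2 * s)))"
    by (simp add: bose_mellin_of_real)
  have "of_real s * rGamma (complex_of_real s + 1) = rGamma (of_real s)" by (rule rGamma_plus1)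
  then have R: "rGamma (complex_of_real s + 1) = rGamma (of_real s) / of_real s"
    using s by (simp add: field_simps)
  have nz: "complex_of_real s \<noteq> 0" "complex_of_real s - 1 \<noteq> 0"
    using s by (auto simp: complex_eq_iff)
  have "(z - 1) * (r * (Z + (- 1 / (z - 1) + 1 / (2 * z))) - r / z / 2) + r = (z - 1) * Z * r" if "z \<noteq> 0" "z - 1 \<noteq> 0" for z r Z :: complex
    using that by (simp add: field_simps)
  from this[OF nz] show ?thesis unfolding zeta1_def B R by simp
qed

section \<open>Zeta on the right half-plane\<close>

text \<open>Terms of \<open>(s - 1) \<Sum>n\<^bsup>-s\<^esup> - 1\<close> after adding a telescoping series. Each is \<open>O(n\<^bsup>-s-1\<^esup>)\<close>, so the
sum converges for \<open>Re s > 0\<close>.\<close>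

definition zterm :: "nat \<Rightarrow> complex \<Rightarrow> complex" where
  "zterm n s = (s - 1) * of_nat (Suc n) powr (- s) + of_nat (Suc (Suc n)) powr (1 - s) - of_nat (Suc n) powr (1 - s)"

lemma norm_of_nat_powr: "n > 0 \<Longrightarrow> norm (of_nat n powr s :: complex) = real n powr Re s"
  using norm_powr_real_powr[of "of_nat n" s] by simp

text \<open>The term is the error of a first order Taylor expansion of \<open>x\<^bsup>1-s\<^esup>\<close> between consecutive
integers.\<close>

lemma zterm_bound:
  assumes "Re s > 0"
  shows "norm (zterm n s) \<le> norm (s - 1) * norm s * real (Suc n) powr (- Re s - 1)"
proof -
  let ?N = "of_nat (Suc n) :: complex" and ?M = "of_nat (Suc (Suc n)) :: complex"
  define f :: "nat \<Rightarrow> complex \<Rightarrow> complex" where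
    "f = (\<lambda>i x. if i = 0 then x powr (1 - s) else if i = 1 then (1 - s) * x powr (- s) else (1 - s) * (- s) * x powr (- s - 1))"
  have seg: "\<exists>r. x = of_real r \<and> real (Suc n) \<le> r" if "x \<in> closed_segment ?N ?M" for x
  proof -
    have "closed_segment ?N ?M = of_real ` closed_segment (real (Suc n)) (real (Suc (Suc n)))"
      using closed_segment_of_real[of "real (Suc n)" "real (Suc (Suc n))"] by simp
    with that show ?thesis by (auto simp: closed_segment_eq_real_ivl)
  qed
  have "norm (f 0 ?M - (\<Sum>i\<le>1. f i ?N * (?M - ?N) ^ i / fact i)) \<le> norm (s - 1) * norm s * real (Suc n) powr (- Re s - 1) * norm (?M - ?N) ^ Suc 1 / fact 1"
  proof (rule complex_Taylor[of "closed_segment ?N ?M"])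
    fix i x assume x: "x \<in> closed_segment ?N ?M" and i: "i \<le> (1::nat)"
    from seg[OF x] obtain r where "x = of_real r" "real (Suc n) \<le> r" by blast
    then have "x \<notin> \<real>\<^sub>\<le>\<^sub>0" by simp
    from has_field_derivative_powr[OF this] have d: "((\<lambda>z. z powr t) has_field_derivative t * x powr (t - 1)) (at x within closed_segment ?N ?M)" for t
      by (rule has_field_derivative_at_within)
    from i consider "i = 0" | "i = 1" by linarith
    then show "(f i has_field_derivative f (Suc i) x) (at x within closed_segment ?N ?M)"
    proof cases
      case 1 then show ?thesis using d[of "1 - s"] by (simp add: f_def)
    next
      case 2 then show ?thesis using DERIV_cmult[OF d[of "- s"], of "1 - s"] by (simp add: f_def mult.assoc)
    qed
  next
    fix x assume "x \<in> closed_segment ?N ?M"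
    from seg[OF this] obtain r where r: "x = of_real r" "real (Suc n) \<le> r" by blast
    have "norm (x powr (- s - 1)) = r powr (- Re s - 1)" using r norm_powr_real_powr[of x "- s - 1"] by simp
    also have "\<dots> \<le> real (Suc n) powr (- Re s - 1)" using r assms by (intro powr_mono2') auto
    finally show "norm (f (Suc 1) x) \<le> norm (s - 1) * norm s * real (Suc n) powr (- Re s - 1)"
      by (simp add: f_def norm_mult norm_minus_commute mult_left_mono)
  qed auto
  moreover have "f 0 ?M - (\<Sum>i\<le>1. f i ?N * (?M - ?N) ^ i / fact i) = zterm n s"
    by (simp add: f_def zterm_def algebra_simps)
  ultimately show ?thesis by simp
qed

lemma zterm_has_field_derivative:
  "(zterm n has_field_derivative of_nat (Suc n) powr (- s) - (s - 1) * of_real (ln (Suc n)) * of_nat (Suc n) powr (- s)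
      - of_real (ln (Suc (Suc n))) * of_nat (Suc (Suc n)) powr (1 - s) + of_real (ln (Suc n)) * of_nat (Suc n) powr (1 - s)) (at s)"
proof -
  have p: "((\<lambda>s. of_nat (Suc k) powr g s) has_field_derivative of_real (ln (Suc k)) * of_nat (Suc k) powr g s * g') (at s)"
    if "(g has_field_derivative g') (at s)" for k g and g' :: complex
    using DERIV_chain2[OF has_field_derivative_powr_right[of "of_nat (Suc k)"] that] Ln_of_nat[of "Suc k"] by (simp del: of_nat_Suc)
  show ?thesis
    unfolding zterm_def
    by (rule derivative_eq_intros p refl)+ (simp add: algebra_simps)
qed

text \<open>Locally uniform convergence allows termwise differentiation; the derivative of the sum is needed
at \<open>s = 1\<close>.\<close>

lemma zterm_series:
  obtains g g' where "\<And>s. Re s > 0 \<Longrightarrow> (\<lambda>n. zterm n s) sums g s"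
    "\<And>s. Re s > 0 \<Longrightarrow> (\<lambda>n. of_nat (Suc n) powr (- s) - (s - 1) * of_real (ln (Suc n)) * of_nat (Suc n) powr (- s)
      - of_real (ln (Suc (Suc n))) * of_nat (Suc (Suc n)) powr (1 - s) + of_real (ln (Suc n)) * of_nat (Suc n) powr (1 - s)) sums g' s"
    "\<And>s. Re s > 0 \<Longrightarrow> (g has_field_derivative g' s) (at s)"
proof -
  have "\<exists>g g'. \<forall>s \<in> {s. Re s > 0}. ((\<lambda>n. zterm n s) sums g s) \<and> ((\<lambda>n. of_nat (Suc n) powr (- s) - (s - 1) * of_real (ln (Suc n)) * of_nat (Suc n) powr (- s)
      - of_real (ln (Suc (Suc n))) * of_nat (Suc (Suc n)) powr (1 - s) + of_real (ln (Suc n)) * of_nat (Suc n) powr (1 - s)) sums g' s) \<and> (g has_field_derivative g' s) (at s)"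
  proof (rule series_and_derivative_comparison_local)
    show "open {s. Re s > 0}" by (rule open_halfspace_Re_gt)
    fix x assume x: "x \<in> {s. Re s > 0}"
    define d where "d = Re x / 2"
    have d: "d > 0" using x by (simp add: d_def)
    let ?h = "\<lambda>n. (norm x + d + 1) * (norm x + d) * real (Suc n) powr (- (d + 1))"
    have "summable ?h" using d by (intro summable_mult summable_powr_Suc) auto
    moreover have "norm (zterm n y) \<le> ?h n" if "y \<in> ball x d" for n y
    proof -
      have yx: "norm (y - x) < d" using that by (simp add: dist_norm norm_minus_commute)
      have Re: "Re y > d" using yx abs_Re_le_cmod[of "y - x"] by (auto simp: d_def)
      have n1: "norm y \<le> norm x + d" using yx norm_triangle_sub[of y x] by simp
      have n2: "norm (y - 1) \<le> norm x + d + 1" using n1 norm_triangle_ineq4[of y 1] by simp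
      have "norm (zterm n y) \<le> norm (y - 1) * norm y * real (Suc n) powr (- Re y - 1)"
        using Re d by (intro zterm_bound) auto
      also have "\<dots> \<le> ?h n"
        using n1 n2 Re d by (intro mult_mono powr_mono mult_nonneg_nonneg) auto
      finally show ?thesis .
    qed
    ultimately show "\<exists>d h. 0 < d \<and> summable h \<and> (\<forall>\<^sub>F n in sequentially. \<forall>y\<in>ball x d \<inter> {s. Re s > 0}. norm (zterm n y) \<le> h n)"
      using d by (intro exI[of _ d] exI[of _ ?h]) auto
  qed (rule zterm_has_field_derivative)
  then obtain g g' where "\<forall>s \<in> {s. Re s > 0}. ((\<lambda>n. zterm n s) sums g s) \<and> ((\<lambda>n. of_nat (Suc n) powr (- s) - (s - 1) * of_real (ln (Suc n)) * of_nat (Suc n) powr (- s)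
      - of_real (ln (Suc (Suc n))) * of_nat (Suc (Suc n)) powr (1 - s) + of_real (ln (Suc n)) * of_nat (Suc n) powr (1 - s)) sums g' s) \<and> (g has_field_derivative g' s) (at s)"
    by (elim exE)
  then show ?thesis by (intro that[of g g']) blast+
qed

lemma summable_Dirichlet:
  assumes "Re s > 1" shows "summable (\<lambda>n. norm (of_nat (Suc n) powr (- s) :: complex))"
  using summable_powr_Suc[OF assms] norm_of_nat_powr[of "Suc _" "- s"] by (simp del: of_nat_Suc)

lemma zterm_sums_gt_1:
  assumes "Re s > 1"
  shows "(\<lambda>n. zterm n s) sums ((s - 1) * (\<Sum>n. of_nat (Suc n) powr (- s)) - 1)"
proof -
  have "(\<lambda>n. real (Suc n) powr (1 - Re s)) \<longlonglongrightarrow> 0"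
    using assms by (intro tendsto_neg_powr filterlim_compose[OF filterlim_real_sequentially filterlim_Suc]) auto
  then have "(\<lambda>n. of_nat (Suc n) powr (1 - s) :: complex) \<longlonglongrightarrow> 0"
    by (subst tendsto_norm_zero_iff[symmetric]) (simp add: norm_of_nat_powr del: of_nat_Suc)
  from telescope_sums[OF this]
  have "(\<lambda>n. of_nat (Suc (Suc n)) powr (1 - s) - of_nat (Suc n) powr (1 - s)) sums (- 1 :: complex)"
    by simp
  moreover have "(\<lambda>n. (s - 1) * of_nat (Suc n) powr (- s)) sums ((s - 1) * (\<Sum>n. of_nat (Suc n) powr (- s)))"
    by (intro sums_mult summable_sums summable_norm_cancel[OF summable_Dirichlet[OF assms]])
  ultimately have "(\<lambda>n. (s - 1) * of_nat (Suc n) powr (- s) + (of_nat (Suc (Suc n)) powr (1 - s) - of_nat (Suc n) powr (1 - s)))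
     sums ((s - 1) * (\<Sum>n. of_nat (Suc n) powr (- s)) + - 1)"
    by (intro sums_add)
  then show ?thesis by (simp add: zterm_def algebra_simps)
qed

lemma zeta1_sums: "Re s > 0 \<Longrightarrow> (\<lambda>n. zterm n s) sums (zeta1 s - 1)"
  and zeta1_deriv_sums: "Re s > 0 \<Longrightarrow> (\<lambda>n. of_nat (Suc n) powr (- s) - (s - 1) * of_real (ln (Suc n)) * of_nat (Suc n) powr (- s)
      - of_real (ln (Suc (Suc n))) * of_nat (Suc (Suc n)) powr (1 - s) + of_real (ln (Suc n)) * of_nat (Suc n) powr (1 - s)) sums deriv zeta1 s"
proof -
  assume s: "Re s > 0"
  obtain g g' where g: "\<And>s. Re s > 0 \<Longrightarrow> (\<lambda>n. zterm n s) sums g s"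
    "\<And>s. Re s > 0 \<Longrightarrow> (\<lambda>n. of_nat (Suc n) powr (- s) - (s - 1) * of_real (ln (Suc n)) * of_nat (Suc n) powr (- s)
      - of_real (ln (Suc (Suc n))) * of_nat (Suc (Suc n)) powr (1 - s) + of_real (ln (Suc n)) * of_nat (Suc n) powr (1 - s)) sums g' s"
    "\<And>s. Re s > 0 \<Longrightarrow> (g has_field_derivative g' s) (at s)"
    by (rule zterm_series) (rule that)
  have hol: "(\<lambda>s. g s + 1) holomorphic_on {s. Re s > 0}"
  proof -
    have "g holomorphic_on {s. Re s > 0}"
      unfolding holomorphic_on_def field_differentiable_def
    proof (intro ballI exI)
      fix x assume "x \<in> {s. Re s > 0}"
      then show "(g has_field_derivative g' x) (at x within {s. Re s > 0})"
        by (intro has_field_derivative_at_within[OF g(3)]) simp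
    qed
    then show ?thesis by (intro holomorphic_intros)
  qed
  have eq: "zeta1 z = g z + 1" if "Re z > 0" for z
  proof (rule holomorphic_eq_if_eq_on_real_interval[OF _ hol, of zeta1 1 2])
    show "zeta1 holomorphic_on {s. Re s > 0}"
      by (rule holomorphic_on_subset[OF zeta1_holomorphic]) auto
    show "connected {s. Re s > 0}" by (intro convex_connected convex_halfspace_Re_gt)
    fix x :: real assume x: "1 < x" "x < 2"
    have "g (of_real x) = (of_real x - 1) * (\<Sum>n. of_nat (Suc n) powr (- of_real x)) - 1"
      using zterm_sums_gt_1[of "of_real x"] g(1)[of "of_real x"] x sums_unique2 by fastforce
    also have "(\<Sum>n. of_nat (Suc n) powr (- of_real x)) = (\<Sum>n. complex_of_real (real (Suc n) powr (- x)))"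
      using powr_of_real[of "real (Suc _)" "- x"] by (intro suminf_cong) (simp del: of_nat_Suc)
    also have "\<dots> = of_real (\<Sum>n. real (Suc n) powr (- x))"
      by (rule suminf_of_real[symmetric]) (use x in \<open>auto intro: summable_powr_Suc simp del: of_nat_Suc\<close>)
    finally show "zeta1 (of_real x) = g (of_real x) + 1"
      using zeta1_real_gt_1[OF x(1)] by simp
  qed (use that in \<open>auto simp: open_halfspace_Re_gt\<close>)
  show "(\<lambda>n. zterm n s) sums (zeta1 s - 1)" using g(1)[OF s] eq[OF s] by simp
  have "eventually (\<lambda>z. z \<in> {s. Re s > 0}) (nhds s)"
    using s by (intro eventually_nhds_in_open open_halfspace_Re_gt) auto
  then have "deriv zeta1 s = deriv (\<lambda>z. g z + 1) s"
    by (intro deriv_cong_ev) (auto elim!: eventually_mono simp: eq)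
  also have "\<dots> = g' s"
    using g(3)[OF s] by (intro DERIV_imp_deriv) (auto intro!: derivative_eq_intros)
  finally show "(\<lambda>n. of_nat (Suc n) powr (- s) - (s - 1) * of_real (ln (Suc n)) * of_nat (Suc n) powr (- s)
      - of_real (ln (Suc (Suc n))) * of_nat (Suc (Suc n)) powr (1 - s) + of_real (ln (Suc n)) * of_nat (Suc n) powr (1 - s)) sums deriv zeta1 s"
    using g(2)[OF s] by simp
qed

lemma zeta1_Dirichlet:
  assumes "Re s > 1"
  shows "zeta1 s = (s - 1) * (\<Sum>n. of_nat (Suc n) powr (- s))"
  using sums_unique2[OF zeta1_sums zterm_sums_gt_1[OF assms]] assms by simp

lemma zeta1_1: "zeta1 1 = 1"
proof -
  have "zterm n 1 = 0" for n by (simp add: zterm_def del: of_nat_Suc)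
  then show ?thesis using zeta1_sums[of 1] sums_unique2[OF _ sums_zero] by fastforce
qed

lemma zeta1_0: "zeta1 0 = 1 / 2"
  by (simp add: zeta1_def)

text \<open>At \<open>s = 1\<close> the differentiated series is the standard series for Euler's constant, so
\<open>\<zeta>(s) = 1 / (s - 1) + \<gamma> + \<dots>\<close>.\<close>

lemma deriv_zeta1_1: "deriv zeta1 1 = of_real euler_mascheroni"
proof (rule sums_unique2)
  show "(\<lambda>n. inverse (of_nat (n+1)) + of_real (ln (of_nat (n+1))) - of_real (ln (of_nat (n+2)))) sums (of_real euler_mascheroni :: complex)"
    using euler_mascheroni_sum[where 'a = complex] by simp
  show "(\<lambda>n. inverse (of_nat (n+1)) + of_real (ln (of_nat (n+1))) - of_real (ln (of_nat (n+2)))) sums deriv zeta1 1"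
  proof -
    have "of_nat (Suc n) powr (- 1) - (1 - 1) * of_real (ln (Suc n)) * of_nat (Suc n) powr (- 1)
      - of_real (ln (Suc (Suc n))) * of_nat (Suc (Suc n)) powr (1 - 1) + of_real (ln (Suc n)) * of_nat (Suc n) powr (1 - 1)
      = inverse (of_nat (n+1)) + of_real (ln (of_nat (n+1))) - (of_real (ln (of_nat (n+2))) :: complex)" for n
      by (simp add: powr_minus del: of_nat_Suc)
    then show ?thesis using zeta1_deriv_sums[of 1] by (simp only: one_complex.sel zero_less_one)
  qed
qed

text \<open>By the mean value theorem each term of the series is, for \<open>0 < x < 1\<close>, at least a term of a
telescoping series with sum \<open>x - 1\<close>; hence the value is at least \<open>x\<close>. Used at \<open>2\<sigma> + 2\<close>, this excludes
real poles of the continued transform, which Landau's theorem requires.\<close>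

lemma zeta1_real_pos:
  assumes "x > (0::real)"
  shows "Re (zeta1 (of_real x)) > 0"
proof -
  consider "x < 1" | "x = 1" | "x > 1" by linarith
  then show ?thesis
  proof cases
    case 1
    have zr: "zterm n (of_real x) = of_real ((x - 1) * real (Suc n) powr (- x) + real (Suc (Suc n)) powr (1 - x) - real (Suc n) powr (1 - x))" for n
      using powr_of_real[of "real (Suc n)" "- x"] powr_of_real[of "real (Suc n)" "1 - x"] powr_of_real[of "real (Suc (Suc n))" "1 - x"]
      by (simp add: zterm_def del: of_nat_Suc)
    have "(\<lambda>n. real (Suc n) powr (- x)) \<longlonglongrightarrow> 0"
      using assms by (intro tendsto_neg_powr filterlim_compose[OF filterlim_real_sequentially filterlim_Suc]) auto
    from sums_mult[OF telescope_sums'[OF this], of "x - 1"]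
    have t: "(\<lambda>n. (x - 1) * (real (Suc n) powr (- x) - real (Suc (Suc n)) powr (- x))) sums (x - 1)" by simp
    have S: "(\<lambda>n. Re (zterm n (of_real x))) sums Re (zeta1 (of_real x) - 1)"
      using zeta1_sums[of "of_real x"] assms by (intro sums_Re) auto
    have "x - 1 \<le> Re (zeta1 (of_real x) - 1)"
    proof (rule sums_le[OF _ t S])
      fix n
      have "\<exists>z. real (Suc n) < z \<and> z < real (Suc (Suc n)) \<and>
         real (Suc (Suc n)) powr (1 - x) - real (Suc n) powr (1 - x) = (real (Suc (Suc n)) - real (Suc n)) * ((1 - x) * z powr (1 - x - 1))"
        by (rule MVT2) (auto intro!: derivative_eq_intros)
      then obtain z where z: "real (Suc n) < z" "z < real (Suc (Suc n))"
         "real (Suc (Suc n)) powr (1 - x) - real (Suc n) powr (1 - x) = (1 - x) * z powr (- x)" by auto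
      have "real (Suc (Suc n)) powr (- x) \<le> z powr (- x)" using z assms by (intro powr_mono2') auto
      then have "(1 - x) * real (Suc (Suc n)) powr (- x) \<le> (1 - x) * z powr (- x)" using 1 by (intro mult_left_mono) auto
      then show "(x - 1) * (real (Suc n) powr (- x) - real (Suc (Suc n)) powr (- x)) \<le> Re (zterm n (of_real x))"
        unfolding zr Re_complex_of_real using z(3) by (simp add: algebra_simps)
    qed
    then show ?thesis using assms by simp
  next
    case 2 then show ?thesis by (simp add: zeta1_1)
  next
    case 3
    have "(\<Sum>n. real (Suc n) powr (- x)) > 0"
      using summable_powr_Suc[OF 3] by (intro suminf_pos) auto
    then show ?thesis using 3 by (simp add: zeta1_real_gt_1)
  qed
qed

lemma zeta1_bound:
  obtains C where "C \<ge> 0" "\<And>s. Re s \<ge> 1 / 2 \<Longrightarrow> norm (zeta1 s) \<le> 1 + C * norm (s - 1) * norm s"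
proof
  let ?C = "\<Sum>n. real (Suc n) powr (- (3/2))"
  have sm: "summable (\<lambda>n. real (Suc n) powr (- (3/2)))" by (rule summable_powr_Suc) simp
  show "?C \<ge> 0" by (intro suminf_nonneg sm) simp
  fix s assume s: "Re s \<ge> 1 / 2"
  have b: "norm (zterm n s) \<le> norm (s - 1) * norm s * real (Suc n) powr (- (3/2))" for n
  proof -
    have "norm (zterm n s) \<le> norm (s - 1) * norm s * real (Suc n) powr (- Re s - 1)"
      using s by (intro zterm_bound) auto
    also have "\<dots> \<le> norm (s - 1) * norm s * real (Suc n) powr (- (3/2))"
      using s by (intro mult_left_mono powr_mono) auto
    finally show ?thesis .
  qed
  have sm': "summable (\<lambda>n. norm (s - 1) * norm s * real (Suc n) powr (- (3/2)))" by (intro summable_mult sm)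
  have "norm (zeta1 s - 1) = norm (\<Sum>n. zterm n s)" using zeta1_sums[of s] s by (simp add: sums_iff)
  also have "\<dots> \<le> (\<Sum>n. norm (s - 1) * norm s * real (Suc n) powr (- (3/2)))"
    by (rule norm_suminf_le[OF b sm'])
  also have "\<dots> = norm (s - 1) * norm s * ?C" by (rule suminf_mult[OF sm])
  finally show "norm (zeta1 s) \<le> 1 + ?C * norm (s - 1) * norm s"
    using norm_triangle_sub[of "zeta1 s" 1] by (simp add: mult_ac)
qed

section \<open>The functional equation\<close>

text \<open>Riemann's \<open>\<xi>\<close>-function. Here \<open>\<Gamma>(s/2 + 1)\<close> absorbs the factor \<open>s/2\<close>, which removes the pole
of \<open>\<Gamma>(s/2)\<close> at \<open>0\<close>.\<close>

definition xi0 :: "complex \<Rightarrow> complex" where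
  "xi0 s = of_real pi powr (- s / 2) * Gamma (s / 2 + 1) * zeta1 s"

text \<open>The formula for \<open>xi0\<close> is only meaningful to the right of \<open>-1\<close>; elsewhere the functional
equation serves as the definition.\<close>

definition xi :: "complex \<Rightarrow> complex" where
  "xi s = (if Re s > -1 then xi0 s else xi0 (1 - s))"

lemma half_plus_1_not_nonpos_Int: "Re s > -2 \<Longrightarrow> s / 2 + 1 \<notin> \<int>\<^sub>\<le>\<^sub>0"
  by (auto elim!: nonpos_Ints_cases simp: complex_eq_iff)

lemma xi0_holomorphic: "xi0 holomorphic_on {s. Re s > -1}"
  unfolding xi0_def
  by (intro holomorphic_intros zeta1_holomorphic) (use half_plus_1_not_nonpos_Int in auto)

text \<open>On the segment \<open>(-1, 0)\<close> both sides are explicit multiples of the same Dirichlet series; the Gamma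
factors agree by Legendre's duplication formula.\<close>

lemma xi0_functional_real:
  assumes s: "-1 < s" "s < (0::real)"
  shows "xi0 (of_real s) = xi0 (1 - of_real s)"
proof -
  define S where "S = (\<Sum>n. real (Suc n) powr (- (1 - s)))"
  let ?z = "complex_of_real s"
  have gni: "complex_of_real x \<notin> \<int>\<^sub>\<le>\<^sub>0" if "x > 0 \<or> (-1 < x \<and> x < 0)" for x
  proof
    assume "complex_of_real x \<in> \<int>\<^sub>\<le>\<^sub>0"
    then obtain n :: nat where "complex_of_real x = - of_nat n" by (elim nonpos_Ints_cases')
    then have "x = - real n" by (metis of_real_eq_iff of_real_minus of_real_of_nat_eq)
    with that show False by (cases n) auto
  qed
  have G2: "Gamma (?z / 2 + 1) = ?z / 2 * Gamma (?z / 2)"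
    using Gamma_plus1[of "?z / 2"] gni[of "s / 2"] s by simp
  have nzG: "Gamma ?z \<noteq> 0" using gni[of s] s by (simp add: Gamma_eq_zero_iff)
  have dup: "Gamma (?z / 2) * Gamma (?z / 2 + 1 / 2) = exp ((1 - ?z) * of_real (ln 2)) * of_real (sqrt pi) * Gamma ?z"
    using Gamma_legendre_duplication[of "?z / 2"] gni[of "s / 2"] gni[of "s / 2 + 1 / 2"] s by simp
  have G3: "Gamma ((1 - ?z) / 2 + 1) = (1 - ?z) / 2 * Gamma ((1 - ?z) / 2)"
    using Gamma_plus1[of "(1 - ?z) / 2"] gni[of "(1 - s) / 2"] s by simp
  have Gr: "complex_of_real (Gamma ((1 + s) / 2)) = Gamma (?z / 2 + 1 / 2)" "complex_of_real (Gamma ((1 - s) / 2)) = Gamma ((1 - ?z) / 2)"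
    by (simp_all add: Gamma_complex_of_real[symmetric] add_divide_distrib add.commute)
  have z1: "zeta1 ?z = (?z - 1) * (Gamma (?z / 2 + 1 / 2) * Gamma ((1 - ?z) / 2) * of_real (2 * pi) powr (?z - 1) * of_real S) / Gamma ?z"
  proof -
    have pw: "of_real ((2 * pi) powr (s - 1)) = complex_of_real (2 * pi) powr (?z - 1)"
      using powr_of_real[of "2 * pi" "s - 1"] by (simp del: of_real_mult)
    have "zeta1 ?z = of_real ((s - 1) * (Gamma ((1 + s) / 2) * Gamma ((1 - s) / 2) * (2 * pi) powr (s - 1) * S)) * rGamma ?z"
      using zeta1_real_neg[OF s] by (simp only: S_def)
    also have "\<dots> = of_real (s - 1) * (Gamma (?z / 2 + 1 / 2) * Gamma ((1 - ?z) / 2) * of_real (2 * pi) powr (?z - 1) * of_real S) / Gamma ?z"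
      by (simp only: of_real_mult[of "s - 1"] of_real_mult[of _ S] of_real_mult[of _ "(2 * pi) powr (s - 1)"]
            of_real_mult[of "Gamma _"] Gr pw rGamma_inverse_Gamma) (simp only: divide_inverse)
    finally show ?thesis by simp
  qed
  have z2: "zeta1 (1 - ?z) = - ?z * of_real S"
    using zeta1_real_gt_1[of "1 - s"] s by (simp add: S_def)
  have P: "of_real pi powr (- ?z / 2) * (exp ((1 - ?z) * of_real (ln 2)) * of_real (sqrt pi)) * of_real (2 * pi) powr (?z - 1) = of_real pi powr (- (1 - ?z) / 2)"
  proof -
    have "complex_of_real pi powr w = exp (w * of_real (ln pi))" for w
      using Ln_of_real[of pi] by (simp add: powr_def)
    moreover have "of_real (2 * pi) powr w = exp (w * (of_real (ln 2) + of_real (ln pi)))" for w :: complex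
      using Ln_of_real[of "2 * pi"] by (simp add: powr_def ln_mult del: of_real_mult)
    moreover have "of_real (sqrt pi) = exp (complex_of_real (ln pi) / 2)"
    proof -
      have sq: "exp (ln pi / 2) = sqrt pi" by (simp flip: ln_sqrt)
      show ?thesis by (simp only: sq[symmetric] exp_of_real[symmetric] of_real_divide of_real_numeral)
    qed
    ultimately show ?thesis
      by (simp only: exp_add[symmetric]) (rule arg_cong[where f = exp], simp add: field_simps)
  qed
  have "xi0 ?z = of_real pi powr (- ?z / 2) * (?z / 2 * (?z - 1)) * (Gamma (?z / 2) * Gamma (?z / 2 + 1 / 2)) * Gamma ((1 - ?z) / 2) * of_real (2 * pi) powr (?z - 1) * of_real S / Gamma ?z"
    unfolding xi0_def G2 z1 by (simp add: mult_ac)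
  also have "\<dots> = (of_real pi powr (- ?z / 2) * (exp ((1 - ?z) * of_real (ln 2)) * of_real (sqrt pi)) * of_real (2 * pi) powr (?z - 1)) * (?z / 2 * (?z - 1)) * Gamma ((1 - ?z) / 2) * of_real S"
    unfolding dup using nzG by (simp add: field_simps)
  also have "\<dots> = of_real pi powr (- (1 - ?z) / 2) * (?z / 2 * (?z - 1)) * Gamma ((1 - ?z) / 2) * of_real S"
    unfolding P ..
  also have "\<dots> = xi0 (1 - ?z)"
    unfolding xi0_def G3 z2 by (simp add: algebra_simps)
  finally show ?thesis .
qed

lemma xi0_functional:
  assumes "-1 < Re s" "Re s < 2"
  shows "xi0 s = xi0 (1 - s)"
proof (rule holomorphic_eq_if_eq_on_real_interval[of xi0 "{s. -1 < Re s} \<inter> {s. Re s < 2}" "\<lambda>s. xi0 (1 - s)" "-1" 0])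
  show "xi0 holomorphic_on {s. -1 < Re s} \<inter> {s. Re s < 2}"
    by (rule holomorphic_on_subset[OF xi0_holomorphic]) auto
  have "(xi0 \<circ> (\<lambda>s. 1 - s)) holomorphic_on {s. -1 < Re s} \<inter> {s. Re s < 2}"
    by (rule holomorphic_on_compose_gen[OF _ xi0_holomorphic]) (auto intro!: holomorphic_intros)
  then show "(\<lambda>s. xi0 (1 - s)) holomorphic_on {s. -1 < Re s} \<inter> {s. Re s < 2}" by (simp add: o_def)
  show "open ({s. -1 < Re s} \<inter> {s. Re s < 2})" by (intro open_Int open_halfspace_Re_gt open_halfspace_Re_lt)
  show "connected ({s. -1 < Re s} \<inter> {s. Re s < 2})"
    by (intro convex_connected convex_Int convex_halfspace_Re_gt convex_halfspace_Re_lt)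
qed (use assms xi0_functional_real in auto)

lemma xi_holomorphic: "xi holomorphic_on A"
proof -
  have 1: "xi holomorphic_on {s. Re s > -1}"
    by (rule holomorphic_transform[OF xi0_holomorphic]) (simp add: xi_def)
  have "(xi0 \<circ> (\<lambda>s. 1 - s)) holomorphic_on {s. Re s < 2}"
    by (rule holomorphic_on_compose_gen[OF _ xi0_holomorphic]) (auto intro!: holomorphic_intros)
  then have 2: "xi holomorphic_on {s. Re s < 2}"
  proof (rule holomorphic_transform)
    fix x assume "x \<in> {s. Re s < 2}"
    then show "(xi0 \<circ> (\<lambda>s. 1 - s)) x = xi x"
      using xi0_functional[of x, symmetric] by (cases "Re x > -1") (simp_all add: xi_def)
  qed
  have "xi holomorphic_on ({s. Re s > -1} \<union> {s. Re s < 2})"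
    by (rule holomorphic_on_Un[OF 1 2]) (rule open_halfspace_Re_gt open_halfspace_Re_lt)+
  then show ?thesis by (rule holomorphic_on_subset) auto
qed

lemma xi_reflect: "xi (1 - s) = xi s"
proof (cases "-1 < Re s \<and> Re s < 2")
  case True
  then show ?thesis using xi0_functional[of s, symmetric] by (simp add: xi_def)
next
  case False
  then show ?thesis by (auto simp: xi_def)
qed

lemma xi_eq_xi0: "Re s > -1 \<Longrightarrow> xi s = xi0 s"
  by (simp add: xi_def)

lemma xi_eq_0_iff: "Re s > -1 \<Longrightarrow> xi s = 0 \<longleftrightarrow> zeta1 s = 0"
  using half_plus_1_not_nonpos_Int[of s] by (simp add: xi_eq_xi0 xi0_def Gamma_eq_zero_iff)

text \<open>The logarithmic derivatives of \<open>\<xi>\<close> at \<open>0\<close> and \<open>1\<close> are opposite. The one at \<open>1\<close> is known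
from Euler's constant, and special values of the digamma function give the rest.\<close>

lemma deriv_zeta1_0: "deriv zeta1 0 = of_real ((ln (2 * pi) - 1) / 2)"
proof -
  have D: "(xi0 has_field_derivative xi0 s * (- of_real (ln pi) / 2 + Digamma (s / 2 + 1) / 2 + deriv zeta1 s / zeta1 s)) (at s)"
    if s: "Re s > -1" "zeta1 s \<noteq> 0" for s
  proof -
    have z: "(zeta1 has_field_derivative deriv zeta1 s) (at s)"
      using zeta1_holomorphic s(1) by (intro holomorphic_derivI[of _ "{s. Re s > -1}"]) (auto simp: open_halfspace_Re_gt)
    have p: "((\<lambda>s. of_real pi powr (- s / 2)) has_field_derivative Ln (of_real pi) * of_real pi powr (- s / 2) * (- 1 / 2)) (at s)"
      by (rule DERIV_chain2[OF has_field_derivative_powr_right]) (auto intro!: derivative_eq_intros)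
    have g: "((\<lambda>s. Gamma (s / 2 + 1)) has_field_derivative Gamma (s / 2 + 1) * Digamma (s / 2 + 1) * (1 / 2)) (at s)"
      by (rule DERIV_chain2[OF has_field_derivative_Gamma]) (use s half_plus_1_not_nonpos_Int[of s] in \<open>auto intro!: derivative_eq_intros\<close>)
    have "((\<lambda>s. of_real pi powr (- s / 2) * Gamma (s / 2 + 1) * zeta1 s) has_field_derivative
        (Ln (of_real pi) * of_real pi powr (- s / 2) * (- 1 / 2) * Gamma (s / 2 + 1) + Gamma (s / 2 + 1) * Digamma (s / 2 + 1) * (1 / 2) * of_real pi powr (- s / 2)) * zeta1 s
         + deriv zeta1 s * (of_real pi powr (- s / 2) * Gamma (s / 2 + 1))) (at s)"
      by (intro DERIV_mult z p g)
    moreover have "(Ln (of_real pi) * P * (- 1 / 2) * G + G * d * (1 / 2) * P) * Z + Z' * (P * G)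
        = P * G * Z * (- of_real (ln pi) / 2 + d / 2 + Z' / Z)" if "Z \<noteq> 0" for P G d Z Z' :: complex
      using that Ln_of_real[of pi] by (simp add: field_simps)
    ultimately show ?thesis using s(2) by (simp add: xi0_def[abs_def])
  qed
  have D0: "(xi0 has_field_derivative xi0 0 * (- of_real (ln pi) / 2 + Digamma 1 / 2 + 2 * deriv zeta1 0)) (at 0)"
    using D[of 0] by (simp add: zeta1_0 mult.commute)
  have D1: "(xi0 has_field_derivative xi0 1 * (- of_real (ln pi) / 2 + Digamma (3 / 2) / 2 + of_real euler_mascheroni)) (at 1)"
    using D[of 1] by (simp add: zeta1_1 deriv_zeta1_1 add_divide_distrib)
  have Dx: "((\<lambda>s. xi0 (1 - s)) has_field_derivative xi0 1 * (- of_real (ln pi) / 2 + Digamma (3 / 2) / 2 + of_real euler_mascheroni) * (- 1)) (at 0)"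
    by (rule DERIV_chain2[of xi0]) (use D1 in \<open>auto intro!: derivative_eq_intros\<close>)
  have ev: "eventually (\<lambda>s. xi0 (1 - s) = xi0 s) (nhds 0)"
  proof -
    have "eventually (\<lambda>s::complex. s \<in> ball 0 1) (nhds 0)" by (intro eventually_nhds_in_open) auto
    then show ?thesis
    proof eventually_elim
      case (elim s)
      then show ?case using xi0_functional[of s] abs_Re_le_cmod[of s] by auto
    qed
  qed
  have "(xi0 has_field_derivative xi0 1 * (- of_real (ln pi) / 2 + Digamma (3 / 2) / 2 + of_real euler_mascheroni) * (- 1)) (at 0)"
    by (rule iffD1[OF has_field_derivative_cong_eventually Dx]) (use ev xi0_functional[of 0] in \<open>auto simp: eventually_at_filter elim: eventually_mono\<close>)
  from DERIV_unique[OF D0 this]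
  have eq: "xi0 0 * (- of_real (ln pi) / 2 + Digamma 1 / 2 + 2 * deriv zeta1 0) = xi0 1 * (- of_real (ln pi) / 2 + Digamma (3 / 2) / 2 + of_real euler_mascheroni) * (- 1)" .
  have x01: "xi0 1 = xi0 0" using xi0_functional[of 0] by simp
  have x00: "xi0 0 = 1 / 2" by (simp add: xi0_def zeta1_0)
  have D3: "Digamma (3 / 2 :: complex) = - of_real euler_mascheroni - of_real (2 * ln 2) + 2"
    using Digamma_plus1[of "1/2 :: complex"] Digamma_one_half[where 'a = complex] by simp
  have alg: "2 * Z = L + l - 1" if H: "1 / 2 * (- L / 2 + - g / 2 + 2 * Z) = 1 / 2 * (- L / 2 + (- g - 2 * l + 2) / 2 + g) * (- 1)" for Z L l g :: complex
  proof -
    have "16 * (1 + 2 * Z) = 16 * (L + l)" using H by (simp add: field_simps)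
    then have "1 + 2 * Z = L + l" by (simp only: mult_cancel_left) simp
    then show ?thesis by (simp add: algebra_simps)
  qed
  have "2 * deriv zeta1 0 = of_real (ln pi) + of_real (ln 2) - 1"
    by (rule alg[where g = "of_real euler_mascheroni"]) (use eq in \<open>simp add: x01 x00 D3\<close>)
  then have "deriv zeta1 0 = of_real ((ln pi + ln 2 - 1) / 2)" by (simp add: field_simps)
  moreover have "ln (2 * pi) = ln 2 + ln pi" by (simp add: ln_mult)
  ultimately show ?thesis by (simp only: add.commute)
qed

lemma norm_Gamma_le:
  assumes "Re z > 0"
  shows "norm (Gamma z) \<le> Gamma (Re z)"
proof -
  have 1: "((\<lambda>t. complex_of_real t powr (z - 1) / of_real (exp t)) has_integral Gamma z) {0..}"
    by (rule Gamma_integral_complex[OF assms])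
  have 2: "((\<lambda>t. t powr (Re z - 1) / exp t) has_integral Gamma (Re z)) {0..}"
    by (rule Gamma_integral_real[OF assms])
  have "norm (integral {0..} (\<lambda>t. complex_of_real t powr (z - 1) / of_real (exp t))) \<le> integral {0..} (\<lambda>t. t powr (Re z - 1) / exp t)"
    using 1 2 by (intro integral_norm_bound_integral) (auto simp: integrable_on_def norm_divide norm_powr_real_powr)
  then show ?thesis using 1 2 by (simp add: integral_unique)
qed

lemma Gamma_real_le_exp:
  assumes "x \<ge> (1::real)"
  shows "Gamma x \<le> exp (2 * (x + 2) powr (3 / 2))"
proof -
  define n where "n = nat \<lceil>x\<rceil>"
  have n: "x \<le> real n" "real n < x + 1" using assms by (auto simp: n_def) linarith
  have "Gamma x * 1 \<le> Gamma x * x" using assms by (intro mult_left_mono Gamma_real_nonneg) auto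
  also have "Gamma x * x = Gamma (x + 1)"
    using Gamma_plus1[of x] assms nonpos_Ints_nonpos[of x] by force
  also have "\<dots> \<le> Gamma (real n + 2)"
    using Gamma_real_strict_mono[of "x + 1" "real n + 2"] n assms by simp
  also have "\<dots> = fact (n + 1)" using Gamma_fact[of "n + 1", where 'a = real] by (simp add: add_ac)
  also have "\<dots> \<le> real (n + 1) ^ (n + 1)"
    by (metis fact_le_power of_nat_power)
  also have "\<dots> = exp (real (n + 1) * ln (real (n + 1)))" by (simp add: exp_of_nat_mult del: of_nat_add of_nat_Suc)
  also have "\<dots> \<le> exp (real (n + 1) * (real (n + 1) powr (1/2) / (1/2)))"
    by (intro iffD2[OF exp_le_cancel_iff] mult_left_mono ln_powr_bound) auto
  also have "real (n + 1) * (real (n + 1) powr (1/2) / (1/2)) = 2 * real (n + 1) powr (3/2)"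
    using powr_mult_base[of "real (n + 1)" "1/2"] by simp
  also have "exp \<dots> \<le> exp (2 * (x + 2) powr (3/2))"
    using n assms by (intro iffD2[OF exp_le_cancel_iff] mult_left_mono powr_mono2) auto
  finally show ?thesis by simp
qed

text \<open>The point of the exponent is \<open>3/2 < 2\<close>. By the functional equation it is
enough to treat \<open>Re s \<ge> 1/2\<close>, where \<open>\<Gamma>\<close> dominates.\<close>

lemma xi_growth:
  obtains A where "A \<ge> 0" "\<And>s. norm (xi s) \<le> A * exp (4 * (norm s + 4) powr (3 / 2))"
proof -
  obtain C where C: "C \<ge> 0" "\<And>s. Re s \<ge> 1 / 2 \<Longrightarrow> norm (zeta1 s) \<le> 1 + C * norm (s - 1) * norm s"
    using zeta1_bound by blast
  have right: "norm (xi s) \<le> (1 + C) * exp (4 * (norm s + 3) powr (3 / 2))" if s: "Re s \<ge> 1 / 2" for s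
  proof -
    define y where "y = norm s + 3"
    have y: "y \<ge> 3" by (simp add: y_def)
    have r: "Re s \<le> norm s" by (rule complex_Re_le_cmod)
    have b1: "norm (of_real pi powr (- s / 2) :: complex) \<le> 1"
    proof -
      have "norm (of_real pi powr (- s / 2) :: complex) = pi powr (- Re s / 2)"
        by (subst norm_powr_real_powr) auto
      also have "\<dots> \<le> pi powr 0" using s pi_gt3 by (intro powr_mono) auto
      finally show ?thesis by simp
    qed
    have b2: "norm (Gamma (s / 2 + 1)) \<le> exp (2 * y powr (3 / 2))"
    proof -
      have "norm (Gamma (s / 2 + 1)) \<le> Gamma (Re s / 2 + 1)"
        using norm_Gamma_le[of "s / 2 + 1"] s by simp
      also have "\<dots> \<le> exp (2 * (Re s / 2 + 1 + 2) powr (3 / 2))"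
        using s by (intro Gamma_real_le_exp) auto
      also have "\<dots> \<le> exp (2 * y powr (3 / 2))"
        using s r by (intro iffD2[OF exp_le_cancel_iff] mult_left_mono powr_mono2) (auto simp: y_def)
      finally show ?thesis .
    qed
    have b3: "norm (zeta1 s) \<le> (1 + C) * exp (2 * y powr (3 / 2))"
    proof -
      have "norm (s - 1) \<le> y" using norm_triangle_ineq4[of s 1] by (simp add: y_def)
      then have m: "norm (s - 1) * norm s \<le> y * y" by (intro mult_mono) (auto simp: y_def)
      have "norm (zeta1 s) \<le> 1 + C * (norm (s - 1) * norm s)" using C(2)[OF s] by (simp add: mult.assoc)
      also have "\<dots> \<le> y * y + C * (y * y)"
        using m C(1) y mult_mono[of 1 y 1 y] by (intro add_mono mult_left_mono) auto
      also have "\<dots> = (1 + C) * (y * y)" by (simp add: algebra_simps)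
      also have "y * y \<le> exp y * exp y"
        using y order_trans[OF _ exp_ge_add_one_self[of y], of y] by (intro mult_mono) auto
      also have "exp y * exp y = exp (2 * y)" by (simp flip: exp_add)
      also have "y \<le> y powr (3 / 2)" using y powr_mono[of 1 "3/2" y] by simp
      finally show ?thesis using C(1) by (simp add: mult_left_mono)
    qed
    have b12: "norm (of_real pi powr (- s / 2) :: complex) * norm (Gamma (s / 2 + 1)) \<le> 1 * exp (2 * y powr (3 / 2))"
      by (rule mult_mono[OF b1 b2]) auto
    have "norm (xi s) = norm (of_real pi powr (- s / 2) :: complex) * norm (Gamma (s / 2 + 1)) * norm (zeta1 s)"
      using s by (simp add: xi_def xi0_def norm_mult)
    also have "\<dots> \<le> 1 * exp (2 * y powr (3 / 2)) * ((1 + C) * exp (2 * y powr (3 / 2)))"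
      by (rule mult_mono[OF b12 b3]) auto
    also have "\<dots> = (1 + C) * exp (4 * y powr (3 / 2))" by (simp flip: exp_add)
    finally show ?thesis by (simp add: y_def)
  qed
  show ?thesis
  proof (rule that[of "1 + C"])
    show "1 + C \<ge> 0" using C by simp
    fix s :: complex
    have mono: "(1 + C) * exp (4 * (norm w + 3) powr (3 / 2)) \<le> (1 + C) * exp (4 * (norm s + 4) powr (3 / 2))" if "norm w \<le> norm s + 1" for w :: complex
      using that C(1) by (intro mult_left_mono iffD2[OF exp_le_cancel_iff] powr_mono2) auto
    show "norm (xi s) \<le> (1 + C) * exp (4 * (norm s + 4) powr (3 / 2))"
    proof (cases "Re s \<ge> 1 / 2")
      case True
      then show ?thesis using right[of s] mono[of s] by linarith
    next
      case False
      have "norm (1 - s) \<le> norm s + 1" using norm_triangle_ineq4[of 1 s] by simp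
      moreover have "norm (xi (1 - s)) \<le> (1 + C) * exp (4 * (norm (1 - s) + 3) powr (3 / 2))" using False by (intro right) auto
      ultimately show ?thesis using mono[of "1 - s"] xi_reflect[of s] by simp
    qed
  qed
qed

section \<open>Euler products\<close>

definition smooth :: "nat \<Rightarrow> nat set" where
  "smooth N = {n. n > 0 \<and> (\<forall>p. prime p \<longrightarrow> p dvd n \<longrightarrow> p < N)}"

lemma smooth_Suc_not_prime: "\<not> prime N \<Longrightarrow> smooth (Suc N) = smooth N"
  by (auto simp: smooth_def less_Suc_eq)

lemma smooth_0: "smooth 0 = {1}"
proof (intro equalityI subsetI)
  fix n assume "n \<in> smooth 0"
  then have "\<not> (\<exists>p. prime p \<and> p dvd n)" by (simp add: smooth_def)
  then have "n = 1" using prime_factor_nat[of n] by (rule contrapos_np)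
  then show "n \<in> {1}" by simp
next
  fix n :: nat assume "n \<in> {1}"
  then show "n \<in> smooth 0" by (auto simp: smooth_def)
qed

text \<open>Unique factorization, one prime at a time: the exponent of the new prime and the remaining
cofactor determine the number.\<close>

lemma bij_betw_smooth_Suc:
  assumes p: "prime p"
  shows "bij_betw (\<lambda>(j, n). p ^ j * n) (UNIV \<times> smooth p) (smooth (Suc p))"
proof (rule bij_betwI')
  have pp: "p > 0" "p > 1" using prime_gt_0_nat[OF p] prime_gt_1_nat[OF p] by simp_all
  have nd: "\<not> p dvd n" if "n \<in> smooth p" for n using that p by (auto simp: smooth_def)
  fix x y :: "nat \<times> nat" assume "x \<in> UNIV \<times> smooth p" "y \<in> UNIV \<times> smooth p"
  then obtain i m j n where xy: "x = (i, m)" "y = (j, n)" "m \<in> smooth p" "n \<in> smooth p" by auto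
  have mult: "multiplicity p (p ^ k * l) = k" if "l \<in> smooth p" for k l
  proof -
    have "l \<noteq> 0" "\<not> p dvd l" using nd that by (auto simp: smooth_def)
    moreover have "p ^ k \<noteq> 0" using pp by simp
    moreover have "prime_elem p" using p by simp
    ultimately have "multiplicity p (p ^ k * l) = multiplicity p (p ^ k) + multiplicity p l"
      by (intro prime_elem_multiplicity_mult_distrib)
    also have "multiplicity p (p ^ k) = k"
      using p pp by (intro multiplicity_same_power) (auto simp: not_prime_unit)
    also have "multiplicity p l = 0" using \<open>\<not> p dvd l\<close> by (rule not_dvd_imp_multiplicity_0)
    finally show ?thesis by simp
  qed
  show "((case x of (j, n) \<Rightarrow> p ^ j * n) = (case y of (j, n) \<Rightarrow> p ^ j * n)) = (x = y)"
  proof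
    assume "(case x of (j, n) \<Rightarrow> p ^ j * n) = (case y of (j, n) \<Rightarrow> p ^ j * n)"
    then have e: "p ^ i * m = p ^ j * n" by (simp add: xy)
    have "i = multiplicity p (p ^ i * m)" by (rule mult[OF xy(3), symmetric])
    also have "\<dots> = j" unfolding e by (rule mult[OF xy(4)])
    finally have "i = j" .
    moreover have "m = n" using e pp(1) unfolding \<open>i = j\<close> by simp
    ultimately show "x = y" by (simp add: xy)
  qed simp
next
  fix x :: "nat \<times> nat" assume "x \<in> UNIV \<times> smooth p"
  then obtain i m where x: "x = (i, m)" "m \<in> smooth p" by auto
  have "p ^ i * m \<in> smooth (Suc p)"
    unfolding smooth_def
  proof (safe)
    show "0 < p ^ i * m" using x p by (auto simp: smooth_def prime_gt_0_nat)
    fix q assume "prime q" "q dvd p ^ i * m"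
    then have "q dvd p \<or> q dvd m" by (metis prime_dvd_mult_iff prime_dvd_power_nat)
    then show "q < Suc p"
      using x \<open>prime q\<close> p by (auto simp: smooth_def less_Suc_eq dest: primes_dvd_imp_eq)
  qed
  then show "(case x of (j, n) \<Rightarrow> p ^ j * n) \<in> smooth (Suc p)" by (simp add: x)
next
  fix y assume y: "y \<in> smooth (Suc p)"
  then have y0: "y \<noteq> 0" by (simp add: smooth_def)
  obtain m where m: "y = p ^ multiplicity p y * m" "\<not> p dvd m"
    using multiplicity_decompose'[of y p] y0 p by (metis not_prime_unit)
  have "m \<in> smooth p"
    unfolding smooth_def
  proof safe
    show "m > 0" using m y0 by (cases m) auto
    fix q assume q: "prime q" "q dvd m"
    then have "q dvd y" using m(1) by (metis dvd_mult)
    then have "q < Suc p" using y q by (auto simp: smooth_def)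
    moreover have "q \<noteq> p" using q m by auto
    ultimately show "q < p" by simp
  qed
  then show "\<exists>x\<in>UNIV \<times> smooth p. y = (case x of (j, n) \<Rightarrow> p ^ j * n)"
    using m(1) by (intro bexI[of _ "(multiplicity p y, m)"]) auto
qed

text \<open>The value \<open>1\<close> off the primes lets Euler products run over all natural numbers below a bound.\<close>

definition local_factor :: "(nat \<Rightarrow> complex) \<Rightarrow> nat \<Rightarrow> complex" where
  "local_factor f p = (if prime p then \<Sum>\<^sub>\<infinity>j. f (p ^ j) else 1)"

text \<open>Passing from \<open>N\<close> to \<open>N + 1\<close> splits the sum along the bijection of the previous lemma.\<close>

lemma infsum_smooth:
  fixes f :: "nat \<Rightarrow> complex"
  assumes f1: "f 1 = 1" and mult: "\<And>m n. coprime m n \<Longrightarrow> f (m * n) = f m * f n"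
    and abs: "(\<lambda>n. norm (f n)) summable_on {0<..}"
  shows "infsum f (smooth N) = (\<Prod>p<N. local_factor f p)"
proof (induction N)
  case 0
  then show ?case using f1 by (simp add: smooth_0)
next
  case (Suc N)
  show ?case
  proof (cases "prime N")
    case False
    then show ?thesis using Suc by (simp add: smooth_Suc_not_prime local_factor_def)
  next
    case True
    have sub: "smooth k \<subseteq> {0<..}" for k by (auto simp: smooth_def)
    have absS: "(\<lambda>n. norm (f n)) summable_on smooth k" for k
      by (rule summable_on_subset_banach[OF abs sub])
    have bij: "bij_betw (\<lambda>(j, n). N ^ j * n) (UNIV \<times> smooth N) (smooth (Suc N))"
      by (rule bij_betw_smooth_Suc[OF True])
    have cop: "coprime (N ^ j) n" if "n \<in> smooth N" for j n
    proof -
      have "\<not> N dvd n" using that True by (auto simp: smooth_def)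
      then have "coprime N n" using True by (simp add: prime_imp_coprime)
      then show ?thesis by simp
    qed
    have "infsum f (smooth (Suc N)) = infsum (\<lambda>(j, n). f (N ^ j * n)) (UNIV \<times> smooth N)"
      using infsum_reindex_bij_betw[OF bij, of f] by (simp add: split_def)
    also have "\<dots> = infsum (\<lambda>(j, n). f (N ^ j) * f n) (UNIV \<times> smooth N)"
      by (intro infsum_cong) (auto simp: mult[OF cop])
    also have "\<dots> = infsum (\<lambda>j. infsum (\<lambda>n. f (N ^ j) * f n) (smooth N)) UNIV"
    proof (rule infsum_Sigma'_banach[symmetric])
      have "f summable_on smooth (Suc N)" using absS abs_summable_summable by blast
      then have "(\<lambda>(j, n). f (N ^ j * n)) summable_on UNIV \<times> smooth N"
        using summable_on_reindex_bij_betw[OF bij, of f] by (simp add: split_def)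
      then show "(\<lambda>(j, n). f (N ^ j) * f n) summable_on UNIV \<times> smooth N"
        by (rule summable_on_cong[THEN iffD1, rotated]) (auto simp: mult[OF cop])
    qed
    also have "\<dots> = infsum (\<lambda>j. f (N ^ j)) UNIV * infsum f (smooth N)"
      by (simp add: infsum_cmult_right' infsum_cmult_left')
    finally show ?thesis using Suc True by (simp add: local_factor_def mult.commute)
  qed
qed

text \<open>The finite product is the sum over numbers without prime factors \<open>\<ge> N\<close>, and all numbers that
are missed are at least \<open>N\<close>; they contribute at most a tail of the series of absolute values.\<close>

theorem Euler_product:
  fixes f :: "nat \<Rightarrow> complex"
  assumes f1: "f 1 = 1" and mult: "\<And>m n. coprime m n \<Longrightarrow> f (m * n) = f m * f n"
    and abs: "summable (\<lambda>n. norm (f (Suc n)))"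
  shows "(\<lambda>N. \<Prod>p<N. local_factor f p) \<longlonglongrightarrow> (\<Sum>n. f (Suc n))"
proof -
  have bij: "bij_betw Suc UNIV {0<..}"
    by (rule bij_betw_byWitness[of _ "\<lambda>n. n - 1"]) auto
  have "(\<lambda>n. norm (f (Suc n))) summable_on UNIV"
    using abs by (subst summable_on_UNIV_nonneg_real_iff) auto
  then have abs': "(\<lambda>n. norm (f n)) summable_on {0<..}"
    using summable_on_reindex_bij_betw[OF bij, of "\<lambda>n. norm (f n)"] by simp
  have sm: "f summable_on A" if "A \<subseteq> {0<..}" for A
    using abs_summable_summable summable_on_subset_banach[OF abs' that] by blast
  have tot: "infsum f {0<..} = (\<Sum>n. f (Suc n))"
  proof -
    have "infsum f {0<..} = infsum (\<lambda>n. f (Suc n)) UNIV"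
      using infsum_reindex_bij_betw[OF bij, of f] by simp
    also have "\<dots> = (\<Sum>n. f (Suc n))"
      by (rule infsumI[OF norm_summable_imp_has_sum[OF abs summable_sums[OF summable_norm_cancel[OF abs]]]])
    finally show ?thesis .
  qed
  show ?thesis
  proof (rule LIMSEQ_I)
    fix e :: real assume e: "e > 0"
    define t where "t = (\<lambda>N. \<Sum>n. norm (f (Suc (n + N))))"
    have "t \<longlonglongrightarrow> 0" unfolding t_def using abs by (rule suminf_exist_split2)
    then obtain N0 where N0: "\<And>N. N \<ge> N0 \<Longrightarrow> norm (t N) < e"
      using LIMSEQ_D[OF _ e, of t 0] by auto
    have "norm ((\<Prod>p<N. local_factor f p) - (\<Sum>n. f (Suc n))) < e" if N: "N \<ge> Suc N0" for N
    proof -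
      have subN: "smooth N \<subseteq> {0<..}" by (auto simp: smooth_def)
      have "infsum f {0<..} = infsum f (smooth N \<union> ({0<..} - smooth N))" using subN by (simp add: Un_absorb1 Un_Diff_cancel)
      also have "\<dots> = infsum f (smooth N) + infsum f ({0<..} - smooth N)"
        by (rule infsum_Un_disjoint[OF sm[OF subN] sm]) auto
      finally have d: "infsum f {0<..} = (\<Prod>p<N. local_factor f p) + infsum f ({0<..} - smooth N)"
        using infsum_smooth[OF f1 mult abs', of N] by simp
      have "norm ((\<Prod>p<N. local_factor f p) - (\<Sum>n. f (Suc n))) = norm (infsum f ({0<..} - smooth N))"
        unfolding tot[symmetric] d by simp
      also have "\<dots> \<le> infsum (\<lambda>n. norm (f n)) ({0<..} - smooth N)"
        by (intro norm_infsum_bound) (auto intro: summable_on_subset_banach[OF abs'])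
      also have "\<dots> \<le> infsum (\<lambda>n. norm (f n)) {N..}"
      proof (rule infsum_mono_neutral)
        show "(\<lambda>n. norm (f n)) summable_on {0<..} - smooth N" by (rule summable_on_subset_banach[OF abs']) auto
        show "(\<lambda>n. norm (f n)) summable_on {N..}" by (rule summable_on_subset_banach[OF abs']) (use N in auto)
        fix n assume "n \<in> ({0<..} - smooth N) - {N..}"
        then obtain p where p: "n > 0" "n < N" "prime p" "p dvd n" "\<not> p < N" by (auto simp: smooth_def)
        then have "p \<le> n" by (intro dvd_imp_le) auto
        with p show "norm (f n) \<le> 0" by simp
      qed auto
      also have "infsum (\<lambda>n. norm (f n)) {N..} = t (N - 1)"
      proof -
        have bN: "bij_betw (\<lambda>n. Suc (n + (N - 1))) UNIV {N..}"
          by (rule bij_betw_byWitness[of _ "\<lambda>n. n - N"]) (use N in auto)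
        have "infsum (\<lambda>n. norm (f n)) {N..} = infsum (\<lambda>n. norm (f (Suc (n + (N - 1))))) UNIV"
          using infsum_reindex_bij_betw[OF bN, of "\<lambda>n. norm (f n)"] by simp
        also have "\<dots> = t (N - 1)" unfolding t_def
        proof -
          have "summable (\<lambda>n. norm (f (Suc (n + (N - 1)))))"
            using abs summable_iff_shift[of "\<lambda>n. norm (f (Suc n))" "N - 1"] by simp
          then show "infsum (\<lambda>n. norm (f (Suc (n + (N - 1))))) UNIV = (\<Sum>n. norm (f (Suc (n + (N - 1)))))"
            by (intro infsumI norm_summable_imp_has_sum summable_sums) simp_all
        qed
        finally show ?thesis .
      qed
      also have "t (N - 1) < e"
      proof -
        have "N0 \<le> N - 1" using N by linarith
        from N0[OF this] show ?thesis by simp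
      qed
      finally show ?thesis .
    qed
    then show "\<exists>no. \<forall>n\<ge>no. norm ((\<Prod>p<n. local_factor f p) - (\<Sum>n. f (Suc n))) < e" by blast
  qed
qed

text \<open>Besides the holomorphic limit, the convergence of the derivatives is recorded: it will give the
derivative of an infinite product at a point from that of its partial products.\<close>

lemma holomorphic_product:
  fixes f :: "nat \<Rightarrow> complex \<Rightarrow> complex"
  assumes S: "open S" and hol: "\<And>n. f n holomorphic_on S"
    and bound: "\<And>x. x \<in> S \<Longrightarrow> \<exists>d>0. \<exists>h. summable h \<and> ball x d \<subseteq> S \<and> (\<forall>n. \<forall>y\<in>ball x d. norm (f n y - 1) \<le> h n)"
  obtains P where "P holomorphic_on S" "\<And>s. s \<in> S \<Longrightarrow> (\<lambda>N. \<Prod>n<N. f n s) \<longlonglongrightarrow> P s"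
    "\<And>s. s \<in> S \<Longrightarrow> P s = 0 \<longleftrightarrow> (\<exists>n. f n s = 0)"
    "\<And>s. s \<in> S \<Longrightarrow> (\<lambda>N. deriv (\<lambda>z. \<Prod>n<N. f n z) s) \<longlonglongrightarrow> deriv P s"
proof -
  define P where "P = (\<lambda>s. \<Prod>n. f n s)"
  have conv: "convergent_prod (\<lambda>n. f n s)" if s: "s \<in> S" for s
  proof -
    obtain d h where dh: "d > 0" "summable h" "\<And>n y. y \<in> ball s d \<Longrightarrow> norm (f n y - 1) \<le> h n"
      using bound[OF s] by metis
    have "summable (\<lambda>n. norm (f n s - 1))"
      by (rule summable_comparison_test'[OF dh(2), of 0]) (use dh in auto)
    then show ?thesis
      by (intro abs_convergent_prod_imp_convergent_prod summable_imp_abs_convergent_prod)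
  qed
  have lim: "(\<lambda>N. \<Prod>n<N. f n s) \<longlonglongrightarrow> P s" if "s \<in> S" for s
    using convergent_prod_LIMSEQ[OF conv[OF that]] LIMSEQ_imp_Suc[of "\<lambda>N. \<Prod>n<N. f n s"]
    by (simp add: P_def lessThan_Suc_atMost)
  have unif: "\<exists>d>0. cball x d \<subseteq> S \<and> uniform_limit (cball x d) (\<lambda>N s. \<Prod>n<N. f n s) P sequentially" if x: "x \<in> S" for x
  proof -
    obtain d h where dh: "d > 0" "summable h" "ball x d \<subseteq> S" "\<And>n y. y \<in> ball x d \<Longrightarrow> norm (f n y - 1) \<le> h n"
      using bound[OF x] by metis
    define e where "e = d / 2"
    have e: "e > 0" "cball x e \<subseteq> ball x d" using dh by (auto simp: e_def)
    have "uniformly_convergent_on (cball x e) (\<lambda>N s. \<Prod>n<N. f n s)"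
    proof (rule uniformly_convergent_on_prod')
      show "uniformly_convergent_on (cball x e) (\<lambda>N s. \<Sum>n<N. norm (f n s - 1))"
        by (rule Weierstrass_m_test'[OF _ dh(2)]) (use dh(4) e in auto)
      show "continuous_on (cball x e) (f n)" for n
        using hol e dh by (intro holomorphic_on_imp_continuous_on) (blast intro: holomorphic_on_subset)
    qed auto
    then obtain Q where Q: "uniform_limit (cball x e) (\<lambda>N s. \<Prod>n<N. f n s) Q sequentially"
      by (auto simp: uniformly_convergent_on_def)
    have "Q s = P s" if "s \<in> cball x e" for s
      using tendsto_uniform_limitI[OF Q that] lim[of s] that e dh LIMSEQ_unique by blast
    then have "uniform_limit (cball x e) (\<lambda>N s. \<Prod>n<N. f n s) P sequentially"
      using Q by (subst uniform_limit_cong'[of _ _ _ P Q]) auto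
    then show ?thesis using e dh by blast
  qed
  have holN: "(\<lambda>s. \<Prod>n<N. f n s) holomorphic_on S" for N
    by (intro holomorphic_intros hol)
  have derN: "((\<lambda>s. \<Prod>n<N. f n s) has_field_derivative deriv (\<lambda>s. \<Prod>n<N. f n s) x) (at x)" if "x \<in> S" for N x
    using holN S that by (rule holomorphic_derivI)
  have "\<exists>g'. \<forall>x\<in>S. (P has_field_derivative g' x) (at x) \<and> (\<lambda>N. deriv (\<lambda>s. \<Prod>n<N. f n s) x) \<longlonglongrightarrow> g' x"
  proof (rule has_complex_derivative_uniform_sequence[OF S derN])
    fix x assume "x \<in> S"
    from unif[OF this] obtain d where d: "d > 0" "cball x d \<subseteq> S"
      "uniform_limit (cball x d) (\<lambda>N s. \<Prod>n<N. f n s) P sequentially" by blast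
    then show "\<exists>d>0. cball x d \<subseteq> S \<and> uniform_limit (cball x d) (\<lambda>N s. \<Prod>n<N. f n s) P sequentially" by blast
  qed auto
  then obtain g' where g': "\<And>x. x \<in> S \<Longrightarrow> (P has_field_derivative g' x) (at x)"
     "\<And>x. x \<in> S \<Longrightarrow> (\<lambda>N. deriv (\<lambda>s. \<Prod>n<N. f n s) x) \<longlonglongrightarrow> g' x" by blast
  show ?thesis
  proof (rule that[of P])
    show "P holomorphic_on S" using g'(1) S by (auto simp: holomorphic_on_open intro!: exI)
    show "(\<lambda>N. deriv (\<lambda>z. \<Prod>n<N. f n z) s) \<longlonglongrightarrow> deriv P s" if "s \<in> S" for s
      using g'[OF that] by (simp add: DERIV_imp_deriv)
    show "P s = 0 \<longleftrightarrow> (\<exists>n. f n s = 0)" if "s \<in> S" for s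
      using has_prod_eq_0_iff[OF convergent_prod_has_prod[OF conv[OF that]]] unfolding P_def by auto
  qed (use lim in auto)
qed

section \<open>Even entire functions of order less than two\<close>

text \<open>Apply the Schwarz lemma to \<open>f(z)/z\<close>, which is again a self-map of the disc fixing \<open>0\<close>. Strict
inequality in the first application comes from its rigidity clause, since \<open>f'(0) = 0\<close> rules out
rotations.\<close>

lemma Schwarz_Lemma_second_order:
  assumes hol: "f holomorphic_on ball 0 1" and f0: "f 0 = 0" and f'0: "deriv f 0 = 0"
    and lt: "\<And>z. norm z < 1 \<Longrightarrow> norm (f z) < 1" and z: "norm z < 1"
  shows "norm (f z) \<le> norm z ^ 2"
proof -
  define h where "h = (\<lambda>w. if w = 0 then deriv f 0 else (f w - f 0) / (w - 0))"
  have hhol: "h holomorphic_on ball 0 1"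
    unfolding h_def by (rule pole_lemma_open[OF hol]) simp
  have fh: "f w = w * h w" for w using f0 by (simp add: h_def)
  have S: "norm (f w) < norm w" if nw: "norm w < 1" and w0: "w \<noteq> 0" for w
  proof -
    have le: "norm (f w) \<le> norm w" using Schwarz_Lemma(1)[OF hol f0 lt that(1)] by blast
    moreover have "norm (f w) \<noteq> norm w"
    proof
      assume "norm (f w) = norm w"
      then obtain \<alpha> where \<alpha>: "\<And>z. norm z < 1 \<Longrightarrow> f z = \<alpha> * z" "norm \<alpha> = 1"
        using Schwarz_Lemma(3)[OF hol f0 lt nw] nw w0 by blast
      have "(f has_field_derivative \<alpha>) (at 0)"
      proof (rule has_field_derivative_transform_within_open[of "\<lambda>z. \<alpha> * z" _ _ "ball 0 1"])
        show "((\<lambda>z. \<alpha> * z) has_field_derivative \<alpha>) (at 0)" by (auto intro!: derivative_eq_intros)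
      qed (use \<alpha> in auto)
      then have "\<alpha> = 0" using f'0 DERIV_imp_deriv by metis
      with \<alpha>(2) show False by simp
    qed
    ultimately show ?thesis by simp
  qed
  have "norm (h w) < 1" if "norm w < 1" for w
  proof (cases "w = 0")
    case True then show ?thesis using f'0 by (simp add: h_def)
  next
    case False
    then show ?thesis using S[OF that False] fh[of w] by (simp add: norm_mult)
  qed
  moreover have "h 0 = 0" using f'0 by (simp add: h_def)
  ultimately have "norm (h z) \<le> norm z"
    using Schwarz_Lemma(1)[OF hhol] z by blast
  then show ?thesis using fh[of z] by (simp add: norm_mult power2_eq_square mult_left_mono)
qed

text \<open>The map \<open>l \<mapsto> l / (2A - l)\<close> takes the half-plane \<open>Re l < A\<close> into the unit disc, so the bound is the
previous lemma in another coordinate. The gain over the usual statement is the factor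
\<open>\<bar>z\<bar>\<^sup>2 / R\<^sup>2\<close>, which beats a growth \<open>A \<approx> R\<^bsup>3/2\<^esup>\<close>.\<close>

lemma Borel_Caratheodory_second_order:
  assumes hol: "L holomorphic_on ball 0 R" and "R > 0" and L0: "L 0 = 0" and L'0: "deriv L 0 = 0"
    and "A > 0" and Re: "\<And>z. norm z < R \<Longrightarrow> Re (L z) < A" and z: "norm z \<le> R / 2"
  shows "norm (L z) \<le> 4 * A * norm z ^ 2 / R ^ 2"
proof -
  let ?B = "2 * complex_of_real A"
  define f where "f = (\<lambda>w. L (of_real R * w) / (?B - L (of_real R * w)))"
  have inb: "norm (of_real R * w) < R" if "norm w < 1" for w :: complex
    using that \<open>R > 0\<close> by (simp add: norm_mult)
  have nz: "?B - L (of_real R * w) \<noteq> 0" if "norm w < 1" for w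
  proof
    assume "?B - L (of_real R * w) = 0"
    then have "Re (L (of_real R * w)) = 2 * A" by (simp add: complex_eq_iff)
    with Re[OF inb[OF that]] \<open>A > 0\<close> show False by simp
  qed
  have Lc: "(\<lambda>w. L (of_real R * w)) holomorphic_on ball 0 1"
  proof -
    have "(L \<circ> (\<lambda>w. of_real R * w)) holomorphic_on ball 0 1"
      by (rule holomorphic_on_compose_gen[OF _ hol]) (use inb in \<open>auto intro!: holomorphic_intros\<close>)
    then show ?thesis by (simp add: o_def)
  qed
  have fhol: "f holomorphic_on ball 0 1"
    unfolding f_def by (intro holomorphic_intros Lc) (use nz in auto)
  have f0: "f 0 = 0" by (simp add: f_def L0)
  have LD: "(L has_field_derivative 0) (at 0)"
    using holomorphic_derivI[OF hol, of 0] \<open>R > 0\<close> L'0 by simp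
  have "((\<lambda>w. L (of_real R * w)) has_field_derivative 0 * of_real R) (at 0)"
    by (rule DERIV_chain2[of L]) (use LD in \<open>auto intro!: derivative_eq_intros\<close>)
  then have "(f has_field_derivative 0) (at 0)"
    unfolding f_def using nz[of 0] by (auto intro!: derivative_eq_intros simp: L0)
  then have f'0: "deriv f 0 = 0" by (rule DERIV_imp_deriv)
  have lt: "norm (f w) < 1" if "norm w < 1" for w
  proof -
    let ?l = "L (of_real R * w)"
    have "norm ?l ^ 2 < norm (?B - ?l) ^ 2"
      using Re[OF inb[OF that]] \<open>A > 0\<close>
    proof -
      have "0 < 4 * A * (A - Re ?l)" using Re[OF inb[OF that]] \<open>A > 0\<close> by (intro mult_pos_pos) auto
      then show ?thesis unfolding cmod_power2 by (simp add: power2_eq_square algebra_simps)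
    qed
    then have "norm ?l < norm (?B - ?l)" by (rule power_less_imp_less_base) simp
    then show ?thesis by (simp add: f_def norm_divide divide_less_eq)
  qed
  define w where "w = z / of_real R"
  have w: "norm w \<le> 1 / 2" "of_real R * w = z" using z \<open>R > 0\<close> by (auto simp: w_def norm_divide field_simps)
  have fw: "norm (f w) \<le> norm w ^ 2"
    by (rule Schwarz_Lemma_second_order[OF fhol f0 f'0 lt]) (use w in auto)
  also have "\<dots> \<le> (1 / 2) ^ 2" using w by (intro power_mono) auto
  finally have f4: "norm (f w) \<le> 1 / 4" by (simp add: power2_eq_square)
  have "L z = f w * (?B - L z)" using nz[of w] w by (simp add: f_def)
  then have "norm (L z) = norm (f w) * norm (?B - L z)" by (metis norm_mult)
  also have "\<dots> \<le> norm (f w) * (2 * A + norm (L z))"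
    using norm_triangle_ineq4[of ?B "L z"] \<open>A > 0\<close> by (intro mult_left_mono) (auto simp: norm_mult)
  also have "\<dots> \<le> norm (f w) * (2 * A) + 1 / 4 * norm (L z)"
    using mult_right_mono[OF f4 norm_ge_zero[of "L z"]] by (simp add: distrib_left)
  finally have *: "norm (L z) \<le> norm (f w) * (2 * A) + 1 / 4 * norm (L z)" .
  have "0 \<le> norm (f w) * A" using \<open>A > 0\<close> by simp
  moreover have "norm (f w) * (2 * A) = 2 * (norm (f w) * A)" "norm (f w) * (4 * A) = 4 * (norm (f w) * A)" by simp_all
  ultimately have "norm (L z) \<le> norm (f w) * (4 * A)" using * norm_ge_zero[of "L z"] by linarith
  also have "\<dots> \<le> norm w ^ 2 * (4 * A)" using fw \<open>A > 0\<close> by (intro mult_right_mono) auto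
  also have "\<dots> = 4 * A * norm z ^ 2 / R ^ 2" using \<open>R > 0\<close> by (simp add: w_def norm_divide power_divide)
  finally show ?thesis .
qed

lemma entire_factor_finite_zeros:
  assumes "finite S" "g holomorphic_on UNIV" "\<And>a. a \<in> S \<Longrightarrow> g a = 0" "0 \<notin> S"
  shows "\<exists>h. h holomorphic_on UNIV \<and> (\<forall>z. g z = h z * (\<Prod>a\<in>S. 1 - z / a))"
  using assms
proof (induction S rule: finite_induct)
  case empty
  then show ?case by auto
next
  case (insert a S)
  then obtain h where h: "h holomorphic_on UNIV" "\<And>z. g z = h z * (\<Prod>b\<in>S. 1 - z / b)" by auto
  have "(\<Prod>b\<in>S. 1 - a / b) \<noteq> 0" using insert by (auto simp: field_simps)
  moreover have "g a = 0" using insert by simp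
  ultimately have ha: "h a = 0" using h(2)[of a] by simp
  define k where "k = (\<lambda>z. - a * (if z = a then deriv h a else (h z - h a) / (z - a)))"
  have "k holomorphic_on UNIV"
    unfolding k_def by (intro holomorphic_intros pole_lemma_open[OF h(1)]) simp
  moreover have "h z = k z * (1 - z / a)" for z
    using insert ha by (auto simp: k_def field_simps)
  ultimately show ?case using h(2) insert by (intro exI[of _ k]) (auto simp: mult_ac)
qed

text \<open>A finite form of Hadamard's factorization. Let \<open>P\<close> be the product
over the zeros in a disc of radius \<open>R\<close>. The quotient \<open>h = g / P\<close> has no zeros there, is bounded on
the circle of radius \<open>3 R\<close> by the bound for \<open>g\<close>, and is even, so \<open>L = log (h / g(0))\<close> vanishes to
second order at \<open>0\<close>. Borel-Caratheodory then makes \<open>L(x) = O(R\<^bsup>-1/2\<^esup>)\<close> for fixed \<open>x\<close>, and in the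
limit only the product over zeros remains.\<close>

lemma even_entire_zero_product_bound:
  fixes g :: "complex \<Rightarrow> complex"
  assumes hol: "g holomorphic_on UNIV" and even: "\<And>z. g (- z) = g z" and g0: "g 0 \<noteq> 0"
    and growth: "\<And>z. norm (g z) \<le> A * exp (B * (norm z + c) powr (3 / 2))" and A: "A > 0" "B \<ge> 0" "c \<ge> 0"
    and simple: "\<And>a. g a = 0 \<Longrightarrow> deriv g a \<noteq> 0"
    and M: "\<And>S. finite S \<Longrightarrow> (\<And>a. a \<in> S \<Longrightarrow> g a = 0) \<Longrightarrow> (\<Prod>a\<in>S. 1 + x\<^sup>2 / (norm a)\<^sup>2) \<le> M"
    and x: "x > 0"
  shows "norm (g (of_real x)) ^ 2 \<le> norm (g 0) ^ 2 * M"
proof -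
  define K where "K = \<bar>ln A\<bar> + \<bar>ln (norm (g 0))\<bar> + 8 * B + 2"
  have bound: "norm (g (of_real x)) ^ 2 \<le> norm (g 0) ^ 2 * exp (8 * K * x\<^sup>2 * R powr (- 1 / 2)) * M"
    if R: "R > 2 * x" "R \<ge> 1" "R \<ge> c" for R
  proof -
    define S where "S = {z \<in> cball 0 R. g z = 0}"
    have fin: "finite S"
    proof (cases "g constant_on UNIV")
      case True
      then have "S = {}" using g0 by (auto simp: S_def constant_on_def)
      then show ?thesis by simp
    next
      case False
      then show ?thesis unfolding S_def
        by (intro holomorphic_compact_finite_zeros[OF hol]) auto
    qed
    have S0: "0 \<notin> S" using g0 by (simp add: S_def)
    obtain h where h: "h holomorphic_on UNIV" "\<And>z. g z = h z * (\<Prod>a\<in>S. 1 - z / a)"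
      using entire_factor_finite_zeros[OF fin hol _ S0] by (auto simp: S_def)
    define P where "P = (\<lambda>z. \<Prod>a\<in>S. 1 - z / a)"
    have gP: "g z = h z * P z" for z using h(2) by (simp add: P_def)
    have Phol: "P holomorphic_on UNIV" unfolding P_def using S0 by (intro holomorphic_intros) auto
    have hnz: "h z \<noteq> 0" if "z \<in> cball 0 R" for z
    proof
      assume hz: "h z = 0"
      then have gz: "g z = 0" by (simp add: gP)
      then have "z \<in> S" using that by (simp add: S_def)
      then have Pz: "P z = 0" using fin S0 by (auto simp: P_def)
      have "(h has_field_derivative deriv h z) (at z)" "(P has_field_derivative deriv P z) (at z)"
        using h(1) Phol by (auto intro!: holomorphic_derivI)
      from DERIV_mult[OF this] have "((\<lambda>z. h z * P z) has_field_derivative 0) (at z)" by (simp add: hz Pz)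
      then have "deriv g z = 0" by (intro DERIV_imp_deriv) (simp add: gP[abs_def])
      with simple[OF gz] show False by simp
    qed
    have Pn0: "P z \<noteq> 0" if "z \<notin> S" for z using fin S0 that by (auto simp: P_def field_simps)
    have P0: "P 0 = 1" by (simp add: P_def)
    have h0: "h 0 = g 0" using gP[of 0] P0 by simp
    have Pev: "P (- z) = P z" for z
      unfolding P_def
      by (rule prod.reindex_bij_witness[of _ uminus uminus]) (auto simp: S_def even)
    have hev: "h (- z) = h z" if "z \<notin> S" for z
      using gP[of z] gP[of "- z"] Pn0[OF that] by (simp add: even Pev)
    have h'0: "deriv h 0 = 0"
    proof -
      have D: "(h has_field_derivative deriv h 0) (at 0)" using h(1) by (auto intro!: holomorphic_derivI)
      have Dx: "((\<lambda>z. h (- z)) has_field_derivative deriv h 0 * (- 1)) (at 0)"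
        by (rule DERIV_chain2[of h]) (use D in \<open>auto intro!: derivative_eq_intros\<close>)
      have "eventually (\<lambda>z. z \<in> - S) (nhds 0)"
        using fin S0 by (intro eventually_nhds_in_open) (auto intro: finite_imp_closed)
      then have ev: "eventually (\<lambda>z. h (- z) = h z) (nhds 0)" by eventually_elim (use hev in auto)
      have "(h has_field_derivative deriv h 0 * (- 1)) (at 0)"
        by (rule iffD1[OF has_field_derivative_cong_eventually Dx]) (use ev in \<open>auto simp: eventually_at_filter elim: eventually_mono\<close>)
      from DERIV_unique[OF D this] show ?thesis by simp
    qed
    (* on the circle of radius 3 R every factor of P has modulus at least 1 *)
    have hbound: "norm (h z) \<le> A * exp (B * (3 * R + c) powr (3 / 2))" if "z \<in> ball 0 (3 * R)" for z
    proof (rule maximum_modulus_frontier[of h "ball 0 (3 * R)"])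
      fix w :: complex assume "w \<in> frontier (ball 0 (3 * R))"
      then have w: "norm w = 3 * R" using R x by simp
      have "norm (P w) \<ge> 1"
        unfolding P_def prod_norm[symmetric]
      proof (rule prod_ge_1)
        fix a assume a: "a \<in> S"
        then have "norm a > 0" "norm a \<le> R" using S0 by (auto simp: S_def)
        then have "norm (w / a) \<ge> 2" using w R by (simp add: norm_divide field_simps)
        then show "1 \<le> norm (1 - w / a)" using norm_triangle_ineq3[of 1 "w / a"] by simp
      qed
      then have "norm (h w) * 1 \<le> norm (h w) * norm (P w)" by (intro mult_left_mono) auto
      also have "\<dots> = norm (g w)" by (simp add: gP norm_mult)
      also have "\<dots> \<le> A * exp (B * (3 * R + c) powr (3 / 2))" using growth[of w] w by simp
      finally show "norm (h w) \<le> A * exp (B * (3 * R + c) powr (3 / 2))" by simp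
    qed (use that h(1) in \<open>auto intro: holomorphic_on_subset holomorphic_on_imp_continuous_on\<close>)
    obtain k where k: "k holomorphic_on ball 0 R" "\<And>z. z \<in> ball 0 R \<Longrightarrow> h z = exp (k z)"
    proof (rule holomorphic_logarithm_exists[of "ball 0 R" h 0])
      show "h holomorphic_on ball 0 R" using h(1) by (rule holomorphic_on_subset) auto
      show "h x \<noteq> 0" if "x \<in> ball 0 R" for x using hnz[of x] that by simp
      show "(0::complex) \<in> ball 0 R" using R by simp
      show thesis if "g holomorphic_on ball 0 R" "\<And>x. x \<in> ball 0 R \<Longrightarrow> exp (g x) = h x" for g
        using that \<open>\<And>k. \<lbrakk>k holomorphic_on ball 0 R; \<And>z. z \<in> ball 0 R \<Longrightarrow> h z = exp (k z)\<rbrakk> \<Longrightarrow> thesis\<close> by metis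
    qed auto
    define L where "L = (\<lambda>z. k z - k 0)"
    have R0: "R > 0" using R by simp
    have Lhol: "L holomorphic_on ball 0 R" unfolding L_def by (intro holomorphic_intros k)
    have hL: "h z = g 0 * exp (L z)" if "norm z < R" for z
      using k(2)[of z] k(2)[of 0] that R0 h0 by (simp add: L_def exp_diff)
    have L'0: "deriv L 0 = 0"
    proof -
      have LD: "(L has_field_derivative deriv L 0) (at 0)"
        using holomorphic_derivI[OF Lhol] R0 by simp
      have "((\<lambda>z. g 0 * exp (L z)) has_field_derivative g 0 * (exp (L 0) * deriv L 0)) (at 0)"
        by (intro DERIV_cmult DERIV_chain2[OF DERIV_exp] LD)
      then have "(h has_field_derivative g 0 * (exp (L 0) * deriv L 0)) (at 0)"
        by (rule has_field_derivative_transform_within_open[of _ _ _ "ball 0 R"]) (use R0 hL in auto)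
      then have "deriv h 0 = g 0 * (exp (L 0) * deriv L 0)" by (rule DERIV_imp_deriv)
      with h'0 g0 show ?thesis by simp
    qed
    let ?A = "K * R powr (3 / 2)"
    have K: "K \<ge> 1" using A by (simp add: K_def)
    have Rp: "R powr (3 / 2) \<ge> 1" using R by (intro ge_one_powr_ge_zero) auto
    have ReL: "Re (L z) < ?A" if "norm z < R" for z
    proof -
      have "norm (h z) = norm (g 0) * exp (Re (L z))" using hL[OF that] by (simp add: norm_mult)
      then have "norm (g 0) * exp (Re (L z)) \<le> A * exp (B * (3 * R + c) powr (3 / 2))"
        using hbound[of z] that R0 by simp
      then have "ln (norm (g 0) * exp (Re (L z))) \<le> ln (A * exp (B * (3 * R + c) powr (3 / 2)))"
        using g0 by (subst ln_le_cancel_iff) (use A in auto)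
      then have "Re (L z) \<le> ln A + B * (3 * R + c) powr (3 / 2) - ln (norm (g 0))"
        using g0 A by (simp add: ln_mult)
      also have "(3 * R + c) powr (3 / 2) \<le> (4 * R) powr (3 / 2)" using R A by (intro powr_mono2) auto
      also have "(4 * R) powr (3 / 2) = 8 * R powr (3 / 2)"
      proof -
        have "(4::real) powr (3 / 2) = (2 powr 2) powr (3 / 2)" by simp
        also have "\<dots> = 2 powr 3" by (simp only: powr_powr) simp
        finally show ?thesis using R0 by (simp add: powr_mult)
      qed
      finally have "Re (L z) \<le> \<bar>ln A\<bar> * 1 + \<bar>ln (norm (g 0))\<bar> * 1 + 8 * B * R powr (3 / 2)"
        using A by (simp add: mult_left_mono)
      also have "\<dots> < ?A"
      proof -
        have m: "a \<le> a * R powr (3 / 2)" if "a \<ge> 0" for a using mult_left_mono[OF Rp that] by simp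
        show ?thesis using m[of "\<bar>ln A\<bar>"] m[of "\<bar>ln (norm (g 0))\<bar>"] Rp unfolding K_def by (simp add: distrib_right)
      qed
      finally show ?thesis .
    qed
    have Lx: "norm (L (of_real x)) \<le> 4 * ?A * norm (complex_of_real x) ^ 2 / R ^ 2"
      by (rule Borel_Caratheodory_second_order[OF Lhol R0 _ L'0 _ ReL]) (use R x K Rp in \<open>auto simp: L_def\<close>)
    also have "\<dots> = 4 * K * x\<^sup>2 * R powr (- 1 / 2)"
    proof -
      have "R powr (- 1 / 2) = R powr (3 / 2 - 2)" by simp
      also have "\<dots> = R powr (3 / 2) / R powr 2" by (rule powr_diff)
      finally show ?thesis using R0 x by simp
    qed
    finally have Lx: "norm (L (of_real x)) \<le> 4 * K * x\<^sup>2 * R powr (- 1 / 2)" .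
    (* pairing x with -x replaces the factors by 1 - x^2 / a^2 *)
    have Pxx: "norm (P (of_real x)) ^ 2 \<le> M"
    proof -
      have "norm (P (of_real x)) ^ 2 = norm (P (of_real x) * P (- of_real x))"
        by (simp add: Pev norm_mult power2_eq_square)
      also have "\<dots> = (\<Prod>a\<in>S. norm (1 - (of_real x)\<^sup>2 / a\<^sup>2))"
        unfolding P_def prod.distrib[symmetric] prod_norm[symmetric]
        by (intro prod.cong refl) (simp add: algebra_simps power2_eq_square)
      also have "\<dots> \<le> (\<Prod>a\<in>S. 1 + x\<^sup>2 / (norm a)\<^sup>2)"
      proof (rule prod_mono, safe)
        fix a
        have "norm (1 - (complex_of_real x)\<^sup>2 / a\<^sup>2) \<le> norm (1::complex) + norm ((complex_of_real x)\<^sup>2 / a\<^sup>2)" by (rule norm_triangle_ineq4)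
        then show "norm (1 - (complex_of_real x)\<^sup>2 / a\<^sup>2) \<le> 1 + x\<^sup>2 / (norm a)\<^sup>2"
          by (simp add: norm_divide norm_power)
      qed auto
      also have "\<dots> \<le> M" by (rule M[OF fin]) (simp add: S_def)
      finally show ?thesis .
    qed
    have "norm (g (of_real x)) ^ 2 = norm (h (of_real x)) ^ 2 * norm (P (of_real x)) ^ 2"
      by (simp add: gP norm_mult power_mult_distrib)
    also have "\<dots> \<le> (norm (g 0) ^ 2 * exp (8 * K * x\<^sup>2 * R powr (- 1 / 2))) * M"
    proof (intro mult_mono Pxx)
      have "norm (h (of_real x)) = norm (g 0) * exp (Re (L (of_real x)))"
        using hL[of "of_real x"] R x by (simp add: norm_mult)
      also have "\<dots> \<le> norm (g 0) * exp (4 * K * x\<^sup>2 * R powr (- 1 / 2))"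
        using Lx complex_Re_le_cmod[of "L (of_real x)"] by (intro mult_left_mono) auto
      finally have "norm (h (of_real x)) ^ 2 \<le> (norm (g 0) * exp (4 * K * x\<^sup>2 * R powr (- 1 / 2))) ^ 2"
        by (intro power_mono) auto
      also have "\<dots> = norm (g 0) ^ 2 * exp (8 * K * x\<^sup>2 * R powr (- 1 / 2))"
        by (simp add: power_mult_distrib flip: exp_of_nat_mult)
      finally show "norm (h (of_real x)) ^ 2 \<le> norm (g 0) ^ 2 * exp (8 * K * x\<^sup>2 * R powr (- 1 / 2))" .
    qed auto
    finally show ?thesis .
  qed
  have "((\<lambda>R. norm (g 0) ^ 2 * exp (8 * K * x\<^sup>2 * R powr (- 1 / 2)) * M) \<longlongrightarrow> norm (g 0) ^ 2 * exp (8 * K * x\<^sup>2 * 0) * M) at_top"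
    by (intro tendsto_intros tendsto_neg_powr filterlim_ident) auto
  moreover have "eventually (\<lambda>R. norm (g (of_real x)) ^ 2 \<le> norm (g 0) ^ 2 * exp (8 * K * x\<^sup>2 * R powr (- 1 / 2)) * M) at_top"
    using eventually_gt_at_top[of "2 * x"] eventually_ge_at_top[of 1] eventually_ge_at_top[of c]
    by eventually_elim (rule bound)
  ultimately have "norm (g (of_real x)) ^ 2 \<le> norm (g 0) ^ 2 * exp (8 * K * x\<^sup>2 * 0) * M"
    by (rule tendsto_lowerbound) simp
  then show ?thesis by simp
qed

text \<open>This is a partial product of \<open>sinh (\<pi> x) / (\<pi> x)\<close>: zeros in an arithmetic progression cost no
more than exponential growth.\<close>

lemma prod_one_plus_square_le_exp:
  assumes "x \<ge> (1::real)"
  shows "(\<Prod>k<n. 1 + x\<^sup>2 / (real (Suc k))\<^sup>2) \<le> exp (pi * x)"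
proof -
  let ?p = "\<lambda>n. pi * x * (\<Prod>k=1..n. 1 + x\<^sup>2 / (real k)\<^sup>2)"
  have "(\<lambda>n. of_real pi * (\<i> * of_real x) * (\<Prod>k=1..n. 1 - (\<i> * of_real x)^2 / of_nat k^2)) \<longlonglongrightarrow> sin (of_real pi * (\<i> * of_real x))"
    by (rule sin_product_formula_complex)
  moreover have "of_real pi * (\<i> * of_real x) * (\<Prod>k=1..n. 1 - (\<i> * of_real x)^2 / of_nat k^2) = \<i> * of_real (?p n)" for n
    by (simp add: power_mult_distrib)
  moreover have "sin (of_real pi * (\<i> * of_real x)) = \<i> * of_real ((exp (pi * x) - exp (- (pi * x))) / 2)"
    by (simp add: sin_exp_eq exp_of_real[symmetric] field_simps)
  ultimately have "(\<lambda>n. \<i> * complex_of_real (?p n)) \<longlonglongrightarrow> \<i> * of_real ((exp (pi * x) - exp (- (pi * x))) / 2)" by (simp only:)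
  from tendsto_Im[OF this] have "(\<lambda>n. Im (\<i> * complex_of_real (?p n))) \<longlonglongrightarrow> Im (\<i> * of_real ((exp (pi * x) - exp (- (pi * x))) / 2))" .
  moreover have "Im (\<i> * complex_of_real r) = r" for r by simp
  ultimately have lim: "?p \<longlonglongrightarrow> (exp (pi * x) - exp (- (pi * x))) / 2" by (simp only:)
  have nn: "(\<Prod>k=1..n. 1 + x\<^sup>2 / (real k)\<^sup>2) \<ge> 0" for n by (intro prod_nonneg) auto
  have "incseq ?p"
  proof (rule incseq_SucI)
    fix n
    have "(\<Prod>k=1..n. 1 + x\<^sup>2 / (real k)\<^sup>2) * 1 \<le> (\<Prod>k=1..n. 1 + x\<^sup>2 / (real k)\<^sup>2) * (1 + x\<^sup>2 / (real (Suc n))\<^sup>2)"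
      by (intro mult_left_mono nn) auto
    then show "?p n \<le> ?p (Suc n)" using assms by (simp add: mult_left_mono)
  qed
  from incseq_le[OF this lim] have "?p n \<le> (exp (pi * x) - exp (- (pi * x))) / 2" .
  also have "\<dots> \<le> exp (pi * x)"
  proof -
    have gen: "(a - b) / 2 \<le> a" if "a > 0" "b > 0" for a b :: real using that by simp
    show ?thesis by (rule gen) auto
  qed
  finally have "?p n \<le> exp (pi * x)" .
  moreover have "1 * (\<Prod>k=1..n. 1 + x\<^sup>2 / (real k)\<^sup>2) \<le> pi * x * (\<Prod>k=1..n. 1 + x\<^sup>2 / (real k)\<^sup>2)"
  proof (intro mult_right_mono nn)
    have "1 * 1 \<le> pi * x" using assms pi_gt3 by (intro mult_mono) auto
    then show "1 \<le> pi * x" by simp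
  qed
  moreover have "(\<Prod>k<n. 1 + x\<^sup>2 / (real (Suc k))\<^sup>2) = (\<Prod>k=1..n. 1 + x\<^sup>2 / (real k)\<^sup>2)"
    by (rule prod.reindex_bij_witness[of _ "\<lambda>k. k - 1" Suc]) auto
  ultimately show ?thesis by linarith
qed

text \<open>Zeros lying in \<open>card F\<close> progressions, indexed by \<open>\<phi>\<close>, contribute at most the product of the bounds
for the single progressions.\<close>

lemma prod_indexed_zeros_bound:
  fixes \<phi> :: "complex \<Rightarrow> nat \<times> 'b"
  assumes "finite S" "inj_on \<phi> S" "finite F" "\<And>a. a \<in> S \<Longrightarrow> snd (\<phi> a) \<in> F"
    and "\<And>a. a \<in> S \<Longrightarrow> norm a \<ge> real (Suc (fst (\<phi> a)))" and x: "x \<ge> 1"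
  shows "(\<Prod>a\<in>S. 1 + x\<^sup>2 / (norm a)\<^sup>2) \<le> exp (pi * x) ^ card F"
proof -
  obtain n where n: "\<And>a. a \<in> S \<Longrightarrow> fst (\<phi> a) < n"
    using finite_nat_set_iff_bounded[of "(fst \<circ> \<phi>) ` S"] \<open>finite S\<close> by auto
  have "(\<Prod>a\<in>S. 1 + x\<^sup>2 / (norm a)\<^sup>2) \<le> (\<Prod>a\<in>S. 1 + x\<^sup>2 / (real (Suc (fst (\<phi> a))))\<^sup>2)"
    using assms(5) by (intro prod_mono conjI add_left_mono divide_left_mono power_mono mult_pos_pos) (auto intro!: add_nonneg_nonneg, force+)
  also have "\<dots> = (\<Prod>p\<in>\<phi> ` S. 1 + x\<^sup>2 / (real (Suc (fst p)))\<^sup>2)"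
    using assms(2) by (simp add: prod.reindex)
  also have "\<dots> \<le> (\<Prod>p\<in>{..<n} \<times> F. 1 + x\<^sup>2 / (real (Suc (fst p)))\<^sup>2)"
  proof (rule prod_mono2)
    show "\<phi> ` S \<subseteq> {..<n} \<times> F"
    proof
      fix p assume "p \<in> \<phi> ` S"
      then obtain a where "a \<in> S" "p = \<phi> a" by blast
      then show "p \<in> {..<n} \<times> F" using n assms(4) by (simp add: mem_Times_iff)
    qed
  qed (use assms(3) in auto)
  also have "\<dots> = (\<Prod>k<n. \<Prod>f\<in>F. 1 + x\<^sup>2 / (real (Suc k))\<^sup>2)"
    by (subst prod.cartesian_product) (simp add: case_prod_beta)
  also have "\<dots> = (\<Prod>k<n. 1 + x\<^sup>2 / (real (Suc k))\<^sup>2) ^ card F"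
    by (simp add: prod_power_distrib)
  also have "\<dots> \<le> exp (pi * x) ^ card F"
    by (intro power_mono prod_one_plus_square_le_exp x prod_nonneg) auto
  finally show ?thesis .
qed

section \<open>The Dirichlet series of the singular series\<close>

lemma of_nat_powr_mult: "of_nat (m * n) powr s = of_nat m powr s * (of_nat n powr s :: complex)"
  using powr_times_real[of "of_nat m" "of_nat n" s] by simp

lemma of_nat_power_powr: "n > 0 \<Longrightarrow> of_nat (n ^ j) powr s = (of_nat n powr s :: complex) ^ j"
  by (induction j) (simp_all add: of_nat_powr_mult del: of_nat_mult of_nat_power)

lemma norm_prime_powr_less_1:
  assumes "prime p" "Re s < 0"
  shows "norm (of_nat p powr s :: complex) < 1"
proof -
  have "real p > 1" using prime_gt_1_nat[OF assms(1)] by simp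
  then have "real p powr Re s < real p powr 0" using assms(2) by (intro powr_less_mono) auto
  then show ?thesis using prime_gt_0_nat[OF assms(1)] by (simp add: norm_of_nat_powr)
qed

text \<open>Both zeta and the singular series have coefficients that are constant on the powers of a prime
with positive exponent.\<close>

lemma local_factor_geometric:
  assumes "prime p" "f 1 = 1" "\<And>j. f (p ^ Suc j) = c * u ^ Suc j" "norm u < 1"
  shows "local_factor f p = 1 + c * u / (1 - u)"
proof -
  define g where "g = (\<lambda>j. f (p ^ j))"
  have gS: "g (Suc j) = c * u * u ^ j" for j using assms(3)[of j] by (simp add: g_def mult.assoc)
  have "(\<lambda>j. g (Suc j)) sums (c * u * (1 / (1 - u)))"
    unfolding gS by (intro sums_mult geometric_sums assms(4))
  then have s: "g sums (c * u * (1 / (1 - u)) + g 0)" by (rule sums_Suc)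
  have "summable (\<lambda>j. norm (g (Suc j)))"
    unfolding gS norm_mult norm_power by (intro summable_mult summable_geometric) (use assms(4) in simp)
  then have "summable (\<lambda>j. norm (g j))" using summable_Suc_iff[of "\<lambda>j. norm (g j)"] by simp
  from infsumI[OF norm_summable_imp_has_sum[OF this s]]
  have "infsum g UNIV = c * u * (1 / (1 - u)) + g 0" .
  then show ?thesis using assms(1,2) by (simp add: local_factor_def g_def)
qed

lemma local_factor_powr:
  assumes "prime p" "Re s > 0"
  shows "local_factor (\<lambda>n. of_nat n powr (- s)) p = 1 / (1 - of_nat p powr (- s))"
proof -
  have lt: "norm (of_nat p powr (- s) :: complex) < 1"
    using assms by (intro norm_prime_powr_less_1) auto
  have "local_factor (\<lambda>n. of_nat n powr (- s)) p = 1 + 1 * of_nat p powr (- s) / (1 - of_nat p powr (- s))"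
    using prime_gt_0_nat[OF assms(1)]
    by (intro local_factor_geometric assms(1) lt) (simp_all add: of_nat_power_powr del: power_Suc of_nat_power)
  moreover have "1 - of_nat p powr (- s) \<noteq> (0::complex)" using lt by auto
  ultimately show ?thesis by (simp add: field_simps)
qed

text \<open>The reciprocal of the Euler factor of \<open>\<zeta>(s)\<close>.\<close>

definition prime_factor_powr :: "complex \<Rightarrow> nat \<Rightarrow> complex" where
  "prime_factor_powr s p = (if prime p then 1 - of_nat p powr (- s) else 1)"

lemma zeta_Euler_product:
  assumes "Re s > 1"
  shows "(\<lambda>N. \<Prod>p<N. inverse (prime_factor_powr s p)) \<longlonglongrightarrow> zeta1 s / (s - 1)"
proof -
  have "(\<lambda>N. \<Prod>p<N. local_factor (\<lambda>n. of_nat n powr (- s)) p) \<longlonglongrightarrow> (\<Sum>n. of_nat (Suc n) powr (- s))"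
  proof (rule Euler_product)
    show "summable (\<lambda>n. norm (of_nat (Suc n) powr (- s) :: complex))"
      by (rule summable_Dirichlet[OF assms])
  qed (simp_all add: of_nat_powr_mult del: of_nat_mult)
  moreover have "local_factor (\<lambda>n. of_nat n powr (- s)) p = inverse (prime_factor_powr s p)" for p
    using local_factor_powr[of p s] assms
    by (cases "prime p") (simp_all add: prime_factor_powr_def local_factor_def inverse_eq_divide)
  moreover have "s - 1 \<noteq> 0" using assms by auto
  ultimately show ?thesis using zeta1_Dirichlet[OF assms] by simp
qed

text \<open>Inside the region of absolute convergence the partial products of \<open>1/\<zeta>\<close> converge as well, and
a limit \<open>0\<close> of one product would contradict that the two multiply to \<open>1\<close>.\<close>

lemma zeta1_nonzero:
  assumes "Re s > 1"
  shows "zeta1 s \<noteq> 0"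
proof
  assume z: "zeta1 s = 0"
  have "summable (\<lambda>n. norm (prime_factor_powr s (Suc n) - 1))"
  proof (rule summable_comparison_test'[OF summable_Dirichlet[OF assms], of 0])
    fix n show "norm (norm (prime_factor_powr s (Suc n) - 1)) \<le> norm (of_nat (Suc n) powr (- s) :: complex)"
      by (simp add: prime_factor_powr_def)
  qed
  then have "summable (\<lambda>n. norm (prime_factor_powr s n - 1))"
    using summable_Suc_iff[of "\<lambda>n. norm (prime_factor_powr s n - 1)"] by simp
  then have "convergent_prod (prime_factor_powr s)"
    by (intro abs_convergent_prod_imp_convergent_prod summable_imp_abs_convergent_prod)
  from convergent_prod_LIMSEQ[OF this]
  have "(\<lambda>N. \<Prod>p<N. prime_factor_powr s p) \<longlonglongrightarrow> prodinf (prime_factor_powr s)"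
    using LIMSEQ_imp_Suc[of "\<lambda>N. \<Prod>p<N. prime_factor_powr s p"] by (simp add: lessThan_Suc_atMost)
  from tendsto_mult[OF this zeta_Euler_product[OF assms]] z
  have "(\<lambda>N. (\<Prod>p<N. prime_factor_powr s p) * (\<Prod>p<N. inverse (prime_factor_powr s p))) \<longlonglongrightarrow> 0" by simp
  moreover have "(\<Prod>p<N. prime_factor_powr s p) * (\<Prod>p<N. inverse (prime_factor_powr s p)) = 1" for N
  proof -
    have "prime_factor_powr s p \<noteq> 0" for p
      using norm_prime_powr_less_1[of p "- s"] assms by (auto simp: prime_factor_powr_def)
    then have "prime_factor_powr s p * inverse (prime_factor_powr s p) = 1" for p by simp
    then show ?thesis by (simp flip: prod.distrib)
  qed
  ultimately have "(\<lambda>N::nat. 1::complex) \<longlonglongrightarrow> 0" by simp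
  then show False using LIMSEQ_unique tendsto_const by fastforce
qed

text \<open>The multiplicative part of the singular series: \<open>\<SS>(2n)\<close> equals \<open>2 C\<^sub>2\<close> times this weight.\<close>

definition sing_weight :: "nat \<Rightarrow> real" where
  "sing_weight n = (\<Prod>p | prime p \<and> p dvd n \<and> p > 2. (real p - 1) / (real p - 2))"

lemma finite_odd_prime_divisors: "n > 0 \<Longrightarrow> finite {p. prime p \<and> p dvd n \<and> p > (2::nat)}"
  by (rule finite_subset[of _ "{..n}"]) (auto dest: dvd_imp_le)

lemma sing_weight_1: "sing_weight 1 = 1"
proof -
  have "{p. prime p \<and> p dvd 1 \<and> p > (2::nat)} = {}" by auto
  then show ?thesis unfolding sing_weight_def by (simp only: prod.empty)
qed

lemma sing_weight_mult:
  assumes "coprime m n"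
  shows "sing_weight (m * n) = sing_weight m * sing_weight n"
proof (cases "m = 0 \<or> n = 0")
  case True
  then have "m = 1 \<or> n = 1" using assms by auto
  then show ?thesis using sing_weight_1 by auto
next
  case False
  have "{p. prime p \<and> p dvd m * n \<and> p > 2} = {p. prime p \<and> p dvd m \<and> p > 2} \<union> {p. prime p \<and> p dvd n \<and> p > 2}"
    by (auto simp: prime_dvd_mult_iff)
  moreover have "{p. prime p \<and> p dvd m \<and> p > 2} \<inter> {p. prime p \<and> p dvd n \<and> p > 2} = {}"
    using assms by (auto dest: coprime_common_divisor_nat not_prime_unit)
  ultimately show ?thesis unfolding sing_weight_def
    using False by (simp add: prod.union_disjoint finite_odd_prime_divisors)
qed

lemma prod_distinct_primes_dvd:
  fixes n :: nat
  assumes "finite A" "\<And>p. p \<in> A \<Longrightarrow> prime p" "\<And>p. p \<in> A \<Longrightarrow> p dvd n"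
  shows "\<Prod>A dvd n"
  using assms
proof (induction A rule: finite_induct)
  case (insert p A)
  have "coprime p (\<Prod>A)"
  proof (rule prod_coprime_right)
    fix q assume "q \<in> A"
    then show "coprime p q" using insert by (intro primes_coprime) auto
  qed
  then have "p * \<Prod>A dvd n" using insert by (intro divides_mult) auto
  then show ?case using insert by simp
qed simp

text \<open>Every factor is at most \<open>p\<close>, and the product of the distinct primes dividing \<open>n\<close> divides \<open>n\<close>.
This gives absolute convergence of the Dirichlet series for \<open>Re s > 2\<close>.\<close>

lemma sing_weight_bounds:
  assumes "n > 0"
  shows "0 \<le> sing_weight n" "sing_weight n \<le> real n"
proof -
  let ?A = "{p. prime p \<and> p dvd n \<and> p > 2}"
  have f: "0 \<le> (real p - 1) / (real p - 2)" "(real p - 1) / (real p - 2) \<le> real p" if "p > 2" for p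
  proof -
    have "real p \<ge> 3" using that by simp
    then show "0 \<le> (real p - 1) / (real p - 2)" by simp
    have "real p * 1 \<le> real p * (real p - 2)" using \<open>real p \<ge> 3\<close> by (intro mult_left_mono) auto
    then have "real p - 1 \<le> real p * (real p - 2)" by linarith
    then show "(real p - 1) / (real p - 2) \<le> real p" using \<open>real p \<ge> 3\<close> by (simp add: divide_le_eq)
  qed
  show "0 \<le> sing_weight n" unfolding sing_weight_def using f by (intro prod_nonneg) auto
  have "sing_weight n \<le> (\<Prod>p\<in>?A. real p)" unfolding sing_weight_def using f by (intro prod_mono) auto
  also have "\<dots> = real (\<Prod>?A)" by simp
  also have "\<Prod>?A dvd n"
    by (rule prod_distinct_primes_dvd[OF finite_odd_prime_divisors[OF assms]]) auto
  then have "\<Prod>?A \<le> n" using assms by (intro dvd_imp_le)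
  then have "real (\<Prod>?A) \<le> real n" by (simp only: of_nat_le_iff)
  finally show "sing_weight n \<le> real n" .
qed

lemma sing_weight_prime_power:
  assumes "prime p"
  shows "sing_weight (p ^ Suc j) = (if p > 2 then (real p - 1) / (real p - 2) else 1)"
proof -
  have "{q. prime q \<and> q dvd p ^ Suc j \<and> q > 2} = (if p > 2 then {p} else {})"
    using assms by (auto dest!: prime_dvd_power_nat[rotated] dest: primes_dvd_imp_eq simp del: power_Suc)
  then show ?thesis by (simp add: sing_weight_def)
qed

lemma singular_series_double: "singular_series (2 * n) = 2 * twin_prime_const * sing_weight n"
proof -
  have "{p. prime p \<and> p dvd 2 * n \<and> p > (2::nat)} = {p. prime p \<and> p dvd n \<and> p > 2}"
    by (auto simp: prime_dvd_mult_iff dest: primes_dvd_imp_eq[OF _ two_is_prime_nat])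
  then show ?thesis by (simp add: singular_series_def sing_weight_def)
qed

lemma summable_sing_weight:
  assumes "Re s > 2"
  shows "summable (\<lambda>n. norm (of_real (sing_weight (Suc n)) * of_nat (Suc n) powr (- s) :: complex))"
proof (rule summable_comparison_test'[OF summable_powr_Suc[of "Re s - 1"], of 0])
  fix n
  have "norm (of_real (sing_weight (Suc n)) * of_nat (Suc n) powr (- s) :: complex) = sing_weight (Suc n) * real (Suc n) powr (- Re s)"
    using sing_weight_bounds[of "Suc n"] by (simp add: norm_mult norm_of_nat_powr del: of_nat_Suc)
  also have "\<dots> \<le> real (Suc n) * real (Suc n) powr (- Re s)"
    using sing_weight_bounds[of "Suc n"] by (intro mult_right_mono) auto
  also have "\<dots> = real (Suc n) powr (- (Re s - 1))"
    by (subst powr_mult_base) auto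
  finally show "norm (norm (of_real (sing_weight (Suc n)) * of_nat (Suc n) powr (- s) :: complex)) \<le> real (Suc n) powr (- (Re s - 1))" by simp
qed (use assms in auto)

lemma singular_series_Dirichlet:
  assumes "Re s > 2"
  shows "summable (\<lambda>k. norm (of_real (singular_series (Suc k)) * of_nat (Suc k) powr (- s) :: complex))"
    and "(\<Sum>k. of_real (singular_series (Suc k)) * of_nat (Suc k) powr (- s))
      = of_real (2 * twin_prime_const) * 2 powr (- s) * (\<Sum>n. of_real (sing_weight (Suc n)) * of_nat (Suc n) powr (- s) :: complex)"
proof -
  let ?f = "\<lambda>k. of_real (singular_series (Suc k)) * of_nat (Suc k) powr (- s) :: complex"
  let ?g = "\<lambda>n::nat. 2 * n + 1"
  have mono: "strict_mono ?g" by (auto simp: strict_mono_def)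
  have zero: "?f k = 0" if "k \<notin> range ?g" for k
  proof -
    have "even k"
    proof (rule ccontr)
      assume "odd k"
      then obtain n where "k = 2 * n + 1" by (rule oddE)
      with that show False by blast
    qed
    then have "odd (Suc k)" by simp
    then show ?thesis by (simp add: singular_series_def)
  qed
  have fg: "?f (?g n) = of_real (2 * twin_prime_const) * 2 powr (- s) * (of_real (sing_weight (Suc n)) * of_nat (Suc n) powr (- s))" for n
  proof -
    have "Suc (?g n) = 2 * Suc n" by simp
    then have "?f (?g n) = of_real (singular_series (2 * Suc n)) * of_nat (2 * Suc n) powr (- s)" by (simp only:)
    also have "\<dots> = of_real (2 * twin_prime_const * sing_weight (Suc n)) * (2 powr (- s) * of_nat (Suc n) powr (- s))"
      by (simp only: singular_series_double of_nat_powr_mult of_nat_numeral)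
    finally show ?thesis by (simp only: of_real_mult mult_ac)
  qed
  have sm: "summable (\<lambda>n. norm (?f (?g n)))"
    unfolding fg norm_mult[of "_ * _" "_ * _"] by (intro summable_mult summable_sing_weight assms)
  show "summable (\<lambda>k. norm (?f k))"
    using sm summable_mono_reindex[OF mono, of "\<lambda>k. norm (?f k)"] zero by simp
  have "(\<Sum>k. ?f k) = (\<Sum>n. ?f (?g n))"
    by (rule suminf_mono_reindex[OF mono, symmetric]) (use zero in auto)
  also have "\<dots> = of_real (2 * twin_prime_const) * 2 powr (- s) * (\<Sum>n. of_real (sing_weight (Suc n)) * of_nat (Suc n) powr (- s))"
    unfolding fg by (rule suminf_mult[OF summable_norm_cancel[OF summable_sing_weight[OF assms]]])
  finally show "(\<Sum>k. ?f k) = \<dots>" .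
qed

text \<open>Euler factor at \<open>p\<close> of \<open>D(s) / (2 C\<^sub>2 \<zeta>(s) \<zeta>(s+1))\<close>, where \<open>D\<close> is the Dirichlet series of the
singular series. Only even arguments occur in \<open>D\<close>; the resulting factor \<open>2\<^bsup>-s\<^esup>\<close> is put into
the factor at \<open>2\<close>.\<close>

definition sing_factor :: "nat \<Rightarrow> complex \<Rightarrow> complex" where
  "sing_factor p s = (if \<not> prime p then 1 else if p = 2 then 2 powr (- s) * (1 - 2 powr (- s - 1))
     else (1 + of_nat p powr (- s) / (of_nat p - 2)) * (1 - of_nat p powr (- s - 1)))"

text \<open>With \<open>v = p\<^bsup>-s-1\<^esup>\<close> the factor for an odd prime is \<open>(1 + a v) (1 - v)\<close> with
\<open>a = p / (p - 2)\<close> close to \<open>1\<close>; dividing by \<open>(1 - v) (1 + v)\<close>, the reciprocal Euler factor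
of \<open>\<zeta>(2s+2)\<close>, leaves \<open>1 + O(v/p)\<close>. At \<open>2\<close> and \<open>5\<close> the numerator is replaced by \<open>1\<close>: for
\<open>p = 2\<close> it has a different shape and for \<open>p = 5\<close> it has zeros in the strip of interest, so both
are kept separate.\<close>

definition sing_factor' :: "nat \<Rightarrow> complex \<Rightarrow> complex" where
  "sing_factor' p s = (if \<not> prime p then 1 else
     (1 + (if p = 2 \<or> p = 5 then 0 else of_nat p / (of_nat p - 2)) * of_nat p powr (- s - 1)) / (1 + of_nat p powr (- s - 1)))"

lemma prime_odd_ge_3: "prime p \<Longrightarrow> p \<noteq> 2 \<Longrightarrow> real p \<ge> 3"
  using prime_ge_2_nat[of p] by simp

lemma powr_minus_one: "p > 0 \<Longrightarrow> of_nat p powr (s - 1) = of_nat p powr s / (of_nat p :: complex)"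
  by (simp add: powr_diff)

lemma open_Re_gt_ball:
  assumes "a < Re x"
  obtains d \<sigma> where "d > 0" "a < \<sigma>" "\<sigma> < Re x" "\<And>y. y \<in> ball x d \<Longrightarrow> \<sigma> < Re y"
proof
  show "(Re x - a) / 2 > 0" "a < (Re x + a) / 2" "(Re x + a) / 2 < Re x" using assms by auto
  fix y assume "y \<in> ball x ((Re x - a) / 2)"
  then have "norm (x - y) < (Re x - a) / 2" by (simp add: dist_norm)
  then have "Re (x - y) < (Re x - a) / 2" using complex_Re_le_cmod[of "x - y"] by linarith
  then show "(Re x + a) / 2 < Re y" by (simp add: field_simps)
qed

lemma prime_powr_norm_mono:
  assumes "prime p" "Re s \<le> t"
  shows "norm (of_nat p powr s :: complex) \<le> real p powr t"
  using assms prime_ge_1_nat[of p] prime_gt_0_nat[of p] by (simp add: norm_of_nat_powr powr_mono)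

text \<open>With \<open>u = p\<^bsup>-s\<^esup>\<close> the factor minus one is \<open>(2u - u\<^sup>2) / (p (p - 2))\<close>, which is summable
over \<open>p\<close> precisely for \<open>Re s > -1/2\<close>.\<close>

lemma sing_factor_product:
  obtains L where "L holomorphic_on {s. Re s > -1/2}"
    "\<And>s. Re s > -1/2 \<Longrightarrow> (\<lambda>N. \<Prod>p<N. sing_factor p s) \<longlonglongrightarrow> L s"
    "\<And>s. Re s > -1/2 \<Longrightarrow> (\<lambda>N. deriv (\<lambda>z. \<Prod>p<N. sing_factor p z) s) \<longlonglongrightarrow> deriv L s"
proof (rule holomorphic_product[of "{s. Re s > -1/2}" sing_factor])
  show "open {s. Re s > -1/2}" by (rule open_halfspace_Re_gt)
  show "sing_factor n holomorphic_on {s. Re s > - 1 / 2}" for n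
    unfolding sing_factor_def by (cases "prime n"; cases "n = 2") (auto intro!: holomorphic_intros simp: prime_gt_0_nat)
  fix x assume "x \<in> {s. Re s > -1/2}"
  then obtain d \<sigma>' where d: "d > 0" "-1/2 < \<sigma>'" "\<And>y. y \<in> ball x d \<Longrightarrow> \<sigma>' < Re y"
    using open_Re_gt_ball[of "-1/2" x] by auto
  define \<sigma> where "\<sigma> = min \<sigma>' 0"
  have \<sigma>: "-1/2 < \<sigma>" "\<sigma> \<le> 0" "\<And>y. y \<in> ball x d \<Longrightarrow> \<sigma> < Re y" using d by (force simp: \<sigma>_def)+
  (* 7 is a generous bound for the factor at 2, which obeys no decay estimate *)
  let ?h = "\<lambda>n. (if n = 2 then 7 else 0) + 9 * real n powr (- 2 * \<sigma> - 2)"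
  have "summable (\<lambda>n::nat. (if n = 2 then 7 else 0) :: real)" by (rule summable_finite[of "{2}"]) auto
  moreover have "summable (\<lambda>n::nat. real n powr (- 2 * \<sigma> - 2))" using \<sigma> by (simp add: summable_real_powr_iff)
  ultimately have "summable ?h" by (intro summable_add summable_mult)
  moreover have "norm (sing_factor n y - 1) \<le> ?h n" if y: "y \<in> ball x d" for n y
  proof -
    have ry: "\<sigma> < Re y" by (rule \<sigma>(3)[OF y])
    consider "\<not> prime n" | "n = 2" | "prime n" "n \<noteq> 2" by blast
    then show ?thesis
    proof cases
      case 1 then show ?thesis by (simp add: sing_factor_def)
    next
      case 2
      have "norm (2 powr (- y) :: complex) \<le> 2 powr 1" using prime_powr_norm_mono[of 2 "- y" 1] ry \<sigma> by simp
      moreover have "norm (2 powr (- y - 1) :: complex) \<le> 2 powr 0" using prime_powr_norm_mono[of 2 "- y - 1" 0] ry \<sigma> by simp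
      ultimately have a: "norm (2 powr (- y) :: complex) \<le> 2" "norm (2 powr (- y - 1) :: complex) \<le> 1" by simp_all
      have "norm (1 - 2 powr (- y - 1) :: complex) \<le> 1 + 1"
        using norm_triangle_ineq4[of 1 "2 powr (- y - 1) :: complex"] a(2) by simp
      then have "norm (2 powr (- y) :: complex) * norm (1 - 2 powr (- y - 1) :: complex) \<le> 2 * 2"
        using a by (intro mult_mono) auto
      then have "norm (sing_factor 2 y) \<le> 4" by (simp add: sing_factor_def norm_mult)
      then have "norm (sing_factor 2 y - 1) \<le> 5" using norm_triangle_ineq4[of "sing_factor 2 y" 1] by simp
      then show ?thesis using 2 by (simp add: add_increasing2)
    next
      case 3
      let ?p = "of_nat n :: complex"
      have p3: "real n \<ge> 3" using 3 by (rule prime_odd_ge_3)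
      define u where "u = ?p powr (- y)"
      have v: "?p powr (- y - 1) = u / ?p" using p3 by (simp add: u_def powr_minus_one)
      have nz: "?p \<noteq> 0" "?p - 2 \<noteq> 0" using p3 by (auto simp: complex_eq_iff)
      have "sing_factor n y - 1 = (2 * u - u * u) / (?p * (?p - 2))"
        using 3 nz unfolding sing_factor_def v by (simp add: u_def[symmetric] field_simps)
      also have "norm \<dots> = norm (2 * u - u * u) / (real n * (real n - 2))"
      proof -
        have "norm (?p - 2) = real n - 2" using p3 norm_of_real[of "real n - 2", where 'a = complex] by simp
        then show ?thesis by (simp add: norm_divide norm_mult)
      qed
      also have "\<dots> \<le> (3 * real n powr (- 2 * \<sigma>)) / (real n * (real n / 3))"
      proof (intro frac_le)
        have nu: "norm u \<le> real n powr (- \<sigma>)" unfolding u_def using 3 ry by (intro prime_powr_norm_mono) auto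
        have "norm (2 * u - u * u) \<le> 2 * norm u + norm u * norm u"
          using norm_triangle_ineq4[of "2 * u" "u * u"] by (simp add: norm_mult)
        also have "\<dots> \<le> 2 * real n powr (- \<sigma>) + real n powr (- \<sigma>) * real n powr (- \<sigma>)"
          using nu by (intro add_mono mult_mono) auto
        also have "real n powr (- \<sigma>) * real n powr (- \<sigma>) = real n powr (- 2 * \<sigma>)" by (simp flip: powr_add)
        also have "real n powr (- \<sigma>) \<le> real n powr (- 2 * \<sigma>)" using p3 \<sigma> by (intro powr_mono) auto
        finally show "norm (2 * u - u * u) \<le> 3 * real n powr (- 2 * \<sigma>)" by simp
        show "real n * (real n / 3) \<le> real n * (real n - 2)" using p3 by (intro mult_left_mono) auto
      qed (use p3 in auto)
      also have "\<dots> = 9 * real n powr (- 2 * \<sigma> - 2)"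
        using p3 by (simp add: powr_diff power2_eq_square)
      finally show ?thesis using 3 by simp
    qed
  qed
  moreover have "ball x d \<subseteq> {s. Re s > -1/2}" using \<sigma> by force
  ultimately show "\<exists>d>0. \<exists>h. summable h \<and> ball x d \<subseteq> {s. Re s > -1/2} \<and> (\<forall>n. \<forall>y\<in>ball x d. norm (sing_factor n y - 1) \<le> h n)"
    using d(1) by (intro exI[of _ d] conjI exI[of _ ?h]) auto
next
  fix P assume "P holomorphic_on {s. - 1 / 2 < Re s}"
    "\<And>s. s \<in> {s. - 1 / 2 < Re s} \<Longrightarrow> (\<lambda>N. \<Prod>n<N. sing_factor n s) \<longlonglongrightarrow> P s"
    "\<And>s. s \<in> {s. - 1 / 2 < Re s} \<Longrightarrow> (\<lambda>N. deriv (\<lambda>z. \<Prod>n<N. sing_factor n z) s) \<longlonglongrightarrow> deriv P s"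
  then show thesis by (intro that[of P]) auto
qed

lemma sing_factor'_product:
  obtains K where "K holomorphic_on {s. Re s > -1}"
    "\<And>s. Re s > -1 \<Longrightarrow> (\<lambda>N. \<Prod>p<N. sing_factor' p s) \<longlonglongrightarrow> K s"
    "\<And>s. Re s > -1 \<Longrightarrow> K s = 0 \<longleftrightarrow> (\<exists>p. sing_factor' p s = 0)"
proof (rule holomorphic_product[of "{s. Re s > -1}" sing_factor'])
  have nz: "1 + of_nat n powr (- s - 1) \<noteq> (0::complex)" if "prime n" "Re s > -1" for n s
  proof
    assume "1 + of_nat n powr (- s - 1) = (0::complex)"
    then have "of_nat n powr (- s - 1) = (- 1 :: complex)" by (simp add: eq_neg_iff_add_eq_0 add.commute)
    then have "norm (of_nat n powr (- s - 1) :: complex) = 1" by simp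
    with norm_prime_powr_less_1[of n "- s - 1"] that show False by simp
  qed
  show "open {s. Re s > -1}" by (rule open_halfspace_Re_gt)
  show "sing_factor' n holomorphic_on {s. Re s > - 1}" for n
    unfolding sing_factor'_def using nz[of n] by (cases "prime n") (auto intro!: holomorphic_intros simp: prime_gt_0_nat)
  fix x assume "x \<in> {s. Re s > -1}"
  then obtain d \<sigma> where d: "d > 0" "-1 < \<sigma>" "\<And>y. y \<in> ball x d \<Longrightarrow> \<sigma> < Re y"
    using open_Re_gt_ball[of "-1" x] by auto
  define c where "c = 1 - (2::real) powr (- \<sigma> - 1)"
  have "(2::real) powr (- \<sigma> - 1) < 2 powr 0" using d by (intro powr_less_mono) auto
  then have c: "c > 0" by (simp add: c_def)
  let ?h = "\<lambda>n. 6 / c * real n powr (- \<sigma> - 2)"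
  have "summable (\<lambda>n::nat. real n powr (- \<sigma> - 2))" using d by (simp add: summable_real_powr_iff)
  then have "summable ?h" by (rule summable_mult)
  moreover have "norm (sing_factor' n y - 1) \<le> ?h n" if y: "y \<in> ball x d" for n y
  proof (cases "prime n")
    case False
    then show ?thesis using c by (simp add: sing_factor'_def)
  next
    case True
    have ry: "\<sigma> < Re y" by (rule d(3)[OF y])
    let ?p = "of_nat n :: complex"
    define v where "v = ?p powr (- y - 1)"
    define a where "a = (if n = 2 \<or> n = 5 then 0 else ?p / (?p - 2))"
    have n2: "real n \<ge> 2" using prime_ge_2_nat[OF True] by simp
    have nv: "norm v \<le> real n powr (- \<sigma> - 1)" unfolding v_def using True ry by (intro prime_powr_norm_mono) auto
    also have "\<dots> \<le> 2 powr (- \<sigma> - 1)" using n2 d by (intro powr_mono2') auto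
    finally have "norm (1 + v) \<ge> c" using norm_triangle_ineq2[of 1 "- v"] by (simp add: c_def)
    have na: "norm (a - 1) \<le> 6 / real n"
    proof (cases "n = 2 \<or> n = 5")
      case True then show ?thesis by (auto simp: a_def)
    next
      case False
      have p3: "real n \<ge> 3" using True False by (intro prime_odd_ge_3) auto
      have "a - 1 = 2 / (?p - 2)" using False p3 by (simp add: a_def field_simps complex_eq_iff)
      moreover have "norm (?p - 2) = real n - 2" using p3 norm_of_real[of "real n - 2", where 'a = complex] by simp
      ultimately have "norm (a - 1) = 2 / (real n - 2)" by (simp add: norm_divide)
      also have "\<dots> \<le> 6 / real n" using p3 by (simp add: field_simps)
      finally show ?thesis .
    qed
    have "sing_factor' n y - 1 = (a - 1) * v / (1 + v)"
      using True nz[OF True, of y] ry d unfolding sing_factor'_def a_def[symmetric] v_def[symmetric]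
      by (simp add: field_simps)
    then have "norm (sing_factor' n y - 1) = norm (a - 1) * norm v / norm (1 + v)" by (simp add: norm_mult norm_divide)
    also have "\<dots> \<le> (6 / real n * real n powr (- \<sigma> - 1)) / c"
      using na nv c \<open>norm (1 + v) \<ge> c\<close> by (intro frac_le mult_mono) auto
    also have "\<dots> = 6 / c * (real n powr (- \<sigma> - 1) / real n)" by simp
    also have "real n powr (- \<sigma> - 1) / real n = real n powr (- \<sigma> - 2)"
    proof -
      have "- \<sigma> - 2 = (- \<sigma> - 1) - 1" by simp
      then show ?thesis using n2 by (simp only: powr_diff[of _ _ 1]) simp
    qed
    finally show ?thesis .
  qed
  moreover have "ball x d \<subseteq> {s. Re s > -1}" using d by force
  ultimately show "\<exists>d>0. \<exists>h. summable h \<and> ball x d \<subseteq> {s. Re s > -1} \<and> (\<forall>n. \<forall>y\<in>ball x d. norm (sing_factor' n y - 1) \<le> h n)"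
    using d(1) by (intro exI[of _ d] conjI exI[of _ ?h]) auto
next
  fix P assume "P holomorphic_on {s. - 1 < Re s}"
    "\<And>s. s \<in> {s. - 1 < Re s} \<Longrightarrow> (\<lambda>N. \<Prod>n<N. sing_factor' n s) \<longlonglongrightarrow> P s"
    "\<And>s. s \<in> {s. - 1 < Re s} \<Longrightarrow> P s = 0 \<longleftrightarrow> (\<exists>n. sing_factor' n s = 0)"
  then show thesis by (intro that[of P]) auto
qed

text \<open>A zero forces \<open>p\<^bsup>- Re s\<^esup> = p - 2\<close>. In the given strip the left side lies between \<open>p\<^bsup>1/2\<^esup>\<close>
and \<open>p\<^bsup>3/4\<^esup>\<close>, so \<open>p = 3\<close> is too small for a solution and every \<open>p \<ge> 7\<close> is too large. Only
\<open>p = 5\<close> is possible, and its factor has been split off.\<close>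

lemma sing_factor'_nonzero:
  assumes "-3/4 \<le> Re s" "Re s \<le> -1/2"
  shows "sing_factor' p s \<noteq> 0"
proof
  assume z: "sing_factor' p s = 0"
  have p: "prime p" using z by (auto simp: sing_factor'_def split: if_splits)
  have "1 + of_nat p powr (- s - 1) \<noteq> (0::complex)"
  proof
    assume "1 + of_nat p powr (- s - 1) = (0::complex)"
    then have "norm (of_nat p powr (- s - 1) :: complex) = norm (- 1 :: complex)" by (metis add_eq_0_iff)
    with norm_prime_powr_less_1[OF p, of "- s - 1"] assms show False by simp
  qed
  then have z': "1 + (if p = 2 \<or> p = 5 then 0 else of_nat p / (of_nat p - 2)) * of_nat p powr (- s - 1) = (0::complex)"
    using z p by (simp add: sing_factor'_def)
  then have p25: "p \<noteq> 2" "p \<noteq> 5" by auto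
  have p3: "real p \<ge> 3" by (rule prime_odd_ge_3[OF p p25(1)])
  have nz: "of_nat p \<noteq> (0::complex)" "of_nat p - 2 \<noteq> (0::complex)" using p3 by (auto simp: complex_eq_iff)
  have "of_nat p powr (- s) = - (of_nat p - 2 :: complex)"
  proof -
    have "of_nat p powr (- s - 1) = of_nat p powr (- s) / (of_nat p :: complex)" using p3 by (intro powr_minus_one) simp
    then have "1 + of_nat p powr (- s) / (of_nat p - 2) = (0::complex)" using z' p25 nz by simp
    then show ?thesis using nz by (simp add: field_simps add_eq_0_iff)
  qed
  then have "norm (of_nat p powr (- s) :: complex) = norm (of_real (real p - 2) :: complex)" by (simp only: norm_minus_cancel) simp
  moreover have "norm (of_nat p powr (- s) :: complex) = real p powr (- Re s)" using p3 by (simp add: norm_of_nat_powr)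
  moreover have "norm (complex_of_real (real p - 2)) = real p - 2" using p3 by (subst norm_of_real) simp
  ultimately have e: "real p powr (- Re s) = real p - 2" by linarith
  show False
  proof (cases "p = 3")
    case True
    have "(1::real) = 3 powr 0" by simp
    also have "\<dots> < 3 powr (- Re s)" using assms by (intro powr_less_mono) auto
    finally show False using e True by simp
  next
    case False
    then have "p > 3" "p \<noteq> 4" using p3 p by auto
    then have p7: "p \<ge> 7" using p25 p by (cases "p = 6") auto
    have "real p - 2 \<le> real p powr (3/4)" unfolding e[symmetric] using assms p7 by (intro powr_mono) auto
    then have "(real p - 2) ^ 4 \<le> (real p powr (3/4)) ^ 4" using p7 by (intro power_mono) auto
    also have "\<dots> = real p ^ 3"
    proof -
      have "(real p powr (3/4)) ^ 4 = real p powr (3/4 * real 4)" using p7 by (subst powr_powr[symmetric]) (simp add: powr_realpow)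
      also have "\<dots> = real p powr (real 3)" by simp
      also have "\<dots> = real p ^ 3" using p7 by (subst powr_realpow) auto
      finally show ?thesis .
    qed
    finally have le: "(real p - 2) ^ 4 \<le> real p ^ 3" .
    define q where "q = real p - 7"
    have q: "q \<ge> 0" "real p = q + 7" using p7 by (auto simp: q_def)
    have "(q + 5) ^ 4 - (q + 7) ^ 3 = q ^ 4 + 19 * q ^ 3 + 129 * q ^ 2 + 353 * q + 282"
      by (simp add: power4_eq_xxxx power3_eq_cube power2_eq_square algebra_simps)
    also have "\<dots> > 0" using q by (intro add_nonneg_pos add_nonneg_nonneg) auto
    finally have "(q + 7) ^ 3 < (q + 5) ^ 4" by simp
    moreover have p2: "real p - 2 = q + 5" using q by simp
    have "(q + 5) ^ 4 \<le> (q + 7) ^ 3" using le unfolding p2 unfolding q(2) .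
    ultimately show False by linarith
  qed
qed

text \<open>The identity of partial products that extends \<open>L\<close> beyond the line \<open>Re s = -1/2\<close>:
\<open>L(s) \<zeta>(2s+2) = 2\<^bsup>-s\<^esup> (1 + 5\<^bsup>-s\<^esup> / 3) K(s)\<close>.\<close>

lemma sing_factor_eq:
  assumes "Re s > -1/2" "N > 5"
  shows "(\<Prod>p<N. sing_factor p s) = 2 powr (- s) * (1 + 5 powr (- s) / 3) * (\<Prod>p<N. sing_factor' p s) * (\<Prod>p<N. prime_factor_powr (2 * s + 2) p)"
proof -
  define w where "w = (\<lambda>p::nat. if p = 2 then 2 powr (- s) else if p = 5 then 1 + 5 powr (- s) / 3 else (1::complex))"
  have "sing_factor p s = w p * (sing_factor' p s * prime_factor_powr (2 * s + 2) p)" for p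
  proof (cases "prime p")
    case False
    then have "p \<noteq> 2" "p \<noteq> 5" by auto
    then show ?thesis using False by (simp add: sing_factor_def sing_factor'_def prime_factor_powr_def w_def)
  next
    case True
    define v where "v = (of_nat p powr (- s - 1) :: complex)"
    have "norm v < 1" unfolding v_def using True assms by (intro norm_prime_powr_less_1) auto
    then have nz: "1 + v \<noteq> 0" by (metis add_eq_0_iff less_irrefl norm_minus_cancel norm_one)
    have v2: "of_nat p powr (- (2 * s + 2)) = v * v"
    proof -
      have "- (2 * s + 2) = (- s - 1) + (- s - 1)" by simp
      then show ?thesis unfolding v_def by (simp only: powr_add)
    qed
    have pp: "of_nat p \<noteq> (0::complex)" "p > 0" using prime_gt_0_nat[OF True] by auto
    have u: "of_nat p powr (- s) = of_nat p * v" unfolding v_def powr_minus_one[OF pp(2)] using pp by simp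
    have q: "(1 + a * v) / (1 + v) * (1 - v * v) = (1 + a * v) * (1 - v)" for a
      using nz by (simp add: field_simps)
    consider "p = 2" | "p = 5" | "p \<noteq> 2" "p \<noteq> 5" by blast
    then show ?thesis
    proof cases
      case 1
      then show ?thesis using q[of 0] v2 by (simp add: sing_factor_def sing_factor'_def prime_factor_powr_def w_def v_def)
    next
      case 2
      then show ?thesis using q[of 0] v2 True by (simp add: sing_factor_def sing_factor'_def prime_factor_powr_def w_def v_def)
    next
      case 3
      have "sing_factor p s = (1 + (of_nat p / (of_nat p - 2)) * v) * (1 - v)"
        using 3 True by (simp add: sing_factor_def u v_def)
      also have "\<dots> = w p * (sing_factor' p s * prime_factor_powr (2 * s + 2) p)"
        using 3 True q[of "of_nat p / (of_nat p - 2)"] v2 by (simp add: sing_factor'_def prime_factor_powr_def w_def v_def)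
      finally show ?thesis .
    qed
  qed
  then have "(\<Prod>p<N. sing_factor p s) = (\<Prod>p<N. w p) * ((\<Prod>p<N. sing_factor' p s) * (\<Prod>p<N. prime_factor_powr (2 * s + 2) p))"
    by (simp add: prod.distrib)
  also have "(\<Prod>p<N. w p) = (\<Prod>p\<in>{2,5}. w p)"
    by (rule prod.mono_neutral_right) (use assms in \<open>auto simp: w_def\<close>)
  also have "\<dots> = 2 powr (- s) * (1 + 5 powr (- s) / 3)" by (simp add: w_def)
  finally show ?thesis by (simp only: mult.assoc)
qed

lemma sing_weight_Euler:
  assumes s: "Re s > 2" and L: "(\<lambda>N. \<Prod>p<N. sing_factor p s) \<longlonglongrightarrow> L"
  shows "2 powr (- s) * (\<Sum>n. of_real (sing_weight (Suc n)) * of_nat (Suc n) powr (- s)) = zeta1 s / (s - 1) * (zeta1 (s + 1) / s) * L"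
proof -
  let ?f = "\<lambda>n. of_real (sing_weight n) * of_nat n powr (- s) :: complex"
  note w1 = sing_weight_1
  have E: "(\<lambda>N. \<Prod>p<N. local_factor ?f p) \<longlonglongrightarrow> (\<Sum>n. ?f (Suc n))"
  proof (rule Euler_product)
    show "?f (m * n) = ?f m * ?f n" if "coprime m n" for m n
      using sing_weight_mult[OF that] by (simp add: of_nat_powr_mult del: of_nat_mult)
    show "summable (\<lambda>n. norm (?f (Suc n)))" by (rule summable_sing_weight[OF s])
  qed (use w1 in simp)
  have loc: "(if p = 2 then 2 powr (- s) else 1) * local_factor ?f p
      = inverse (prime_factor_powr s p) * inverse (prime_factor_powr (s + 1) p) * sing_factor p s" for p
  proof (cases "prime p")
    case False
    then have "p \<noteq> 2" by auto
    then show ?thesis using False by (simp add: local_factor_def prime_factor_powr_def sing_factor_def)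
  next
    case True
    have pp: "p > 0" using prime_gt_0_nat[OF True] .
    define u where "u = (of_nat p powr (- s) :: complex)"
    define c where "c = complex_of_real (if p > 2 then (real p - 1) / (real p - 2) else 1)"
    have nu: "norm u < 1" unfolding u_def using True s by (intro norm_prime_powr_less_1) auto
    have lf: "local_factor ?f p = 1 + c * u / (1 - u)"
    proof (rule local_factor_geometric[OF True _ _ nu])
      fix j show "?f (p ^ Suc j) = c * u ^ Suc j"
        unfolding sing_weight_prime_power[OF True] of_nat_power_powr[OF pp] c_def u_def ..
    qed (use w1 in simp)
    have v: "of_nat p powr (- (s + 1)) = u / of_nat p" "of_nat p powr (- s - 1) = u / of_nat p"
      using powr_minus_one[OF pp, of "- s"] by (simp_all add: u_def)
    have nv: "norm (u / of_nat p) < 1" unfolding v(2)[symmetric] using True s by (intro norm_prime_powr_less_1) auto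
    have nz: "1 - u \<noteq> 0" "1 - u / of_nat p \<noteq> 0" using nu nv by auto
    show ?thesis
    proof (cases "p = 2")
      case p2: True
      have "1 + u / (1 - u) = 1 / (1 - u)" using nz by (simp add: field_simps)
      then have 1: "local_factor ?f p = inverse (1 - u)" unfolding lf using p2 by (simp add: c_def inverse_eq_divide)
      have 2: "prime_factor_powr s p = 1 - u" "prime_factor_powr (s + 1) p = 1 - u / of_nat p"
        using True v by (simp_all only: prime_factor_powr_def u_def if_True)
      have 3: "sing_factor p s = u * (1 - u / of_nat p)" "2 powr (- s) = u"
        using True p2 v(2) by (simp_all add: sing_factor_def u_def)
      show ?thesis unfolding 1 2 3 using nz p2 by simp
    next
      case False
      have p3: "real p \<ge> 3" by (rule prime_odd_ge_3[OF True False])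
      have nz2: "of_nat p - 2 \<noteq> (0::complex)" using p3 by (auto simp: complex_eq_iff)
      have "c = (of_nat p - 1) / (of_nat p - 2)" using p3 by (simp add: c_def)
      then have c': "c = 1 + 1 / (of_nat p - 2)" using nz2 by (simp add: field_simps)
      have "1 + c * u / (1 - u) = (1 - u + c * u) / (1 - u)" using nz by (simp add: add_divide_distrib)
      also have "1 - u + c * u = 1 + u / (of_nat p - 2)" unfolding c' by (simp add: algebra_simps)
      finally have "1 + c * u / (1 - u) = (1 + u / (of_nat p - 2)) / (1 - u)" .
      then show ?thesis using True False nz lf v unfolding prime_factor_powr_def sing_factor_def
        by (simp add: u_def[symmetric] inverse_eq_divide)
    qed
  qed
  have "(\<lambda>N. (\<Prod>p<N. inverse (prime_factor_powr s p)) * (\<Prod>p<N. inverse (prime_factor_powr (s + 1) p)) * (\<Prod>p<N. sing_factor p s))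
      \<longlonglongrightarrow> zeta1 s / (s - 1) * (zeta1 (s + 1) / (s + 1 - 1)) * L"
    by (intro tendsto_mult zeta_Euler_product L) (use s in auto)
  moreover have "eventually (\<lambda>N. (\<Prod>p<N. inverse (prime_factor_powr s p)) * (\<Prod>p<N. inverse (prime_factor_powr (s + 1) p)) * (\<Prod>p<N. sing_factor p s)
      = 2 powr (- s) * (\<Prod>p<N. local_factor ?f p)) sequentially"
    using eventually_gt_at_top[of "2::nat"]
  proof eventually_elim
    case (elim N)
    have d: "(\<Prod>p<N. (if p = 2 then 2 powr (- s) else 1)) = (2 powr (- s) :: complex)"
      using elim by (subst prod.delta) auto
    have "(\<Prod>p<N. inverse (prime_factor_powr s p)) * (\<Prod>p<N. inverse (prime_factor_powr (s + 1) p)) * (\<Prod>p<N. sing_factor p s)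
      = (\<Prod>p<N. (if p = 2 then 2 powr (- s) else 1) * local_factor ?f p)"
      by (simp only: prod.distrib[symmetric] loc)
    then show ?case by (simp only: prod.distrib d)
  qed
  ultimately have "(\<lambda>N. 2 powr (- s) * (\<Prod>p<N. local_factor ?f p)) \<longlonglongrightarrow> zeta1 s / (s - 1) * (zeta1 (s + 1) / (s + 1 - 1)) * L"
    by (rule Lim_transform_eventually)
  then have "(\<lambda>N. 2 powr (- s) * (\<Prod>p<N. local_factor ?f p)) \<longlonglongrightarrow> zeta1 s / (s - 1) * (zeta1 (s + 1) / s) * L" by simp
  moreover have "(\<lambda>N. 2 powr (- s) * (\<Prod>p<N. local_factor ?f p)) \<longlonglongrightarrow> 2 powr (- s) * (\<Sum>n. ?f (Suc n))"
    by (intro tendsto_intros E)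
  ultimately show ?thesis using LIMSEQ_unique by blast
qed

lemma twin_prime_const_LIMSEQ:
  "(\<lambda>N. \<Prod>p<N. if prime p \<and> p > 2 then 1 - 1 / (real p - 1)\<^sup>2 else 1) \<longlonglongrightarrow> twin_prime_const"
  using convergent_prod_LIMSEQ[OF convergent_prod_twin_prime_const]
    LIMSEQ_imp_Suc[of "\<lambda>N. \<Prod>p<N. if prime p \<and> p > 2 then 1 - 1 / (real p - 1)\<^sup>2 else 1"]
  by (simp add: twin_prime_const_def lessThan_Suc_atMost)

text \<open>At \<open>0\<close> the odd Euler factors of \<open>L\<close> are the reciprocals of those of \<open>C\<^sub>2\<close>, and at \<open>1\<close>
the same holds after division by the factors of \<open>1/\<zeta>(2)\<close>. These two values make the main term match.\<close>

lemma sing_factor_product_0_1: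
  assumes L0: "(\<lambda>N. \<Prod>p<N. sing_factor p 0) \<longlonglongrightarrow> L0" and L1: "(\<lambda>N. \<Prod>p<N. sing_factor p 1) \<longlonglongrightarrow> L1"
  shows "of_real (2 * twin_prime_const) * L0 = 1" "of_real (2 * twin_prime_const) * zeta1 2 * L1 = 1"
proof -
  define c where "c = (\<lambda>p::nat. if prime p \<and> p > 2 then 1 - 1 / (real p - 1)\<^sup>2 else 1)"
  have "(\<lambda>N. complex_of_real (\<Prod>p<N. c p)) \<longlonglongrightarrow> of_real twin_prime_const"
    using twin_prime_const_LIMSEQ unfolding c_def by (rule tendsto_of_real)
  then have C: "(\<lambda>N. \<Prod>p<N. complex_of_real (c p)) \<longlonglongrightarrow> of_real twin_prime_const" by (simp only: of_real_prod)
  have del: "(\<Prod>p<N. (if p = 2 then 1/2 else 1)) = (1/2 :: complex)" if "N > 2" for N :: nat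
    using that by (subst prod.delta) auto
  have cp: "of_real (c p) * sing_factor p 0 = (if p = 2 then 1/2 else 1)"
     "of_real (c p) * inverse (prime_factor_powr 2 p) * sing_factor p 1 = (if p = 2 then 1/2 else 1)" for p
  proof -
    have "(of_real (c p) * sing_factor p 0 = (if p = 2 then 1/2 else 1)) \<and>
     (of_real (c p) * inverse (prime_factor_powr 2 p) * sing_factor p 1 = (if p = 2 then 1/2 else 1))"
    proof (cases "prime p \<and> p \<noteq> 2")
      case True
      then have p3: "real p \<ge> 3" by (intro prime_odd_ge_3) auto
      then have p2: "p > 2" by simp
      define x where "x = real p"
      have x: "x \<ge> 3" "x - 1 \<noteq> 0" "x - 2 \<noteq> 0" "x \<noteq> 0" using p3 by (auto simp: x_def)
      have P: "of_nat p powr (- 1) = complex_of_real (1 / x)" "of_nat p powr (- 2) = complex_of_real (1 / x\<^sup>2)"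
        using p2 by (simp_all add: x_def powr_minus powr_numeral inverse_eq_divide)
      have S0: "sing_factor p 0 = of_real ((1 + 1 / (x - 2)) * (1 - 1 / x))"
        using True p2 P by (simp add: sing_factor_def x_def)
      have S1: "sing_factor p 1 = of_real ((1 + (1 / x) / (x - 2)) * (1 - 1 / x\<^sup>2))"
        using True p2 P by (simp add: sing_factor_def x_def)
      have Q: "prime_factor_powr 2 p = of_real (1 - 1 / x\<^sup>2)" using True P by (simp add: prime_factor_powr_def)
      have cx: "c p = 1 - 1 / (x - 1)\<^sup>2" using True p2 by (simp add: c_def x_def)
      have sq: "(x - 1)\<^sup>2 - 1 = x * (x - 2)" by (simp add: power2_eq_square algebra_simps)
      have "1 - 1 / (x - 1)\<^sup>2 = ((x - 1)\<^sup>2 - 1) / (x - 1)\<^sup>2" using x by (simp add: diff_divide_distrib)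
      then have "1 - 1 / (x - 1)\<^sup>2 = x * (x - 2) / (x - 1)\<^sup>2" unfolding sq .
      moreover have "(1 + 1 / (x - 2)) * (1 - 1 / x) = (x - 1)\<^sup>2 / (x * (x - 2))" using x by (simp add: field_simps power2_eq_square)
      ultimately have e0: "c p * ((1 + 1 / (x - 2)) * (1 - 1 / x)) = 1" using x by (simp add: cx)
      have "1 + (1 / x) / (x - 2) = (x * (x - 2) + 1) / (x * (x - 2))" using x by (simp add: add_divide_distrib)
      also have "x * (x - 2) + 1 = (x - 1)\<^sup>2" using sq by simp
      finally have "1 + (1 / x) / (x - 2) = (x - 1)\<^sup>2 / (x * (x - 2))" .
      moreover have "1 - 1 / x\<^sup>2 \<noteq> 0"
      proof -
        have "x\<^sup>2 \<ge> 3 * 3" unfolding power2_eq_square using x by (intro mult_mono) auto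
        then show ?thesis by simp
      qed
      ultimately have e1: "c p * inverse (1 - 1 / x\<^sup>2) * ((1 + (1 / x) / (x - 2)) * (1 - 1 / x\<^sup>2)) = 1"
        using x \<open>1 - 1 / (x - 1)\<^sup>2 = x * (x - 2) / (x - 1)\<^sup>2\<close> by (simp add: cx)
      have "of_real (c p) * sing_factor p 0 = 1" unfolding S0 of_real_mult[symmetric] e0 by simp
      moreover have "of_real (c p) * inverse (prime_factor_powr 2 p) * sing_factor p 1 = 1"
        unfolding S1 Q of_real_inverse[symmetric] of_real_mult[symmetric] e1 by simp
      ultimately show ?thesis using True by simp
    next
      case False
      then show ?thesis by (cases "p = 2") (auto simp: c_def sing_factor_def prime_factor_powr_def powr_minus powr_numeral)
    qed
    then show "of_real (c p) * sing_factor p 0 = (if p = 2 then 1/2 else 1)"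
     "of_real (c p) * inverse (prime_factor_powr 2 p) * sing_factor p 1 = (if p = 2 then 1/2 else 1)" by blast+
  qed
  have T0: "(\<lambda>N. (\<Prod>p<N. complex_of_real (c p)) * (\<Prod>p<N. sing_factor p 0)) \<longlonglongrightarrow> of_real twin_prime_const * L0"
    by (intro tendsto_mult C L0)
  have E0: "eventually (\<lambda>N. (\<Prod>p<N. complex_of_real (c p)) * (\<Prod>p<N. sing_factor p 0) = 1/2) sequentially"
    using eventually_gt_at_top[of "2::nat"]
  proof eventually_elim
    case (elim N)
    have "(\<Prod>p<N. complex_of_real (c p)) * (\<Prod>p<N. sing_factor p 0) = (\<Prod>p<N. of_real (c p) * sing_factor p 0)"
      by (simp only: prod.distrib)
    then show ?case by (simp only: cp(1) del[OF elim])
  qed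
  have "of_real twin_prime_const * L0 = 1/2"
    by (rule LIMSEQ_unique[OF T0 tendsto_eventually[OF E0]])
  then show "of_real (2 * twin_prime_const) * L0 = 1" by (simp add: mult_ac)
  have T1: "(\<lambda>N. (\<Prod>p<N. complex_of_real (c p)) * (\<Prod>p<N. inverse (prime_factor_powr 2 p)) * (\<Prod>p<N. sing_factor p 1)) \<longlonglongrightarrow> of_real twin_prime_const * (zeta1 2 / (2 - 1)) * L1"
    by (intro tendsto_mult C L1 zeta_Euler_product) simp
  have E1: "eventually (\<lambda>N. (\<Prod>p<N. complex_of_real (c p)) * (\<Prod>p<N. inverse (prime_factor_powr 2 p)) * (\<Prod>p<N. sing_factor p 1) = 1/2) sequentially"
    using eventually_gt_at_top[of "2::nat"]
  proof eventually_elim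
    case (elim N)
    have "(\<Prod>p<N. complex_of_real (c p)) * (\<Prod>p<N. inverse (prime_factor_powr 2 p)) * (\<Prod>p<N. sing_factor p 1)
       = (\<Prod>p<N. of_real (c p) * inverse (prime_factor_powr 2 p) * sing_factor p 1)"
      by (simp only: prod.distrib)
    then show ?case by (simp only: cp(2) del[OF elim])
  qed
  have "of_real twin_prime_const * (zeta1 2 / (2 - 1)) * L1 = 1/2"
    by (rule LIMSEQ_unique[OF T1 tendsto_eventually[OF E1]])
  then show "of_real (2 * twin_prime_const) * zeta1 2 * L1 = 1" by (simp add: mult_ac)
qed

text \<open>At \<open>s = 0\<close> every single factor is stationary, which is why no sum over primes appears in the
secondary main term.\<close>

lemma deriv_sing_factor_product_0: "((\<lambda>z. \<Prod>p<N. sing_factor p z) has_field_derivative 0) (at 0)"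
proof (induction N)
  case (Suc N)
  have "(sing_factor N has_field_derivative 0) (at 0)"
  proof -
    have p: "((\<lambda>s. of_nat n powr (- s + a)) has_field_derivative - (of_real (ln n) * of_nat n powr a)) (at 0)" if "n > 0" for n and a :: complex
    proof -
      have "((\<lambda>s. of_nat n powr (- s + a)) has_field_derivative Ln (of_nat n) * of_nat n powr (- 0 + a) * (- 1)) (at 0)"
        by (rule DERIV_chain2[OF has_field_derivative_powr_right]) (use that in \<open>auto intro!: derivative_eq_intros\<close>)
      then show ?thesis using that by simp
    qed
    consider "\<not> prime N" | "N = 2" | "prime N" "N \<noteq> 2" by blast
    then show ?thesis
    proof cases
      case 1 then show ?thesis by (simp add: sing_factor_def[abs_def])
    next
      case 2
      have a: "((\<lambda>s. 2 powr (- s)) has_field_derivative - of_real (ln 2)) (at (0::complex))"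
        using p[of 2 0] by simp
      have b: "((\<lambda>s. 2 powr (- s - 1)) has_field_derivative - (of_real (ln 2) / 2)) (at (0::complex))"
        using p[of 2 "- 1"] by (simp add: powr_minus)
      have "((\<lambda>s. 2 powr (- s) * (1 - 2 powr (- s - 1))) has_field_derivative
         - of_real (ln 2) * (1 - 2 powr (- 0 - 1)) + (0 - (- (of_real (ln 2) / 2))) * 2 powr (- 0)) (at (0::complex))"
        by (intro DERIV_mult DERIV_diff DERIV_const a b)
      then show ?thesis using 2 by (simp add: sing_factor_def[abs_def] powr_minus)
    next
      case 3
      have p3: "real N \<ge> 3" using 3 by (rule prime_odd_ge_3)
      have N0: "N > 0" using p3 by simp
      let ?p = "of_nat N :: complex"
      have nz: "?p \<noteq> 0" "?p - 2 \<noteq> 0" using p3 by (auto simp: complex_eq_iff)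
      have a: "((\<lambda>s. ?p powr (- s)) has_field_derivative - of_real (ln N)) (at 0)"
        using p[OF N0, of 0] N0 by simp
      have b: "((\<lambda>s. ?p powr (- s - 1)) has_field_derivative - (of_real (ln N) / ?p)) (at 0)"
        using p[OF N0, of "- 1"] N0 by (simp add: powr_minus divide_inverse)
      have "((\<lambda>s. (1 + ?p powr (- s) / (?p - 2)) * (1 - ?p powr (- s - 1))) has_field_derivative
         (0 + - of_real (ln N) / (?p - 2)) * (1 - ?p powr (- 0 - 1)) + (0 - (- (of_real (ln N) / ?p))) * (1 + ?p powr (- 0) / (?p - 2))) (at 0)"
        by (intro DERIV_mult DERIV_diff DERIV_add DERIV_const DERIV_cdivide a b)
      moreover have "(0 + - of_real (ln N) / (?p - 2)) * (1 - ?p powr (- 0 - 1)) + (0 - (- (of_real (ln N) / ?p))) * (1 + ?p powr (- 0) / (?p - 2)) = 0"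
        using nz N0 by (simp add: powr_minus field_simps)
      ultimately show ?thesis using 3 by (simp add: sing_factor_def[abs_def])
    qed
  qed
  from DERIV_mult[OF Suc this] show ?case by simp
qed simp

section \<open>Orders of zeros\<close>

text \<open>Order of vanishing, expressed by a nonzero limit so that products, affine substitutions and
the approach along a ray can be handled by limit rules alone.\<close>

definition has_order :: "(complex \<Rightarrow> complex) \<Rightarrow> complex \<Rightarrow> nat \<Rightarrow> bool" where
  "has_order f z n \<longleftrightarrow> (\<exists>c. c \<noteq> 0 \<and> ((\<lambda>w. f w / (w - z) ^ n) \<longlongrightarrow> c) (at z))"

lemma has_order_mult:
  assumes "has_order f z m" "has_order g z n"
  shows "has_order (\<lambda>w. f w * g w) z (m + n)"
proof -
  obtain c d where c: "c \<noteq> 0" "((\<lambda>w. f w / (w - z) ^ m) \<longlongrightarrow> c) (at z)" and d: "d \<noteq> 0" "((\<lambda>w. g w / (w - z) ^ n) \<longlongrightarrow> d) (at z)"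
    using assms by (auto simp: has_order_def)
  have "((\<lambda>w. f w / (w - z) ^ m * (g w / (w - z) ^ n)) \<longlongrightarrow> c * d) (at z)"
    by (intro tendsto_intros c d)
  then show ?thesis unfolding has_order_def using c d by (intro exI[of _ "c * d"]) (simp add: power_add)
qed

lemma has_order_nonzero:
  assumes "isCont f z" "f z \<noteq> 0"
  shows "has_order f z 0"
  using assms unfolding has_order_def isCont_def by auto

lemma has_order_cong:
  assumes "eventually (\<lambda>w. f w = g w) (at z)"
  shows "has_order f z n = has_order g z n"
proof -
  have "((\<lambda>w. f w / (w - z) ^ n) \<longlongrightarrow> c) (at z) = ((\<lambda>w. g w / (w - z) ^ n) \<longlongrightarrow> c) (at z)" for c
    by (intro filterlim_cong refl eventually_mono[OF assms]) simp
  then show ?thesis by (simp add: has_order_def)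
qed

lemma has_order_affine:
  assumes "has_order f (a * z + b) n" "a \<noteq> 0"
  shows "has_order (\<lambda>w. f (a * w + b)) z n"
proof -
  obtain c where c: "c \<noteq> 0" "((\<lambda>w. f w / (w - (a * z + b)) ^ n) \<longlongrightarrow> c) (at (a * z + b))"
    using assms by (auto simp: has_order_def)
  have "filterlim (\<lambda>w. a * w + b) (at (a * z + b)) (at z)"
    using assms(2) by (intro filterlim_atI tendsto_intros) (auto simp: eventually_at_filter)
  from filterlim_compose[OF c(2) this]
  have "((\<lambda>w. f (a * w + b) / (a * w + b - (a * z + b)) ^ n) \<longlongrightarrow> c) (at z)" .
  then have "((\<lambda>w. f (a * w + b) / (a * w + b - (a * z + b)) ^ n * a ^ n) \<longlongrightarrow> c * a ^ n) (at z)"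
    by (intro tendsto_intros)
  moreover have "f (a * w + b) / (a * w + b - (a * z + b)) ^ n * a ^ n = f (a * w + b) / (w - z) ^ n" for w
  proof -
    have "a * w + b - (a * z + b) = a * (w - z)" by (simp add: algebra_simps)
    then show ?thesis using assms(2) by (simp add: power_mult_distrib)
  qed
  ultimately show ?thesis unfolding has_order_def using c assms(2) by (intro exI[of _ "c * a ^ n"]) simp
qed

lemma has_order_exists:
  assumes hol: "f holomorphic_on S" "open S" "connected S" "z \<in> S" and w: "w \<in> S" "f w \<noteq> 0"
  obtains n where "has_order f z n"
proof (cases "f z = 0")
  case False
  have "isCont f z" using hol holomorphic_on_imp_continuous_on continuous_on_eq_continuous_at by blast
  from has_order_nonzero[OF this False] show ?thesis by (rule that)
next
  case True
  have "\<not> f constant_on S"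
  proof
    assume "f constant_on S"
    then obtain y where "\<And>x. x \<in> S \<Longrightarrow> f x = y" by (auto simp: constant_on_def)
    with True w hol(4) show False by metis
  qed
  obtain g r n where g: "0 < r" "g holomorphic_on ball z r"
     "\<And>w. w \<in> ball z r \<Longrightarrow> f w = (w - z) ^ n * g w" "\<And>w. w \<in> ball z r \<Longrightarrow> g w \<noteq> 0"
    by (rule holomorphic_factor_zero_nonconstant[OF hol True \<open>\<not> f constant_on S\<close>]) (rule that)
  have "continuous_on (ball z r) g" using g(2) by (rule holomorphic_on_imp_continuous_on)
  then have "isCont g z" using g(1) by (simp add: continuous_on_eq_continuous_at)
  then have lim: "(g \<longlongrightarrow> g z) (at z)" by (simp add: isCont_def)
  have "eventually (\<lambda>w. w \<in> ball z r) (at z)" using g(1) by (intro eventually_at_in_open') auto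
  moreover have "eventually (\<lambda>w. w \<noteq> z) (at z)" by (auto simp: eventually_at_filter)
  ultimately have "eventually (\<lambda>w. g w = f w / (w - z) ^ n) (at z)"
    by eventually_elim (simp add: g(3))
  with lim have "((\<lambda>w. f w / (w - z) ^ n) \<longlongrightarrow> g z) (at z)" by (rule Lim_transform_eventually)
  moreover have "g z \<noteq> 0" using g(1,4) by simp
  ultimately have "has_order f z n" unfolding has_order_def by blast
  then show ?thesis by (rule that)
qed

lemma has_order_zero:
  assumes "isCont f z" "f z = 0"
  shows "\<not> has_order f z 0"
proof
  assume "has_order f z 0"
  then obtain c where "c \<noteq> 0" "(f \<longlongrightarrow> c) (at z)" by (auto simp: has_order_def)
  with assms tendsto_unique[of "at z" f c 0] show False by (simp add: isCont_def)
qed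

lemma has_order_1_deriv:
  assumes "has_order f z 1" "f z = 0" "(f has_field_derivative D) (at z)"
  shows "D \<noteq> 0"
proof -
  obtain c where c: "c \<noteq> 0" "((\<lambda>w. f w / (w - z) ^ 1) \<longlongrightarrow> c) (at z)" using assms(1) by (auto simp: has_order_def)
  have "((\<lambda>w. f w / (w - z) ^ 1) \<longlongrightarrow> D) (at z)"
    using assms(2,3) by (simp add: has_field_derivative_iff)
  from tendsto_unique[OF _ this c(2)] c(1) show ?thesis by simp
qed

section \<open>A zero that is not cancelled\<close>

lemma xi_isCont: "isCont xi z"
  using xi_holomorphic[of UNIV] by (auto dest!: holomorphic_on_imp_continuous_on simp: continuous_on_eq_continuous_at)

lemma xi_2: "xi 2 \<noteq> 0"
  using zeta1_nonzero[of 2] by (simp add: xi_eq_0_iff)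

lemma xi_has_order:
  obtains n where "has_order xi z n"
  by (rule has_order_exists[OF xi_holomorphic open_UNIV connected_UNIV UNIV_I UNIV_I xi_2, of z])

lemma xi_has_order_reflect: "has_order xi (1 - z) n \<longleftrightarrow> has_order xi z n"
proof -
  have e: "- 1 * w + 1 = 1 - w" for w :: complex by simp
  have 1: "has_order xi (1 - z) n \<Longrightarrow> has_order xi z n" for z
    using has_order_affine[of xi "- 1" z 1 n] unfolding e xi_reflect by simp
  from 1[of z] 1[of "1 - z"] show ?thesis by auto
qed

lemma xi_zero_Re:
  assumes "xi z = 0"
  shows "0 \<le> Re z" "Re z \<le> 1"
proof -
  have *: "Re z \<le> 1" if "xi z = 0" for z
  proof (rule ccontr)
    assume "\<not> Re z \<le> 1"
    then show False using zeta1_nonzero[of z] xi_eq_0_iff[of z] that by simp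
  qed
  show "Re z \<le> 1" by (rule *[OF assms])
  have "Re (1 - z) \<le> 1" by (rule *) (simp add: xi_reflect assms)
  then show "0 \<le> Re z" by simp
qed

text \<open>In particular \<open>1\<close> and \<open>2/3\<close> are no zeros.\<close>

lemma xi_real_nonzero: "xi (of_real x) \<noteq> 0"
proof -
  have *: "xi (of_real x) \<noteq> 0" if "x > 0" for x
    using zeta1_real_pos[OF that] xi_eq_0_iff[of "of_real x"] that by auto
  show ?thesis
  proof (cases "x > 0")
    case False
    then show ?thesis using *[of "1 - x"] xi_reflect[of "of_real x"] by simp
  qed (rule *)
qed

text \<open>If \<open>\<rho>\<close> is a zero, the numerator of the transform at \<open>\<rho>/2 - 1\<close> contains \<open>\<zeta>(\<rho>/2)\<close>, whose
order is that of \<open>\<xi>\<close> at this reflected point. The map preserves \<open>Re z \<ge> 1/2\<close> on the critical strip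
and contracts towards its fixed point \<open>2/3\<close>.\<close>

definition halving :: "complex \<Rightarrow> complex" where "halving z = 1 - z / 2"

text \<open>Equivalent to \<open>1 + 5\<^bsup>-s\<^esup> / 3 = 0\<close> at \<open>s = z/2 - 1\<close>.\<close>

definition exceptional :: "complex \<Rightarrow> bool" where
  "exceptional z \<longleftrightarrow> exp ((1 - z / 2) * of_real (ln 5)) = - 3"

lemma halving_funpow: "(halving ^^ n) z = 2 / 3 + (- 1 / 2) ^ n * (z - 2 / 3)"
proof (induction n)
  case (Suc n)
  have "1 - (2 / 3 + q * y) / 2 = 2 / 3 + (- 1 / 2 * q) * y" for q y :: complex
    by (simp add: field_simps)
  then show ?case using Suc by (simp add: halving_def)
qed simp

lemma Re_halving_funpow: "Re ((halving ^^ n) z) - 2 / 3 = (- 1 / 2) ^ n * (Re z - 2 / 3)"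
proof -
  have "(- 1 / 2 :: complex) ^ n = of_real ((- 1 / 2) ^ n)" by simp
  then show ?thesis unfolding halving_funpow by (simp del: of_real_power)
qed

text \<open>The common real part of the exceptional points; \<open>exceptional_iff\<close> shows that they form a single
arithmetic progression on this line.\<close>

definition exceptional_abscissa :: real where "exceptional_abscissa = 2 - 2 * ln 3 / ln 5"

lemma exceptional_iff:
  "exceptional z \<longleftrightarrow> (\<exists>k::int. z = 2 - 2 * (of_real (ln 3) + \<i> * of_real (pi * (2 * of_int k + 1))) / of_real (ln 5))"
proof -
  have l5: "complex_of_real (ln 5) \<noteq> 0" by simp
  have m3: "- 3 = exp (complex_of_real (ln 3) + \<i> * of_real pi)"
    by (simp add: exp_add exp_of_real)
  have "exceptional z \<longleftrightarrow> (\<exists>k::int. (1 - z / 2) * of_real (ln 5) = of_real (ln 3) + \<i> * of_real pi + of_int (2 * k) * (of_real pi * \<i>))"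
    unfolding exceptional_def m3 exp_eq by (simp add: mult.assoc)
  also have "\<dots> \<longleftrightarrow> (\<exists>k::int. z = 2 - 2 * (of_real (ln 3) + \<i> * of_real (pi * (2 * of_int k + 1))) / of_real (ln 5))"
  proof (intro ex_cong1)
    fix k :: int
    have "of_real (ln 3) + \<i> * of_real pi + of_int (2 * k) * (of_real pi * \<i>) = complex_of_real (ln 3) + \<i> * of_real (pi * (2 * of_int k + 1))"
      by (simp add: algebra_simps)
    moreover have gen: "(1 - z / 2) * l = c \<longleftrightarrow> z = 2 - 2 * c / l" if "l \<noteq> 0" for l c :: complex
      using that by (auto simp: field_simps)
    ultimately show "((1 - z / 2) * of_real (ln 5) = of_real (ln 3) + \<i> * of_real pi + of_int (2 * k) * (of_real pi * \<i>)) =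
       (z = 2 - 2 * (of_real (ln 3) + \<i> * of_real (pi * (2 * of_int k + 1))) / of_real (ln 5))"
      by (simp only: gen[OF l5])
  qed
  finally show ?thesis .
qed

lemma exceptional_Re: "exceptional z \<Longrightarrow> Re z = exceptional_abscissa"
  unfolding exceptional_iff exceptional_abscissa_def by (auto simp: Re_divide_of_real)

text \<open>Otherwise \<open>3\<^sup>3 = 5\<^sup>2\<close>. Since \<open>2/3\<close> is the fixed point of the contraction, an orbit can meet
the line of exceptional points at most once.\<close>

lemma exceptional_abscissa_ne: "exceptional_abscissa \<noteq> 2 / 3"
proof
  assume "exceptional_abscissa = 2 / 3"
  then have "ln (3::real) * 3 = ln 5 * 2" by (simp add: exceptional_abscissa_def field_simps)
  then have "real 3 * ln (3::real) = real 2 * ln 5" by simp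
  then have "ln ((3::real) ^ 3) = ln (5 ^ 2)" by (subst (1 2) ln_realpow) auto
  then have "(3::real) ^ 3 = 5 ^ 2" by (subst (asm) ln_inj_iff) auto
  then show False by simp
qed

lemma xi_real_growth: "norm (xi (of_nat (2 * M))) \<ge> fact M / pi ^ M" if "M \<ge> 1" for M
proof -
  let ?s = "real (2 * M)"
  have s: "?s > 1" using that by simp
  have E: "zeta1 (of_real ?s) = of_real ((?s - 1) * (\<Sum>n. real (Suc n) powr (- ?s)))"
    by (rule zeta1_real_gt_1[OF s])
  have "(?s - 1) * (\<Sum>n. real (Suc n) powr (- ?s)) \<ge> 1 * 1"
  proof (intro mult_mono)
    have "(\<Sum>n\<in>{0}. real (Suc n) powr (- ?s)) \<le> (\<Sum>n. real (Suc n) powr (- ?s))"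
      by (intro sum_le_suminf summable_powr_Suc[OF s]) auto
    then show "1 \<le> (\<Sum>n. real (Suc n) powr (- ?s))" by simp
  qed (use that in auto)
  then have z: "norm (zeta1 (of_real ?s)) \<ge> 1" unfolding E norm_of_real by linarith
  have G: "Gamma (of_real ?s / 2 + 1 :: complex) = fact M"
    using Gamma_fact[of M, where 'a = complex] by (simp add: add.commute)
  have P: "norm (of_real pi powr (- of_real ?s / 2) :: complex) = 1 / pi ^ M"
    by (subst norm_powr_real_powr) (auto simp: powr_minus powr_realpow inverse_eq_divide)
  have "norm (xi (of_real ?s)) = 1 / pi ^ M * fact M * norm (zeta1 (of_real ?s))"
    using s by (simp only: xi_eq_xi0[of "of_real ?s"] Re_complex_of_real xi0_def norm_mult G P) (simp add: xi_eq_xi0 xi0_def norm_mult G P)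
  also have "\<dots> \<ge> 1 / pi ^ M * fact M * 1" using z by (intro mult_left_mono) auto
  finally show ?thesis by simp
qed

text \<open>Suppose that the order at \<open>\<rho>\<close> never exceeds the order at \<open>halving \<rho>\<close> by more than the exceptional
factor allows. Then \<open>halving\<close> maps zeros to zeros until an exceptional point is met; this must
happen, as the orbit would otherwise accumulate at \<open>2/3\<close>. It happens only once, so following the orbit
back from there shows that all zeros are simple. The number of steps is bounded because the
distance of the real part to \<open>2/3\<close> halves each time and ends at a fixed positive value. So all
zeros lie in finitely many arithmetic progressions, and \<open>\<xi>\<close> grows too slowly.\<close>

theorem xi_uncancelled_zero:
  obtains \<rho> n k where "xi \<rho> = 0" "1 / 2 \<le> Re \<rho>" "Re \<rho> \<le> 1" "has_order xi \<rho> n" "has_order xi (halving \<rho>) k"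
    "n > k + (if exceptional \<rho> then 1 else 0)"
proof (rule ccontr)
  note witness = that
  assume no: "\<not> thesis"
  have cancel: "n \<le> k + (if exceptional z then 1 else 0)"
    if z: "xi z = 0" "1 / 2 \<le> Re z" "has_order xi z n" "has_order xi (halving z) k" for z n k
  proof (rule ccontr)
    assume "\<not> n \<le> k + (if exceptional z then 1 else 0)"
    then have "n > k + (if exceptional z then 1 else 0)" by (simp only: not_le)
    from witness[OF z(1,2) xi_zero_Re(2)[OF z(1)] z(3,4) this] no show False by contradiction
  qed
  have ord_pos: "n > 0" if "xi z = 0" "has_order xi z n" for z n
    using has_order_zero[OF xi_isCont that(1)] that(2) by (cases n) auto
  have Re_half: "1 / 2 \<le> Re (halving z)" if "xi z = 0" for z
    using xi_zero_Re[OF that] by (simp add: halving_def)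
  have step: "xi (halving z) = 0" if "xi z = 0" "1 / 2 \<le> Re z" "\<not> exceptional z" for z
  proof (rule ccontr)
    assume nz: "xi (halving z) \<noteq> 0"
    obtain n where n: "has_order xi z n" by (rule xi_has_order)
    have "n \<le> 0 + (if exceptional z then 1 else 0)"
      by (rule cancel[OF that(1,2) n]) (rule has_order_nonzero[OF xi_isCont nz])
    with ord_pos[OF that(1) n] that(3) show False by simp
  qed
  (* an orbit of zeros without exceptional points would converge to a zero at 2/3 *)
  have hits: "\<exists>n. exceptional ((halving ^^ n) z)" if z: "xi z = 0" "1 / 2 \<le> Re z" for z
  proof (rule ccontr)
    assume no: "\<not> (\<exists>n. exceptional ((halving ^^ n) z))"
    have "xi ((halving ^^ n) z) = 0 \<and> 1 / 2 \<le> Re ((halving ^^ n) z)" for n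
    proof (induction n)
      case (Suc n)
      then show ?case using step[of "(halving ^^ n) z"] Re_half[of "(halving ^^ n) z"] no by auto
    qed (use z in simp)
    moreover have "(\<lambda>n. (halving ^^ n) z) \<longlonglongrightarrow> 2 / 3 + 0 * (z - 2 / 3)"
      unfolding halving_funpow by (intro tendsto_intros LIMSEQ_power_zero) (simp add: norm_divide)
    then have "(\<lambda>n. xi ((halving ^^ n) z)) \<longlonglongrightarrow> xi (2 / 3)"
      using isCont_tendsto_compose[OF xi_isCont] by fastforce
    ultimately have "xi (2 / 3) = 0" using LIMSEQ_unique[OF _ tendsto_const] by force
    then show False using xi_real_nonzero[of "2 / 3"] by simp
  qed
  (* a second exceptional point on the same orbit would have another real part *)
  have exc_half: "xi (halving z) \<noteq> 0" if ez: "exceptional z" and xz: "xi z = 0" for z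
  proof
    assume h: "xi (halving z) = 0"
    obtain n where "exceptional ((halving ^^ n) (halving z))" using hits[OF h Re_half[OF xz]] by blast
    then have "exceptional ((halving ^^ Suc n) z)" by (simp add: funpow_swap1)
    then have "Re ((halving ^^ Suc n) z) = exceptional_abscissa" by (rule exceptional_Re)
    with Re_halving_funpow[of "Suc n" z] exceptional_Re[OF ez]
    have e: "exceptional_abscissa - 2 / 3 = (- 1 / 2) ^ Suc n * (exceptional_abscissa - 2 / 3)" by (simp only:)
    have one: "q = 1" if "d = q * d" "d \<noteq> 0" for q d :: real using that by simp
    have "(- 1 / 2 :: real) ^ Suc n = 1" by (rule one[OF e]) (use exceptional_abscissa_ne in simp)
    then have "\<bar>(- 1 / 2 :: real)\<bar> ^ Suc n = 1" by (metis abs_1 power_abs)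
    moreover have "\<bar>(- 1 / 2 :: real)\<bar> ^ Suc n < 1" by (intro power_Suc_less_one) auto
    ultimately show False by simp
  qed
  have simple: "n \<le> 1" if "xi z = 0" "1 / 2 \<le> Re z" "exceptional ((halving ^^ m) z)" "has_order xi z n" for z m n
    using that
  proof (induction m arbitrary: z n)
    case 0
    then have ex: "exceptional z" by simp
    have "has_order xi (halving z) 0" by (rule has_order_nonzero[OF xi_isCont exc_half[OF ex 0(1)]])
    from cancel[OF 0(1,2,4) this] ex show ?case by simp
  next
    case (Suc m)
    show ?case
    proof (cases "exceptional z")
      case True
      have "has_order xi (halving z) 0" by (rule has_order_nonzero[OF xi_isCont exc_half[OF True Suc(2)]])
      from cancel[OF Suc(2,3,5) this] True show ?thesis by simp
    next
      case False
      obtain k where k: "has_order xi (halving z) k" by (rule xi_has_order)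
      have "k \<le> 1"
        by (rule Suc.IH[OF step[OF Suc(2,3) False] Re_half[OF Suc(2)] _ k])
           (use Suc(4) in \<open>simp add: funpow_swap1\<close>)
      moreover have "n \<le> k + (if exceptional z then 1 else 0)" by (rule cancel[OF Suc(2,3,5) k])
      ultimately show ?thesis using False by simp
    qed
  qed
  obtain N where N: "\<And>n. n \<ge> N \<Longrightarrow> (1 / 2) ^ n < \<bar>exceptional_abscissa - 2 / 3\<bar>"
  proof -
    have "(\<lambda>n. (1 / 2 :: real) ^ n) \<longlonglongrightarrow> 0" by (rule LIMSEQ_power_zero) simp
    from LIMSEQ_D[OF this, of "\<bar>exceptional_abscissa - 2 / 3\<bar>"] exceptional_abscissa_ne that show ?thesis by auto
  qed
  define g where "g = (\<lambda>z. xi (1 / 2 + z))"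
  have g_hol: "g holomorphic_on UNIV"
  proof -
    have "(xi \<circ> (\<lambda>z. 1 / 2 + z)) holomorphic_on UNIV"
      by (rule holomorphic_on_compose) (auto intro!: holomorphic_intros xi_holomorphic)
    then show ?thesis by (simp add: o_def g_def)
  qed
  have g_even: "g (- z) = g z" for z
    using xi_reflect[of "1 / 2 + z"] by (simp add: g_def algebra_simps)
  have g0: "g 0 \<noteq> 0" using xi_real_nonzero[of "1 / 2"] by (simp add: g_def)
  obtain A where A: "A \<ge> 0" "\<And>s. norm (xi s) \<le> A * exp (4 * (norm s + 4) powr (3 / 2))"
    using xi_growth by blast
  have g_growth: "norm (g z) \<le> (A + 1) * exp (4 * (norm z + 5) powr (3 / 2))" for z
  proof -
    have "norm (1 / 2 + z) \<le> norm z + 1" using norm_triangle_ineq[of "1 / 2" z] by simp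
    then have "exp (4 * (norm (1 / 2 + z) + 4) powr (3 / 2)) \<le> exp (4 * (norm z + 5) powr (3 / 2))"
      by (intro iffD2[OF exp_le_cancel_iff] mult_left_mono powr_mono2) auto
    then have "A * exp (4 * (norm (1 / 2 + z) + 4) powr (3 / 2)) \<le> (A + 1) * exp (4 * (norm z + 5) powr (3 / 2))"
      using A(1) by (intro mult_mono) auto
    then show ?thesis using A(2)[of "1 / 2 + z"] by (simp add: g_def)
  qed
  (* Every zero is an n-th preimage of an exceptional point, n < N, or its reflection about 1/2.
     In an index (j, d, n, b) the flag d says on which side of the critical line the zero lies, and
     b and j encode the sign and size of the integer k that numbers the exceptional points; k = -1 - j
     for negative k. The modulus is at least j + 1. *)
  define \<rho>f where "\<rho>f = (\<lambda>(j::nat, d::bool, n::nat, b::bool). 2 / 3 + (- 2) ^ n *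
     (2 - 2 * (of_real (ln 3) + \<i> * of_real (pi * (2 * of_int (if b then int j else - int j - 1) + 1))) / of_real (ln 5) - 2 / 3) :: complex)"
  define \<Psi> where "\<Psi> = (\<lambda>(j::nat, d::bool, n::nat, b::bool). if d then \<rho>f (j, d, n, b) - 1 / 2 else 1 / 2 - \<rho>f (j, d, n, b))"
  have loc: "\<exists>j n b. n < N \<and> \<rho> = \<rho>f (j, d, n, b)" if \<rho>: "xi \<rho> = 0" "1 / 2 \<le> Re \<rho>" for \<rho> d
  proof -
    obtain n where n: "exceptional ((halving ^^ n) \<rho>)" using hits[OF \<rho>] by blast
    define w where "w = (halving ^^ n) \<rho>"
    have w\<rho>: "\<rho> = 2 / 3 + (- 2) ^ n * (w - 2 / 3)"
    proof -
      have "(- 2 :: complex) ^ n * (- 1 / 2) ^ n = 1" by (simp flip: power_mult_distrib)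
      then show ?thesis unfolding w_def halving_funpow by (simp add: mult.assoc[symmetric])
    qed
    have "exceptional_abscissa - 2 / 3 = (- 1 / 2) ^ n * (Re \<rho> - 2 / 3)"
      using Re_halving_funpow[of n \<rho>] exceptional_Re[OF n] by simp
    then have "\<bar>exceptional_abscissa - 2 / 3\<bar> = (1 / 2) ^ n * \<bar>Re \<rho> - 2 / 3\<bar>" by (simp add: abs_mult power_abs)
    also have "\<dots> \<le> (1 / 2) ^ n * 1" using \<rho> xi_zero_Re[OF \<rho>(1)] by (intro mult_left_mono) auto
    finally have "n < N" using N[of n] by (cases "n \<ge> N") auto
    obtain k :: int where k: "w = 2 - 2 * (of_real (ln 3) + \<i> * of_real (pi * (2 * of_int k + 1))) / of_real (ln 5)"
      using n unfolding w_def[symmetric] exceptional_iff by blast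
    show ?thesis
    proof (cases "k \<ge> 0")
      case True
      then have "\<rho> = \<rho>f (nat k, d, n, True)" unfolding \<rho>f_def using w\<rho> k by simp
      then show ?thesis using \<open>n < N\<close> by blast
    next
      case False
      then have "- int (nat (- k - 1)) - 1 = k" by simp
      then have "\<rho> = \<rho>f (nat (- k - 1), d, n, False)" unfolding \<rho>f_def using w\<rho> k by simp
      then show ?thesis using \<open>n < N\<close> by blast
    qed
  qed
  have loc': "\<exists>p. snd p \<in> UNIV \<times> {..<N} \<times> UNIV \<and> \<Psi> p = a" if a: "g a = 0" for a
  proof (cases "Re a \<ge> 0")
    case True
    then obtain j n b where "n < N" "1 / 2 + a = \<rho>f (j, True, n, b)"
      using loc[of "1 / 2 + a" True] a by (auto simp: g_def)
    then have "\<Psi> (j, True, n, b) = a" by (simp add: \<Psi>_def flip: \<open>1 / 2 + a = \<rho>f (j, True, n, b)\<close>)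
    then show ?thesis using \<open>n < N\<close> by (intro exI[of _ "(j, True, n, b)"]) simp
  next
    case False
    have "xi (1 / 2 - a) = 0" using a g_even[of a] by (simp add: g_def)
    then obtain j n b where "n < N" "1 / 2 - a = \<rho>f (j, False, n, b)"
      using loc[of "1 / 2 - a" False] False by auto
    then have "\<Psi> (j, False, n, b) = a" by (simp add: \<Psi>_def flip: \<open>1 / 2 - a = \<rho>f (j, False, n, b)\<close>)
    then show ?thesis using \<open>n < N\<close> by (intro exI[of _ "(j, False, n, b)"]) simp
  qed
  have size: "norm (\<Psi> p) \<ge> real (Suc (fst p))" for p
  proof -
    obtain j d n b where p: "p = (j, d, n, b)" by (metis prod_cases4)
    define k where "k = (if b then int j else - int j - 1)"
    have kj: "\<bar>2 * real_of_int k + 1\<bar> \<ge> real (Suc j)" by (simp add: k_def)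
    have l5: "0 < ln (5::real)" "ln (5::real) \<le> 4" using ln_le_minus_one[of "5::real"] by auto
    have "Im (\<rho>f (j, d, n, b)) = (- 2) ^ n * (- 2 * (pi * (2 * of_int k + 1)) / ln 5)"
    proof -
      have "(- 2 :: complex) ^ n = of_real ((- 2) ^ n)" by simp
      moreover have "\<rho>f (j, d, n, b) = 2 / 3 + (- 2) ^ n *
         (2 - 2 * (of_real (ln 3) + \<i> * of_real (pi * (2 * of_int k + 1))) / of_real (ln 5) - 2 / 3)"
        by (simp add: \<rho>f_def k_def)
      ultimately show ?thesis by (simp add: Im_divide_of_real del: of_real_power)
    qed
    then have "\<bar>Im (\<rho>f (j, d, n, b))\<bar> = 2 ^ n * (2 * pi / ln 5 * \<bar>2 * real_of_int k + 1\<bar>)"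
      using l5 by (simp add: abs_mult power_abs)
    moreover have "2 ^ n * (2 * pi / ln 5 * \<bar>2 * real_of_int k + 1\<bar>) \<ge> 1 * (1 * real (Suc j))"
      using l5 pi_gt3 kj by (intro mult_mono) (auto simp: le_divide_eq)
    moreover have "\<bar>Im (\<Psi> p)\<bar> = \<bar>Im (\<rho>f (j, d, n, b))\<bar>" by (simp add: \<Psi>_def p)
    ultimately show ?thesis using abs_Im_le_cmod[of "\<Psi> p"] by (simp add: p)
  qed
  define \<phi> where "\<phi> = (\<lambda>a. SOME p. snd p \<in> UNIV \<times> {..<N} \<times> UNIV \<and> \<Psi> p = a)"
  have \<phi>: "snd (\<phi> a) \<in> UNIV \<times> {..<N} \<times> UNIV" "\<Psi> (\<phi> a) = a" if "g a = 0" for a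
    using someI_ex[OF loc'[OF that]] by (auto simp: \<phi>_def)
  define c where "c = card (UNIV \<times> {..<N} \<times> UNIV :: (bool \<times> nat \<times> bool) set)"
  have g_simple: "deriv g a \<noteq> 0" if ga: "g a = 0" for a
  proof -
    have main: "has_order xi z 1" if z: "xi z = 0" "1 / 2 \<le> Re z" for z
    proof -
      obtain n where n: "has_order xi z n" by (rule xi_has_order)
      obtain m where "exceptional ((halving ^^ m) z)" using hits[OF z] by blast
      from simple[OF z this n] ord_pos[OF z(1) n] have "n = 1" by simp
      with n show ?thesis by simp
    qed
    have z: "xi (1 / 2 + a) = 0" using ga by (simp add: g_def)
    have "has_order xi (1 / 2 + a) 1"
    proof (cases "1 / 2 \<le> Re (1 / 2 + a)")
      case True then show ?thesis using main z by blast
    next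
      case False
      have "has_order xi (1 - (1 / 2 + a)) 1" using z False xi_reflect[of "1 / 2 + a"] by (intro main) auto
      then show ?thesis by (simp only: xi_has_order_reflect)
    qed
    then have "has_order g a 1" using has_order_affine[of xi 1 a "1 / 2" 1] by (simp add: g_def add.commute)
    moreover have "(g has_field_derivative deriv g a) (at a)" using g_hol by (auto intro!: holomorphic_derivI)
    ultimately show ?thesis using ga has_order_1_deriv by blast
  qed
  have bound: "norm (g (of_real x)) ^ 2 \<le> norm (g 0) ^ 2 * exp (pi * x) ^ c" if x: "x \<ge> 1" for x
  proof (rule even_entire_zero_product_bound[OF g_hol g_even g0 g_growth _ _ _ g_simple])
    fix S assume S: "finite S" "\<And>a. a \<in> S \<Longrightarrow> g a = 0"
    show "(\<Prod>a\<in>S. 1 + x\<^sup>2 / (norm a)\<^sup>2) \<le> exp (pi * x) ^ c"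
      unfolding c_def
    proof (rule prod_indexed_zeros_bound[OF S(1), of \<phi>])
      show "inj_on \<phi> S" using \<phi>(2) S(2) by (metis inj_onI)
      show "norm a \<ge> real (Suc (fst (\<phi> a)))" if "a \<in> S" for a
        using size[of "\<phi> a"] \<phi>(2)[OF S(2)[OF that]] by simp
    qed (use \<phi>(1) S(2) x in auto)
  qed (use A(1) x in auto)
  (* the values at 2 M grow like a factorial, against the exponential bound *)
  define K where "K = pi ^ 2 * exp (2 * pi) ^ c"
  have K: "K > 0" by (simp add: K_def)
  have fle: "fact M \<le> norm (g 0) ^ 2 * K ^ M" if "M \<ge> 1" for M :: nat
  proof -
    let ?x = "real (2 * M) - 1 / 2"
    have x: "?x \<ge> 1" using that by (simp add: field_simps)
    have gx: "g (of_real ?x) = xi (of_nat (2 * M))" by (simp add: g_def)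
    have "(fact M / pi ^ M) ^ 2 \<le> norm (g (of_real ?x)) ^ 2"
      unfolding gx using xi_real_growth[OF that] by (intro power_mono) auto
    also have "\<dots> \<le> norm (g 0) ^ 2 * exp (pi * ?x) ^ c" by (rule bound[OF x])
    also have "\<dots> \<le> norm (g 0) ^ 2 * (exp (2 * pi) ^ c) ^ M"
    proof (intro mult_left_mono)
      have "exp (pi * ?x) \<le> exp (2 * pi) ^ M"
        by (simp add: exp_of_nat_mult[symmetric] algebra_simps)
      then have "exp (pi * ?x) ^ c \<le> (exp (2 * pi) ^ M) ^ c" by (intro power_mono) auto
      also have "\<dots> = (exp (2 * pi) ^ c) ^ M" by (simp add: power_mult[symmetric] mult.commute)
      finally show "exp (pi * ?x) ^ c \<le> (exp (2 * pi) ^ c) ^ M" .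
    qed simp
    finally have "fact M ^ 2 \<le> norm (g 0) ^ 2 * (exp (2 * pi) ^ c) ^ M * (pi ^ M) ^ 2"
      by (simp add: power_divide divide_le_eq)
    also have "\<dots> = norm (g 0) ^ 2 * K ^ M"
      by (simp add: K_def power_mult_distrib power_mult[symmetric] mult_ac)
    finally have "fact M ^ 2 \<le> norm (g 0) ^ 2 * K ^ M" .
    moreover have "(fact M :: real) * 1 \<le> fact M * fact M" by (intro mult_left_mono fact_ge_1) auto
    then have "(fact M :: real) \<le> fact M ^ 2" by (simp add: power2_eq_square)
    ultimately show ?thesis by (rule order_trans[rotated])
  qed
  have "(\<lambda>M. norm (g 0) ^ 2 * (K ^ M / fact M)) \<longlonglongrightarrow> norm (g 0) ^ 2 * 0"
  proof (intro tendsto_intros)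
    have "summable (\<lambda>M. K ^ M / fact M)" using summable_exp[of K] by (simp add: field_simps)
    then show "(\<lambda>M. K ^ M / fact M) \<longlonglongrightarrow> 0" by (rule summable_LIMSEQ_zero)
  qed
  moreover have "eventually (\<lambda>M. 1 \<le> norm (g 0) ^ 2 * (K ^ M / fact M)) sequentially"
    using eventually_ge_at_top[of "1::nat"]
    by eventually_elim (use fle in \<open>simp add: le_divide_eq\<close>)
  ultimately have "(1::real) \<le> norm (g 0) ^ 2 * 0"
    by (rule tendsto_lowerbound) simp
  then show False by simp
qed

section \<open>One-sided bounds\<close>

text \<open>Subtract \<open>e\<close> from \<open>c x\<^bsup>a-1\<^esup>\<close>. Up to a piece of compact support this is nonnegative, so Landau's
theorem applies and the transform of \<open>e\<close> converges absolutely to the right of \<open>a\<close>. Moreover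
\<open>\<bar>e\<bar> \<le> 2 c x\<^bsup>a-1\<^esup> - e\<close> up to that piece, so on a vertical line \<open>Re s = a + h\<close> the transform is bounded
by \<open>2 c / h\<close> plus its value at the real point, and the latter stays bounded because the continuation
is holomorphic at \<open>a\<close>. As \<open>c > 0\<close> is arbitrary, \<open>h \<Phi>\<close> tends to \<open>0\<close>.\<close>

lemma Landau_oscillation:
  fixes e :: "real \<Rightarrow> real" and \<Psi> :: "complex \<Rightarrow> complex"
  assumes meas [measurable]: "e \<in> borel_measurable borel"
    and bdd: "\<And>X. \<exists>B. \<forall>x\<in>{1..X}. \<bar>e x\<bar> \<le> B"
    and ab: "a < b"
    and int: "\<And>\<sigma>. b < \<sigma> \<Longrightarrow> integrable lborel (\<lambda>x. indicator {1..} x * (e x * x powr (- \<sigma>)))"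
    and U: "open U" "\<And>\<sigma>. a \<le> \<sigma> \<Longrightarrow> complex_of_real \<sigma> \<in> U" and hol: "\<Psi> holomorphic_on U"
    and eq: "\<And>\<sigma>. b < \<sigma> \<Longrightarrow> \<Psi> (of_real \<sigma>) = of_real (LINT x|lborel. indicator {1..} x * (e x * x powr (- \<sigma>)))"
    and onesided: "\<And>c. c > 0 \<Longrightarrow> eventually (\<lambda>x. e x \<le> c * x powr (a - 1)) at_top"
  obtains \<Phi> where "\<Phi> holomorphic_on {s. a < Re s}" "\<And>\<sigma>. b < \<sigma> \<Longrightarrow> \<Phi> (of_real \<sigma>) = \<Psi> (of_real \<sigma>)"
    "\<And>t. ((\<lambda>h. of_real h * \<Phi> (Complex (a + h) t)) \<longlongrightarrow> 0) (at_right 0)"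
proof -
  define h where "h = (\<lambda>x::real. ln (max 1 x))"
  have [measurable]: "h \<in> borel_measurable borel" unfolding h_def by measurable
  have h0: "h x \<ge> 0" for x by (simp add: h_def)
  have hx: "exp (- \<sigma> * h x) = x powr (- \<sigma>)" if "x \<ge> 1" for \<sigma> x
    using that by (simp add: h_def powr_def max_def)
  define ie where "ie = (\<lambda>x. indicator {1..} x * e x)"
  have [measurable]: "ie \<in> borel_measurable borel" unfolding ie_def by measurable
  have ie_eq: "ie x * exp (- \<sigma> * h x) = indicator {1..} x * (e x * x powr (- \<sigma>))" for \<sigma> x
    using hx[of x \<sigma>] by (simp add: ie_def indicator_def)
  define w where "w = (\<lambda>c x. indicator {1..} x * (c * x powr (a - 1)) :: real)"
  have w_int: "has_bochner_integral lborel (\<lambda>x. w c x * exp (- \<sigma> * h x)) (c / (\<sigma> - a))" if "\<sigma> > a" for \<sigma> c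
  proof -
    have "has_bochner_integral lborel (\<lambda>x. c * (indicator {1..} x * x powr (a - 1 - \<sigma>))) (c * (1 powr (a - 1 - \<sigma> + 1) / (- (a - 1 - \<sigma> + 1))))"
      using that by (intro has_bochner_integral_mult_right has_bochner_integral_powr_atLeast) auto
    moreover have "c * (indicator {1..} x * x powr (a - 1 - \<sigma>)) = w c x * exp (- \<sigma> * h x)" for x
      using hx[of x \<sigma>] by (simp add: w_def indicator_def powr_diff powr_minus divide_inverse)
    ultimately show ?thesis by simp
  qed
  have w_meas [measurable]: "w c \<in> borel_measurable borel" for c unfolding w_def by measurable
  (* r collects the bounded range of x in which the one-sided bound may fail *)
  have key: "\<exists>g r. g \<in> borel_measurable borel \<and> r \<in> borel_measurable borel \<and> (\<forall>x. g x \<ge> 0) \<and> (\<forall>x. w c x - ie x = g x + r x) \<and>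
      (\<forall>\<sigma>. integrable lborel (\<lambda>x. \<bar>r x\<bar> * exp (- \<sigma> * h x)))" if c: "c > 0" for c
  proof -
    obtain X0 where X0: "\<And>x. x \<ge> X0 \<Longrightarrow> e x \<le> c * x powr (a - 1)"
      using onesided[OF c] by (auto simp: eventually_at_top_linorder)
    define X where "X = max 1 X0"
    define g where "g = (\<lambda>x. indicator {X..} x * (w c x - ie x))"
    define r where "r = (\<lambda>x. indicator {1..X} x * indicator {..<X} x * (w c x - ie x))"
    obtain B where B: "\<And>x. x \<in> {1..X} \<Longrightarrow> \<bar>e x\<bar> \<le> B" using bdd by blast
    have r_meas [measurable]: "r \<in> borel_measurable borel" unfolding r_def by measurable
    have int_r: "integrable lborel (\<lambda>x. \<bar>r x\<bar> * exp (- \<sigma> * h x))" for \<sigma>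
    proof (rule Bochner_Integration.integrable_bound)
      define D where "D = (c * X powr \<bar>a - 1\<bar> + \<bar>B\<bar>) * X powr \<bar>\<sigma>\<bar>"
      show "integrable lborel (\<lambda>x. D * indicator {1..X} x :: real)"
        by (intro integrable_mult_right integrable_real_indicator) (auto simp: emeasure_lborel_Icc_eq)
      show "AE x in lborel. norm (\<bar>r x\<bar> * exp (- \<sigma> * h x)) \<le> norm (D * indicator {1..X} x)"
      proof (rule AE_I2)
        fix x :: real
        show "norm (\<bar>r x\<bar> * exp (- \<sigma> * h x)) \<le> norm (D * indicator {1..X} x)"
        proof (cases "x \<in> {1..X}")
          case True
          have p: "x powr q \<le> X powr \<bar>q\<bar>" for q
          proof -
            have "x powr q \<le> x powr \<bar>q\<bar>" using True by (intro powr_mono) auto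
            also have "\<dots> \<le> X powr \<bar>q\<bar>" using True by (intro powr_mono2) auto
            finally show ?thesis .
          qed
          have "\<bar>r x\<bar> \<le> \<bar>w c x - ie x\<bar>" by (simp add: r_def indicator_def)
          also have "\<dots> \<le> c * X powr \<bar>a - 1\<bar> + \<bar>B\<bar>"
          proof -
            have "c * x powr (a - 1) \<le> c * X powr \<bar>a - 1\<bar>" using p c by (intro mult_left_mono) auto
            moreover have "0 \<le> c * x powr (a - 1)" using c by simp
            ultimately show ?thesis using True B[OF True] by (simp add: w_def ie_def)
          qed
          finally have "\<bar>r x\<bar> * exp (- \<sigma> * h x) \<le> D"
            unfolding D_def using hx[of x \<sigma>] True p[of "- \<sigma>"] c by (intro mult_mono) auto
          then show ?thesis using True by simp
        qed (simp add: r_def)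
      qed
    qed measurable
    have "g x \<ge> 0" for x
      using X0[of x] by (auto simp: g_def w_def ie_def X_def indicator_def)
    moreover have "w c x - ie x = g x + r x" for x
      by (auto simp: g_def r_def w_def ie_def X_def indicator_def)
    moreover have "g \<in> borel_measurable borel" unfolding g_def by measurable
    ultimately show ?thesis using r_meas int_r by blast
  qed
  have int_ie: "integrable lborel (\<lambda>x. ie x * exp (- \<sigma> * h x))" if "\<sigma> > a" for \<sigma>
  proof -
    obtain g r where gr: "g \<in> borel_measurable borel" "r \<in> borel_measurable borel" "\<And>x. g x \<ge> 0" "\<And>x. w 1 x - ie x = g x + r x"
      "\<And>\<sigma>. integrable lborel (\<lambda>x. \<bar>r x\<bar> * exp (- \<sigma> * h x))"
      using key[of 1] by auto
    have [measurable]: "g \<in> borel_measurable borel" "r \<in> borel_measurable borel" by (fact gr)+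
    have int_r: "integrable lborel (\<lambda>x. r x * exp (- \<sigma> * h x))" for \<sigma>
      by (rule Bochner_Integration.integrable_bound[OF gr(5)[of \<sigma>]]) (auto simp: abs_mult)
    have g_eq: "g x = w 1 x - ie x - r x" for x using gr(4)[of x] by simp
    have int_w: "integrable lborel (\<lambda>x. w 1 x * exp (- \<sigma> * h x))" if "\<sigma> > a" for \<sigma>
      using w_int[OF that] by (simp add: has_bochner_integral_iff)
    have int_ie': "integrable lborel (\<lambda>x. ie x * exp (- \<sigma> * h x))" if "\<sigma> > b" for \<sigma>
      unfolding ie_eq by (rule int[OF that])
    define W where "W = (\<lambda>s. LINT x|lborel. complex_of_real (r x) * exp (- s * of_real (h x)))"
    have W_hol: "W holomorphic_on {s. a - 1 < Re s}"
      unfolding W_def by (rule exp_transform_holomorphic_halfplane) (use gr(5) in auto)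
    have W_real: "W (of_real \<sigma>) = of_real (LINT x|lborel. r x * exp (- \<sigma> * h x))" for \<sigma>
    proof -
      have "W (of_real \<sigma>) = (LINT x|lborel. complex_of_real (r x * exp (- \<sigma> * h x)))"
        by (simp add: W_def flip: exp_of_real)
      then show ?thesis by (simp only: integral_complex_of_real)
    qed
    have "integrable lborel (\<lambda>x. g x * exp (- \<sigma> * h x))"
    proof (rule Landau_nonneg_transform[where a = a and b = b and U = "U \<inter> {s. a < Re s}"
           and \<Psi> = "\<lambda>s. 1 / (s - of_real a) - \<Psi> s - W s"])
      show "open (U \<inter> {s. a < Re s})" by (intro open_Int U open_halfspace_Re_gt)
      show "(\<lambda>s. 1 / (s - of_real a) - \<Psi> s - W s) holomorphic_on U \<inter> {s. a < Re s}"
        by (intro holomorphic_intros holomorphic_on_subset[OF hol] holomorphic_on_subset[OF W_hol]) auto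
      fix \<tau> assume \<tau>: "b < \<tau>"
      have split: "g x * exp (- \<tau> * h x) = w 1 x * exp (- \<tau> * h x) - ie x * exp (- \<tau> * h x) - r x * exp (- \<tau> * h x)" for x
        unfolding g_eq by (simp add: algebra_simps)
      have aux: "integrable lborel (\<lambda>x. w 1 x * exp (- \<tau> * h x))" "integrable lborel (\<lambda>x. ie x * exp (- \<tau> * h x))" "integrable lborel (\<lambda>x. r x * exp (- \<tau> * h x))"
        using int_w[of \<tau>] int_ie'[of \<tau>] int_r[of \<tau>] \<tau> ab by auto
      show "integrable lborel (\<lambda>x. g x * exp (- \<tau> * h x))"
        unfolding split by (intro Bochner_Integration.integrable_diff aux)
      have "(LINT x|lborel. g x * exp (- \<tau> * h x)) = 1 / (\<tau> - a) - (LINT x|lborel. ie x * exp (- \<tau> * h x)) - (LINT x|lborel. r x * exp (- \<tau> * h x))"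
        unfolding split using aux w_int[of \<tau> 1] \<tau> ab by (simp add: Bochner_Integration.integral_diff has_bochner_integral_iff)
      moreover have "\<Psi> (of_real \<tau>) = of_real (LINT x|lborel. ie x * exp (- \<tau> * h x))"
        unfolding eq[OF \<tau>] ie_eq ..
      ultimately show "1 / (of_real \<tau> - of_real a) - \<Psi> (of_real \<tau>) - W (of_real \<tau>) = of_real (LINT x|lborel. g x * exp (- \<tau> * h x))"
        using W_real[of \<tau>] by (simp only: of_real_diff of_real_divide of_real_1)
    qed (use gr h0 U ab that in auto)
    then have "integrable lborel (\<lambda>x. w 1 x * exp (- \<sigma> * h x) - g x * exp (- \<sigma> * h x) - r x * exp (- \<sigma> * h x))"
      using int_w[OF that] int_r by (intro Bochner_Integration.integrable_diff)
    moreover have "w 1 x * exp (- \<sigma> * h x) - g x * exp (- \<sigma> * h x) - r x * exp (- \<sigma> * h x) = ie x * exp (- \<sigma> * h x)" for x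
      unfolding g_eq by (simp add: algebra_simps)
    ultimately show ?thesis by (simp only:)
  qed
  define \<Phi> where "\<Phi> = (\<lambda>s. LINT x|lborel. complex_of_real (ie x) * exp (- s * of_real (h x)))"
  have int_abs: "integrable lborel (\<lambda>x. \<bar>ie x\<bar> * exp (- \<sigma> * h x))" if "\<sigma> > a" for \<sigma>
    using integrable_abs[OF int_ie[OF that]] by (simp add: abs_mult)
  have \<Phi>_hol: "\<Phi> holomorphic_on {s. a < Re s}"
    unfolding \<Phi>_def by (rule exp_transform_holomorphic_halfplane) (use int_abs in auto)
  have \<Phi>_real: "\<Phi> (of_real \<sigma>) = of_real (LINT x|lborel. ie x * exp (- \<sigma> * h x))" for \<sigma>
  proof -
    have "\<Phi> (of_real \<sigma>) = (LINT x|lborel. complex_of_real (ie x * exp (- \<sigma> * h x)))"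
      by (simp add: \<Phi>_def flip: exp_of_real)
    then show ?thesis by (simp only: integral_complex_of_real)
  qed
  have \<Phi>\<Psi>: "\<Phi> (of_real \<sigma>) = \<Psi> (of_real \<sigma>)" if "b < \<sigma>" for \<sigma>
    unfolding \<Phi>_real eq[OF that] ie_eq ..
  (* a thin rectangle around the segment lies in U and is connected *)
  have \<Phi>\<Psi>': "\<Phi> (of_real \<sigma>) = \<Psi> (of_real \<sigma>)" if \<sigma>: "a < \<sigma>" "\<sigma> \<le> b" for \<sigma>
  proof -
    have "compact (complex_of_real ` {a..b+1})"
      by (intro compact_continuous_image continuous_intros) auto
    moreover have "complex_of_real ` {a..b+1} \<subseteq> U" using U(2) by auto
    ultimately obtain \<epsilon> where \<epsilon>: "\<epsilon> > 0" "(\<Union>x\<in>complex_of_real ` {a..b+1}. ball x \<epsilon>) \<subseteq> U"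
      using compact_subset_open_imp_ball_epsilon_subset U(1) by metis
    define V where "V = {z. a < Re z} \<inter> {z. Re z < b + 1} \<inter> {z. Im z < \<epsilon>} \<inter> {z. - \<epsilon> < Im z}"
    show ?thesis
    proof (rule holomorphic_eq_if_eq_on_real_interval[of \<Phi> V \<Psi> b "b + 1"])
      show "\<Phi> holomorphic_on V" by (rule holomorphic_on_subset[OF \<Phi>_hol]) (auto simp: V_def)
      have "V \<subseteq> U"
      proof
        fix z assume z: "z \<in> V"
        then have "z \<in> ball (of_real (Re z)) \<epsilon>" by (auto simp: V_def dist_norm cmod_eq_Im abs_less_iff)
        moreover have "Re z \<in> {a..b+1}" using z by (auto simp: V_def)
        ultimately show "z \<in> U" using \<epsilon>(2) by blast
      qed
      then show "\<Psi> holomorphic_on V" using hol holomorphic_on_subset by blast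
      show "open V" unfolding V_def
        by (intro open_Int open_halfspace_Re_gt open_halfspace_Re_lt open_halfspace_Im_gt open_halfspace_Im_lt)
      show "connected V" unfolding V_def
        by (intro convex_connected convex_Int convex_halfspace_Re_gt convex_halfspace_Re_lt
             convex_halfspace_Im_gt convex_halfspace_Im_lt)
    qed (use \<Phi>\<Psi> ab \<sigma> \<epsilon>(1) in \<open>auto simp: V_def\<close>)
  qed
  have small: "((\<lambda>h. of_real h * \<Phi> (Complex (a + h) t)) \<longlongrightarrow> 0) (at_right 0)" for t
  proof (rule tendstoI)
    fix \<epsilon> :: real assume \<epsilon>: "\<epsilon> > 0"
    define c where "c = \<epsilon> / 4"
    have c: "c > 0" using \<epsilon> by (simp add: c_def)
    obtain g r where gr: "g \<in> borel_measurable borel" "r \<in> borel_measurable borel" "\<And>x. g x \<ge> 0" "\<And>x. w c x - ie x = g x + r x"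
      "\<And>\<sigma>. integrable lborel (\<lambda>x. \<bar>r x\<bar> * exp (- \<sigma> * h x))"
      using key[OF c] by auto
    have [measurable]: "g \<in> borel_measurable borel" "r \<in> borel_measurable borel" by (fact gr)+
    define R where "R = (LINT x|lborel. \<bar>r x\<bar> * exp (- a * h x))"
    have bound: "norm (\<Phi> (Complex (a + \<eta>) t)) \<le> 2 * c / \<eta> + norm (\<Psi> (of_real (a + \<eta>))) + 2 * R" if \<eta>: "\<eta> > 0" "\<eta> < b - a" for \<eta>
    proof -
      define \<sigma> where "\<sigma> = a + \<eta>"
      have \<sigma>: "\<sigma> > a" "\<sigma> \<le> b" using \<eta> by (auto simp: \<sigma>_def)
      have iw: "integrable lborel (\<lambda>x. w c x * exp (- \<sigma> * h x))" "(LINT x|lborel. w c x * exp (- \<sigma> * h x)) = c / \<eta>"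
        using w_int[OF \<sigma>(1), of c] by (simp_all add: has_bochner_integral_iff \<sigma>_def)
      have nrm: "norm (complex_of_real (ie x) * exp (- Complex \<sigma> t * of_real (h x))) = \<bar>ie x\<bar> * exp (- \<sigma> * h x)" for x
        by (simp add: norm_mult)
      have "norm (\<Phi> (Complex \<sigma> t)) \<le> (LINT x|lborel. norm (complex_of_real (ie x) * exp (- Complex \<sigma> t * of_real (h x))))"
        unfolding \<Phi>_def by (rule integral_norm_bound)
      also have "\<dots> = (LINT x|lborel. \<bar>ie x\<bar> * exp (- \<sigma> * h x))" unfolding nrm ..
      also have "\<dots> \<le> (LINT x|lborel. 2 * (w c x * exp (- \<sigma> * h x)) - ie x * exp (- \<sigma> * h x) + 2 * (\<bar>r x\<bar> * exp (- \<sigma> * h x)))"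
      proof (rule integral_mono)
        show "integrable lborel (\<lambda>x. \<bar>ie x\<bar> * exp (- \<sigma> * h x))" by (rule int_abs[OF \<sigma>(1)])
        show "integrable lborel (\<lambda>x. 2 * (w c x * exp (- \<sigma> * h x)) - ie x * exp (- \<sigma> * h x) + 2 * (\<bar>r x\<bar> * exp (- \<sigma> * h x)))"
          by (intro Bochner_Integration.integrable_add Bochner_Integration.integrable_diff integrable_mult_right iw int_ie \<sigma> gr(5))
        fix x
        have "w c x \<ge> 0" using c by (simp add: w_def indicator_def)
        then have "\<bar>ie x\<bar> \<le> 2 * w c x - ie x + 2 * \<bar>r x\<bar>" using gr(3,4)[of x] by linarith
        then have "\<bar>ie x\<bar> * exp (- \<sigma> * h x) \<le> (2 * w c x - ie x + 2 * \<bar>r x\<bar>) * exp (- \<sigma> * h x)" by (intro mult_right_mono) auto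
        then show "\<bar>ie x\<bar> * exp (- \<sigma> * h x) \<le> 2 * (w c x * exp (- \<sigma> * h x)) - ie x * exp (- \<sigma> * h x) + 2 * (\<bar>r x\<bar> * exp (- \<sigma> * h x))"
          by (simp add: algebra_simps)
      qed
      also have "\<dots> = 2 * (c / \<eta>) - (LINT x|lborel. ie x * exp (- \<sigma> * h x)) + 2 * (LINT x|lborel. \<bar>r x\<bar> * exp (- \<sigma> * h x))"
        using iw int_ie[OF \<sigma>(1)] gr(5)[of \<sigma>] by (simp add: Bochner_Integration.integral_add Bochner_Integration.integral_diff)
      finally have "norm (\<Phi> (Complex \<sigma> t)) \<le> 2 * (c / \<eta>) - (LINT x|lborel. ie x * exp (- \<sigma> * h x)) + 2 * (LINT x|lborel. \<bar>r x\<bar> * exp (- \<sigma> * h x))" .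
      moreover have "(LINT x|lborel. \<bar>r x\<bar> * exp (- \<sigma> * h x)) \<le> R"
        unfolding R_def
      proof (rule integral_mono[OF gr(5) gr(5)])
        fix x
        have "a * h x \<le> \<sigma> * h x" using h0[of x] \<sigma> by (intro mult_right_mono) auto
        then show "\<bar>r x\<bar> * exp (- \<sigma> * h x) \<le> \<bar>r x\<bar> * exp (- a * h x)" by (intro mult_left_mono) auto
      qed
      moreover have "- (LINT x|lborel. ie x * exp (- \<sigma> * h x)) \<le> norm (\<Psi> (of_real \<sigma>))"
        using \<Phi>\<Psi>'[OF \<sigma>] unfolding \<Phi>_real by (metis abs_ge_minus_self norm_of_real)
      ultimately show ?thesis unfolding \<sigma>_def[symmetric] times_divide_eq_right[symmetric] by linarith
    qed
    have "isCont \<Psi> (of_real a)"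
      using hol U holomorphic_on_imp_continuous_on continuous_on_eq_continuous_at by blast
    moreover have "((\<lambda>\<eta>. complex_of_real (a + \<eta>)) \<longlongrightarrow> of_real (a + 0)) (at_right 0)"
      by (intro tendsto_intros)
    ultimately have "((\<lambda>\<eta>. \<Psi> (complex_of_real (a + \<eta>))) \<longlongrightarrow> \<Psi> (of_real a)) (at_right 0)"
      using isCont_tendsto_compose by force
    then have "((\<lambda>\<eta>. \<eta> * (norm (\<Psi> (of_real (a + \<eta>))) + 2 * R)) \<longlongrightarrow> 0 * (norm (\<Psi> (of_real a)) + 2 * R)) (at_right 0)"
      by (intro tendsto_intros)
    then have "eventually (\<lambda>\<eta>. dist (\<eta> * (norm (\<Psi> (of_real (a + \<eta>))) + 2 * R)) 0 < \<epsilon> / 2) (at_right 0)"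
      using \<epsilon> by (intro tendstoD) auto
    moreover have "eventually (\<lambda>\<eta>. \<eta> \<in> {0<..<b - a}) (at_right (0::real))"
      using ab by (intro eventually_at_right_real) auto
    ultimately show "eventually (\<lambda>\<eta>. dist (of_real \<eta> * \<Phi> (Complex (a + \<eta>) t)) 0 < \<epsilon>) (at_right 0)"
    proof eventually_elim
      case (elim \<eta>)
      then have \<eta>: "\<eta> > 0" "\<eta> < b - a" by auto
      have "norm (of_real \<eta> * \<Phi> (Complex (a + \<eta>) t)) = \<eta> * norm (\<Phi> (Complex (a + \<eta>) t))"
        using \<eta> by (simp add: norm_mult)
      also have "\<dots> \<le> \<eta> * (2 * c / \<eta> + norm (\<Psi> (of_real (a + \<eta>))) + 2 * R)"
        using bound[OF \<eta>] \<eta> by (intro mult_left_mono) auto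
      also have "\<dots> = 2 * c + \<eta> * (norm (\<Psi> (of_real (a + \<eta>))) + 2 * R)"
        using \<eta> by (simp add: field_simps)
      also have "\<dots> < 2 * c + \<epsilon> / 2" using elim(1) by (simp add: dist_norm abs_less_iff)
      also have "\<dots> = \<epsilon>" by (simp add: c_def)
      finally show ?case by (simp add: dist_norm)
    qed
  qed
  show ?thesis by (rule that[OF \<Phi>_hol \<Phi>\<Psi> small])
qed

section \<open>The transform of the error term\<close>

text \<open>Induction on \<open>m\<close>: one factor \<open>x - k\<close> is expanded, which shifts \<open>\<sigma>\<close> by one in the second
summand. Summed over \<open>k\<close> this turns the weighted sum \<open>S\<^sub>m\<close> into its Dirichlet series.\<close>

lemma has_bochner_integral_beta_tail:
  assumes "k > 0" "\<sigma> > 0"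
  shows "has_bochner_integral lborel (\<lambda>x. indicator {k..} x * ((x - k) ^ m * x powr (- real m - 1 - \<sigma>)))
           (k powr (- \<sigma>) * fact m / pochhammer \<sigma> (Suc m))"
  using assms(2)
proof (induction m arbitrary: \<sigma>)
  case 0
  have "has_bochner_integral lborel (\<lambda>x. indicator {k..} x * x powr (- 1 - \<sigma>)) (k powr (- 1 - \<sigma> + 1) / (- (- 1 - \<sigma> + 1)))"
    using 0 assms(1) by (intro has_bochner_integral_powr_atLeast) auto
  then show ?case by simp
next
  case (Suc m)
  have A: "has_bochner_integral lborel (\<lambda>x. indicator {k..} x * ((x - k) ^ m * x powr (- real m - 1 - \<sigma>)) - k * (indicator {k..} x * ((x - k) ^ m * x powr (- real m - 1 - (\<sigma> + 1)))))
     (k powr (- \<sigma>) * fact m / pochhammer \<sigma> (Suc m) - k * (k powr (- (\<sigma> + 1)) * fact m / pochhammer (\<sigma> + 1) (Suc m)))"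
    using Suc by (intro has_bochner_integral_diff has_bochner_integral_mult_right Suc.IH) auto
  have B: "indicator {k..} x * ((x - k) ^ m * x powr (- real m - 1 - \<sigma>)) - k * (indicator {k..} x * ((x - k) ^ m * x powr (- real m - 1 - (\<sigma> + 1))))
     = indicator {k..} x * ((x - k) ^ Suc m * x powr (- real (Suc m) - 1 - \<sigma>))" for x
  proof (cases "x \<ge> k")
    case True
    then have x: "x > 0" using assms(1) by simp
    define y where "y = x powr (- real m - 2 - \<sigma>)"
    have "- real m - 1 - \<sigma> = 1 + (- real m - 2 - \<sigma>)" by simp
    then have 1: "x powr (- real m - 1 - \<sigma>) = x * y" using x unfolding y_def by (metis powr_add powr_one less_imp_le)
    have 2: "x powr (- real m - 1 - (\<sigma> + 1)) = y" "x powr (- real (Suc m) - 1 - \<sigma>) = y"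
      unfolding y_def by (simp_all add: algebra_simps)
    show ?thesis unfolding 1 2 using True by (simp add: algebra_simps)
  qed simp
  have C: "k powr (- \<sigma>) * fact m / pochhammer \<sigma> (Suc m) - k * (k powr (- (\<sigma> + 1)) * fact m / pochhammer (\<sigma> + 1) (Suc m))
     = k powr (- \<sigma>) * fact (Suc m) / pochhammer \<sigma> (Suc (Suc m))"
  proof -
    define P where "P = pochhammer (\<sigma> + 1) m"
    have P: "P > 0" unfolding P_def using Suc.prems by (intro pochhammer_pos) auto
    have p1: "pochhammer \<sigma> (Suc m) = \<sigma> * P" by (simp only: pochhammer_rec P_def)
    have p2: "pochhammer (\<sigma> + 1) (Suc m) = P * (\<sigma> + 1 + real m)" by (simp only: pochhammer_Suc P_def)
    have p3: "pochhammer \<sigma> (Suc (Suc m)) = \<sigma> * (P * (\<sigma> + 1 + real m))" by (simp only: pochhammer_rec[of \<sigma> "Suc m"] p2)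
    have "k * k powr (- (\<sigma> + 1)) = k powr (- \<sigma>)" using assms(1) by (simp add: powr_mult_base)
    then have "k * (k powr (- (\<sigma> + 1)) * fact m / (P * (\<sigma> + 1 + real m))) = k powr (- \<sigma>) * fact m / (P * (\<sigma> + 1 + real m))"
      by (metis mult.assoc times_divide_eq_right)
    then have "k powr (- \<sigma>) * fact m / (\<sigma> * P) - k * (k powr (- (\<sigma> + 1)) * fact m / (P * (\<sigma> + 1 + real m)))
      = k powr (- \<sigma>) * fact m / (\<sigma> * P) - k powr (- \<sigma>) * fact m / (P * (\<sigma> + 1 + real m))" by (simp only:)
    also have "\<dots> = k powr (- \<sigma>) * (fact m * (1 + real m)) / (\<sigma> * (P * (\<sigma> + 1 + real m)))"
      using P Suc.prems by (simp add: divide_simps) (simp add: algebra_simps)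
    also have "fact m * (1 + real m) = fact (Suc m)" by (simp add: algebra_simps)
    finally show ?thesis unfolding p1 p2 p3 .
  qed
  show ?case using A unfolding B C .
qed

lemma twin_prime_const_nonneg: "twin_prime_const \<ge> 0"
proof (rule LIMSEQ_le_const[OF twin_prime_const_LIMSEQ], intro exI[of _ 0] allI impI prod_nonneg)
  fix p :: nat
  show "0 \<le> (if prime p \<and> p > 2 then 1 - 1 / (real p - 1)\<^sup>2 else 1)"
  proof (cases "prime p \<and> p > 2")
    case True
    then have "1 ^ 2 \<le> (real p - 1)\<^sup>2" by (intro power_mono) auto
    then show ?thesis using True by (simp add: divide_le_eq)
  qed simp
qed

lemma singular_series_nonneg:
  assumes "k > 0" shows "singular_series k \<ge> 0"
proof (cases "even k")
  case True
  then obtain n where n: "k = 2 * n" by blast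
  then show ?thesis using assms sing_weight_bounds(1)[of n] twin_prime_const_nonneg
    by (simp add: singular_series_double)
qed (simp add: singular_series_def)

lemma S_sum_sums:
  assumes "x \<ge> 0"
  shows "(\<lambda>k. indicator {real (Suc k)..} x * (x - real (Suc k)) ^ m * singular_series (Suc k)) sums S_sum m x"
proof -
  let ?f = "\<lambda>k. indicator {real (Suc k)..} x * (x - real (Suc k)) ^ m * singular_series (Suc k)"
  let ?A = "{k. real (Suc k) \<le> x}"
  have fin: "finite ?A"
  proof (rule finite_subset[of _ "{..nat \<lceil>x\<rceil>}"])
    show "?A \<subseteq> {..nat \<lceil>x\<rceil>}"
    proof
      fix k assume "k \<in> ?A"
      then have "real k \<le> x" by simp
      then show "k \<in> {..nat \<lceil>x\<rceil>}" by (simp add: le_nat_iff le_ceiling_iff)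
    qed
  qed simp
  have "?f sums (\<Sum>k\<in>?A. ?f k)"
    by (rule sums_finite[OF fin]) (auto simp: indicator_def)
  also have "(\<Sum>k\<in>?A. ?f k) = (\<Sum>k\<in>?A. (x - real (Suc k)) ^ m * singular_series (Suc k))"
    by (intro sum.cong refl) (auto simp: indicator_def)
  also have "\<dots> = S_sum m x"
    unfolding S_sum_def
    by (rule sum.reindex_bij_witness[of _ "\<lambda>k. k - 1" Suc]) auto
  finally show ?thesis .
qed

lemma S_sum_transform:
  assumes s: "\<sigma> > (2::real)"
  shows "has_bochner_integral lborel (\<lambda>x. indicator {1..} x * (S_sum m x * x powr (- real m - 1 - \<sigma>)))
     ((\<Sum>k. singular_series (Suc k) * real (Suc k) powr (- \<sigma>)) * (fact m / pochhammer \<sigma> (Suc m)))"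
    and "summable (\<lambda>k. singular_series (Suc k) * real (Suc k) powr (- \<sigma>))"
proof -
  have "summable (\<lambda>k. norm (of_real (singular_series (Suc k)) * of_nat (Suc k) powr (- of_real \<sigma>) :: complex))"
    by (rule singular_series_Dirichlet(1)) (use s in simp)
  moreover have "norm (of_real (singular_series (Suc k)) * of_nat (Suc k) powr (- of_real \<sigma>) :: complex) = singular_series (Suc k) * real (Suc k) powr (- \<sigma>)" for k
    using singular_series_nonneg[of "Suc k"] by (simp add: norm_mult norm_of_nat_powr del: of_nat_Suc)
  ultimately show sm: "summable (\<lambda>k. singular_series (Suc k) * real (Suc k) powr (- \<sigma>))" by simp
  let ?c = "fact m / pochhammer \<sigma> (Suc m)"
  have c: "?c \<ge> 0" using s by (intro divide_nonneg_nonneg pochhammer_nonneg) auto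
  define g where "g = (\<lambda>k x. singular_series (Suc k) * (indicator {real (Suc k)..} x * ((x - real (Suc k)) ^ m * x powr (- real m - 1 - \<sigma>))))"
  have g0: "g k x \<ge> 0" for k x
    unfolding g_def using singular_series_nonneg[of "Suc k"] by (auto simp: indicator_def)
  have gs: "(\<lambda>k. g k x) sums (indicator {1..} x * (S_sum m x * x powr (- real m - 1 - \<sigma>)))" for x
  proof (cases "x \<ge> 1")
    case True
    from sums_mult2[OF S_sum_sums[of x m], of "x powr (- real m - 1 - \<sigma>)"] True show ?thesis
      by (simp add: g_def mult_ac)
  next
    case False
    then have "g k x = 0" for k by (simp add: g_def)
    then show ?thesis using False by simp
  qed
  have gi: "(\<integral>\<^sup>+x. ennreal (g k x) \<partial>lborel) = ennreal (singular_series (Suc k) * real (Suc k) powr (- \<sigma>) * ?c)" for k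
  proof -
    have "has_bochner_integral lborel (g k) (singular_series (Suc k) * (real (Suc k) powr (- \<sigma>) * fact m / pochhammer \<sigma> (Suc m)))"
      unfolding g_def using s by (intro has_bochner_integral_mult_right has_bochner_integral_beta_tail) auto
    then have "integrable lborel (g k)" "integral\<^sup>L lborel (g k) = singular_series (Suc k) * real (Suc k) powr (- \<sigma>) * ?c"
      by (simp_all add: has_bochner_integral_iff)
    then show ?thesis using g0 by (subst nn_integral_eq_integral) auto
  qed
  have gm [measurable]: "g k \<in> borel_measurable borel" for k unfolding g_def by measurable
  show "has_bochner_integral lborel (\<lambda>x. indicator {1..} x * (S_sum m x * x powr (- real m - 1 - \<sigma>)))
     ((\<Sum>k. singular_series (Suc k) * real (Suc k) powr (- \<sigma>)) * ?c)"
  proof (rule has_bochner_integral_nn_integral)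
    have "(\<lambda>x. indicator {1..} x * (S_sum m x * x powr (- real m - 1 - \<sigma>))) = (\<lambda>x. \<Sum>k. g k x)"
      using gs by (auto simp: sums_iff)
    then show "(\<lambda>x. indicator {1..} x * (S_sum m x * x powr (- real m - 1 - \<sigma>))) \<in> borel_measurable lborel" by simp
    show "AE x in lborel. 0 \<le> indicator {1..} x * (S_sum m x * x powr (- real m - 1 - \<sigma>))"
      using sums_le[OF _ sums_zero gs] g0 by auto
    show "0 \<le> (\<Sum>k. singular_series (Suc k) * real (Suc k) powr (- \<sigma>)) * ?c"
      using singular_series_nonneg by (intro mult_nonneg_nonneg suminf_nonneg sm c) auto
    have "(\<integral>\<^sup>+x. ennreal (indicator {1..} x * (S_sum m x * x powr (- real m - 1 - \<sigma>))) \<partial>lborel) = (\<integral>\<^sup>+x. (\<Sum>k. ennreal (g k x)) \<partial>lborel)"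
      by (intro nn_integral_cong, subst suminf_ennreal_eq[OF g0 gs]) auto
    also have "\<dots> = (\<Sum>k. \<integral>\<^sup>+x. ennreal (g k x) \<partial>lborel)" by (rule nn_integral_suminf) simp
    also have "\<dots> = (\<Sum>k. ennreal (singular_series (Suc k) * real (Suc k) powr (- \<sigma>) * ?c))" by (simp only: gi)
    also have "\<dots> = ennreal (\<Sum>k. singular_series (Suc k) * real (Suc k) powr (- \<sigma>) * ?c)"
      using singular_series_nonneg c by (intro suminf_ennreal2 summable_mult2 sm mult_nonneg_nonneg) auto
    also have "(\<Sum>k. singular_series (Suc k) * real (Suc k) powr (- \<sigma>) * ?c) = (\<Sum>k. singular_series (Suc k) * real (Suc k) powr (- \<sigma>)) * ?c"
      by (rule suminf_mult2[OF sm, symmetric])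
    finally show "(\<integral>\<^sup>+x. ennreal (indicator {1..} x * (S_sum m x * x powr (- real m - 1 - \<sigma>))) \<partial>lborel)
      = ennreal ((\<Sum>k. singular_series (Suc k) * real (Suc k) powr (- \<sigma>)) * ?c)" .
  qed
qed

lemma has_bochner_integral_ln_powr:
  assumes "\<sigma> > (0::real)"
  shows "has_bochner_integral lborel (\<lambda>x. indicator {1..} x * (ln x * x powr (- 1 - \<sigma>))) (1 / \<sigma>\<^sup>2)"
proof (rule has_bochner_integral_nn_integral)
  define F where "F = (\<lambda>x::real. - (ln x * x powr (- \<sigma>)) / \<sigma> - x powr (- \<sigma>) / \<sigma>\<^sup>2)"
  have D: "DERIV F x :> ln x * x powr (- 1 - \<sigma>)" if "1 \<le> x" for x
  proof -
    have p: "((\<lambda>x. x powr (- \<sigma>)) has_real_derivative - \<sigma> * x powr (- \<sigma> - 1)) (at x)"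
      using that by (intro has_real_derivative_powr) auto
    have l: "(ln has_real_derivative 1 / x) (at x)" using that by (intro derivative_eq_intros) (auto simp: inverse_eq_divide)
    have "(F has_real_derivative - (1 / x * x powr (- \<sigma>) + - \<sigma> * x powr (- \<sigma> - 1) * ln x) / \<sigma> - (- \<sigma> * x powr (- \<sigma> - 1)) / \<sigma>\<^sup>2) (at x)"
      unfolding F_def by (intro DERIV_diff DERIV_cdivide DERIV_minus DERIV_mult l p)
    moreover have "- (1 / x * x powr (- \<sigma>) + - \<sigma> * x powr (- \<sigma> - 1) * ln x) / \<sigma> - (- \<sigma> * x powr (- \<sigma> - 1)) / \<sigma>\<^sup>2 = ln x * x powr (- 1 - \<sigma>)"
    proof -
      define y where "y = x powr (- \<sigma> - 1)"
      have "- 1 - \<sigma> = - \<sigma> - 1" by simp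
      then have 1: "x powr (- 1 - \<sigma>) = y" unfolding y_def by (simp only:)
      have 2: "1 / x * x powr (- \<sigma>) = y" using that powr_diff[of x "- \<sigma>" 1] by (simp add: y_def)
      show ?thesis unfolding 1 2 y_def[symmetric] using assms by (simp add: field_simps power2_eq_square)
    qed
    ultimately show ?thesis by (simp only:)
  qed
  have t0: "((\<lambda>x. x powr (- \<sigma>)) \<longlongrightarrow> 0) at_top" using assms by (intro tendsto_neg_powr filterlim_ident) auto
  have t1: "((\<lambda>x. ln x * x powr (- \<sigma>)) \<longlongrightarrow> 0) at_top"
  proof (rule tendsto_sandwich)
    show "eventually (\<lambda>x. 0 \<le> ln x * x powr (- \<sigma>)) at_top"
      using eventually_ge_at_top[of 1] by eventually_elim auto
    show "eventually (\<lambda>x. ln x * x powr (- \<sigma>) \<le> 2 / \<sigma> * x powr (- (\<sigma> / 2))) at_top"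
      using eventually_ge_at_top[of 1]
    proof eventually_elim
      case (elim x)
      have "ln x * x powr (- \<sigma>) \<le> (x powr (\<sigma> / 2) / (\<sigma> / 2)) * x powr (- \<sigma>)"
        using elim assms by (intro mult_right_mono ln_powr_bound) auto
      also have "\<dots> = 2 / \<sigma> * (x powr (\<sigma> / 2) * x powr (- \<sigma>))" by simp
      also have "x powr (\<sigma> / 2) * x powr (- \<sigma>) = x powr (- (\<sigma> / 2))" by (simp flip: powr_add)
      finally show ?case .
    qed
    have "((\<lambda>x. 2 / \<sigma> * x powr (- (\<sigma> / 2))) \<longlongrightarrow> 2 / \<sigma> * 0) at_top"
      using assms by (intro tendsto_intros tendsto_neg_powr filterlim_ident) auto
    then show "((\<lambda>x. 2 / \<sigma> * x powr (- (\<sigma> / 2))) \<longlongrightarrow> 0) at_top" by simp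
  qed auto
  have "(F \<longlongrightarrow> - 0 / \<sigma> - 0 / \<sigma>\<^sup>2) at_top"
    unfolding F_def using assms by (intro tendsto_intros t0 t1) auto
  then have lim: "(F \<longlongrightarrow> 0) at_top" by simp
  have "(\<integral>\<^sup>+x. ennreal (ln x * x powr (- 1 - \<sigma>)) * indicator {1..} x \<partial>lborel) = ennreal (0 - F 1)"
    by (rule nn_integral_FTC_atLeast[OF _ D _ lim]) auto
  also have "0 - F 1 = 1 / \<sigma>\<^sup>2" by (simp add: F_def)
  also have "(\<integral>\<^sup>+x. ennreal (ln x * x powr (- 1 - \<sigma>)) * indicator {1..} x \<partial>lborel)
     = (\<integral>\<^sup>+x. ennreal (indicator {1..} x * (ln x * x powr (- 1 - \<sigma>))) \<partial>lborel)"
    by (intro nn_integral_cong) (auto simp: indicator_def)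
  finally show "(\<integral>\<^sup>+x. ennreal (indicator {1..} x * (ln x * x powr (- 1 - \<sigma>))) \<partial>lborel) = ennreal (1 / \<sigma>\<^sup>2)" .
qed (auto simp: indicator_def)

text \<open>The constant in the secondary main term \<open>- x\<^sup>m (log x + \<kappa>) / 2\<close>.\<close>

definition err_kappa :: "nat \<Rightarrow> real" where
  "err_kappa m = - harm m + euler_mascheroni + ln (2 * pi)"

lemma E_err_transform:
  assumes s: "\<sigma> > (2::real)"
  shows "has_bochner_integral lborel (\<lambda>x. indicator {1..} x * (E_err m x * x powr (- real m - 1) * x powr (- \<sigma>)))
     ((\<Sum>k. singular_series (Suc k) * real (Suc k) powr (- \<sigma>)) * (fact m / pochhammer \<sigma> (Suc m))
       - 1 / (real m + 1) * (1 / (\<sigma> - 1)) + 1 / 2 * (1 / \<sigma>\<^sup>2) + err_kappa m / 2 * (1 / \<sigma>))"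
proof -
  have p1: "has_bochner_integral lborel (\<lambda>x. indicator {1..} x * x powr (- \<sigma>)) (1 / (\<sigma> - 1))"
    using has_bochner_integral_powr_atLeast[of "- \<sigma>" 1] s by simp
  have p2: "has_bochner_integral lborel (\<lambda>x. indicator {1..} x * x powr (- 1 - \<sigma>)) (1 / \<sigma>)"
    using has_bochner_integral_powr_atLeast[of "- 1 - \<sigma>" 1] s by simp
  have "has_bochner_integral lborel (\<lambda>x. indicator {1..} x * (S_sum m x * x powr (- real m - 1 - \<sigma>))
       - 1 / (real m + 1) * (indicator {1..} x * x powr (- \<sigma>)) + 1 / 2 * (indicator {1..} x * (ln x * x powr (- 1 - \<sigma>)))
       + err_kappa m / 2 * (indicator {1..} x * x powr (- 1 - \<sigma>)))
     ((\<Sum>k. singular_series (Suc k) * real (Suc k) powr (- \<sigma>)) * (fact m / pochhammer \<sigma> (Suc m))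
       - 1 / (real m + 1) * (1 / (\<sigma> - 1)) + 1 / 2 * (1 / \<sigma>\<^sup>2) + err_kappa m / 2 * (1 / \<sigma>))"
    using s by (intro has_bochner_integral_add has_bochner_integral_diff has_bochner_integral_mult_right p1 p2
       has_bochner_integral_ln_powr S_sum_transform(1)) auto
  moreover have "indicator {1..} x * (S_sum m x * x powr (- real m - 1 - \<sigma>))
       - 1 / (real m + 1) * (indicator {1..} x * x powr (- \<sigma>)) + 1 / 2 * (indicator {1..} x * (ln x * x powr (- 1 - \<sigma>)))
       + err_kappa m / 2 * (indicator {1..} x * x powr (- 1 - \<sigma>))
     = indicator {1..} x * (E_err m x * x powr (- real m - 1) * x powr (- \<sigma>))" for x
  proof (cases "x \<ge> 1")
    case True
    define y where "y = x powr (- real m - 1 - \<sigma>)"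
    have e1: "x powr (- real m - 1) * x powr (- \<sigma>) = y" by (simp add: y_def flip: powr_add)
    have e2: "x powr (- \<sigma>) = x ^ (m + 1) * y"
    proof -
      have "x ^ (m + 1) * y = x powr real (m + 1) * y" using True by (subst powr_realpow) auto
      also have "\<dots> = x powr (- \<sigma>)" unfolding y_def by (simp flip: powr_add)
      finally show ?thesis ..
    qed
    have e3: "x powr (- 1 - \<sigma>) = x ^ m * y"
    proof -
      have "x ^ m * y = x powr real m * y" using True by (subst powr_realpow) auto
      also have "\<dots> = x powr (- 1 - \<sigma>)" unfolding y_def by (simp flip: powr_add)
      finally show ?thesis ..
    qed
    have "E_err m x * x powr (- real m - 1) * x powr (- \<sigma>) = E_err m x * y" by (simp only: mult.assoc e1)
    moreover have "S_sum m x * y - 1 / (real m + 1) * (x ^ (m + 1) * y) + 1 / 2 * (ln x * (x ^ m * y)) + err_kappa m / 2 * (x ^ m * y) = E_err m x * y"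
      unfolding E_err_def err_kappa_def by (simp add: field_simps)
    ultimately show ?thesis using True e3 e2 by (simp add: y_def)
  qed simp
  ultimately show ?thesis by simp
qed

lemma S_sum_measurable [measurable]: "(\<lambda>x. indicator {1..} x * S_sum m x) \<in> borel_measurable borel"
proof -
  have "(\<lambda>x::real. indicator {1..} x * S_sum m x) = (\<lambda>x. \<Sum>k. indicator {1..} x * (indicator {real (Suc k)..} x * (x - real (Suc k)) ^ m * singular_series (Suc k)))"
  proof
    fix x :: real
    show "indicator {1..} x * S_sum m x = (\<Sum>k. indicator {1..} x * (indicator {real (Suc k)..} x * (x - real (Suc k)) ^ m * singular_series (Suc k)))"
    proof (cases "x \<ge> 1")
      case True
      then show ?thesis using S_sum_sums[of x m] by (simp add: sums_iff)
    qed simp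
  qed
  then show ?thesis by simp
qed

section \<open>Continuation of the transform\<close>

lemma holomorphic_factor:
  assumes "f holomorphic_on S" "open S" "f a = (0::complex)"
  obtains g where "g holomorphic_on S" "g a = deriv f a" "\<And>z. f z = (z - a) * g z"
proof
  let ?g = "\<lambda>z. if z = a then deriv f a else (f z - f a) / (z - a)"
  show "?g holomorphic_on S" by (rule pole_lemma_open[OF assms(1,2)])
  show "f z = (z - a) * ?g z" for z using assms(3) by simp
qed simp

lemma holomorphic_halfplane_isCont: "f holomorphic_on {s. a < Re s} \<Longrightarrow> a < Re z \<Longrightarrow> isCont f z"
  by (intro field_differentiable_imp_continuous_at holomorphic_on_imp_differentiable_at[OF _ open_halfspace_Re_gt]) auto

lemma of_nat_plus_1_nonzero: "of_nat m + 1 \<noteq> (0::complex)"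
  by (metis of_nat_Suc of_nat_neq_0 add.commute)

lemma deriv_pochhammer_Suc_0:
  "((\<lambda>s. pochhammer (s + 1) m) has_field_derivative (fact m * of_real (harm m) :: complex)) (at 0)"
proof (induction m)
  case (Suc m)
  have "((\<lambda>s. pochhammer (s + 1) m * (s + (1 + of_nat m))) has_field_derivative
      fact m * of_real (harm m) * (0 + (1 + of_nat m)) + 1 * pochhammer (0 + 1) m) (at (0::complex))"
    by (rule DERIV_mult[OF Suc]) (auto intro!: derivative_eq_intros)
  moreover have "(\<lambda>s::complex. pochhammer (s + 1) m * (s + (1 + of_nat m))) = (\<lambda>s. pochhammer (s + 1) (Suc m))"
    by (simp add: pochhammer_Suc add.assoc)
  moreover have "fact m * of_real (harm m) * (0 + (1 + of_nat m)) + 1 * pochhammer (0 + 1) m = (fact (Suc m) * of_real (harm (Suc m)) :: complex)"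
  proof -
    have "complex_of_real (harm (Suc m)) = of_real (harm m) + inverse (1 + of_nat m)"
      by (simp add: harm_Suc)
    moreover have "(1 + of_nat m) * inverse (1 + of_nat m) = (1::complex)"
      using of_nat_neq_0[of m, where ?'a = complex] by (intro right_inverse) simp
    moreover have "pochhammer (0 + 1) m = (fact m :: complex)" by (simp add: pochhammer_fact)
    moreover have "fact (Suc m) = (fact m * (1 + of_nat m) :: complex)" by (simp add: mult.commute)
    ultimately show ?thesis by (simp only:) algebra
  qed
  ultimately show ?case by (simp only:)
qed (auto simp: harm_def)

lemma pochhammer_holomorphic [holomorphic_intros]:
  "f holomorphic_on A \<Longrightarrow> (\<lambda>s. pochhammer (f s) m :: complex) holomorphic_on A"
  by (induction m) (auto simp: pochhammer_Suc intro!: holomorphic_intros)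

lemma pochhammer_Suc_nonzero:
  assumes "Re s > -1"
  shows "pochhammer (s + 1) m \<noteq> 0"
proof
  assume "pochhammer (s + 1) m = 0"
  then obtain k where "s + 1 = - of_nat k" by (auto simp: pochhammer_eq_0_iff)
  then have "Re (s + 1) = Re (- of_nat k)" by simp
  then show False using assms by simp
qed

text \<open>Minus the transform of the main term, multiplied by \<open>(s - 1) s\<^sup>2\<close>.\<close>

definition err_poly :: "nat \<Rightarrow> complex \<Rightarrow> complex" where
  "err_poly m s = - s\<^sup>2 / (of_nat m + 1) + (s - 1) * (1 + of_real (err_kappa m) * s) / 2"

text \<open>The part of the transform coming from the Dirichlet series, multiplied by
\<open>(s - 1) s\<^sup>2 (s + 1) \<dots> (s + m)\<close> and \<open>(2s + 1) \<zeta>(2s + 2)\<close>. All its factors are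
holomorphic for \<open>Re s > -1\<close>.\<close>

definition err_num :: "nat \<Rightarrow> (complex \<Rightarrow> complex) \<Rightarrow> complex \<Rightarrow> complex" where
  "err_num m K s = of_real (2 * twin_prime_const * fact m) * zeta1 s * zeta1 (s + 1) * ((2 * s + 1) * 2 powr (- s) * (1 + 5 powr (- s) / 3) * K s)"

text \<open>Multiplied by \<open>(s - 1) s\<^sup>2\<close>, the transform is a function \<open>N\<close> that is holomorphic wherever
\<open>\<zeta>(2s+2)\<close> does not vanish. Dividing again is possible because \<open>N\<close> has a zero at \<open>1\<close> and a double
zero at \<open>0\<close>: the term \<open>x\<^bsup>m+1\<^esup>/(m+1)\<close> cancels the residue at \<open>1\<close>, and the terms of order \<open>x\<^sup>m\<close>
cancel the double pole at \<open>0\<close>, where the harmonic number comes from the Pochhammer factor, Euler's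
constant from \<open>\<zeta>\<close> near \<open>1\<close>, and \<open>ln (2\<pi>)\<close> from \<open>\<zeta>'(0)\<close>.\<close>

lemma E_err_continuation:
  obtains K \<Psi> where "K holomorphic_on {s. Re s > -1}" "\<And>s. -3/4 \<le> Re s \<Longrightarrow> Re s \<le> -1/2 \<Longrightarrow> K s \<noteq> 0"
    "\<Psi> holomorphic_on {s. Re s > -1} \<inter> {s. zeta1 (2 * s + 2) \<noteq> 0}"
    "\<And>s. Re s > -1 \<Longrightarrow> zeta1 (2 * s + 2) \<noteq> 0 \<Longrightarrow>
       \<Psi> s * ((s - 1) * s\<^sup>2 * pochhammer (s + 1) m * zeta1 (2 * s + 2)) = err_num m K s + pochhammer (s + 1) m * zeta1 (2 * s + 2) * err_poly m s"
    "\<And>\<sigma>. \<sigma> > 2 \<Longrightarrow> \<Psi> (of_real \<sigma>) = of_real (LINT x|lborel. indicator {1..} x * (E_err m x * x powr (- real m - 1) * x powr (- \<sigma>)))"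
proof -
  note witness = that
  obtain K where K: "K holomorphic_on {s. Re s > -1}" "\<And>s. Re s > -1 \<Longrightarrow> (\<lambda>N. \<Prod>p<N. sing_factor' p s) \<longlonglongrightarrow> K s"
    "\<And>s. Re s > -1 \<Longrightarrow> K s = 0 \<longleftrightarrow> (\<exists>p. sing_factor' p s = 0)"
    using sing_factor'_product by blast
  obtain L where L: "L holomorphic_on {s. Re s > -1/2}" "\<And>s. Re s > -1/2 \<Longrightarrow> (\<lambda>N. \<Prod>p<N. sing_factor p s) \<longlonglongrightarrow> L s"
    "\<And>s. Re s > -1/2 \<Longrightarrow> (\<lambda>N. deriv (\<lambda>z. \<Prod>p<N. sing_factor p z) s) \<longlonglongrightarrow> deriv L s"
    using sing_factor_product by blast
  have K0: "K s \<noteq> 0" if "-3/4 \<le> Re s" "Re s \<le> -1/2" for s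
    using K(3)[of s] sing_factor'_nonzero[OF that] that by auto
  have LK: "L s * zeta1 (2 * s + 2) = (2 * s + 1) * 2 powr (- s) * (1 + 5 powr (- s) / 3) * K s" if s: "Re s > -1/2" for s
  proof -
    let ?c = "2 powr (- s) * (1 + 5 powr (- s) / 3)"
    have Z: "(\<lambda>N. \<Prod>p<N. inverse (prime_factor_powr (2 * s + 2) p)) \<longlonglongrightarrow> zeta1 (2 * s + 2) / (2 * s + 2 - 1)"
      by (rule zeta_Euler_product) (use s in simp)
    have nz: "prime_factor_powr (2 * s + 2) p \<noteq> 0" for p
      using norm_prime_powr_less_1[of p "- (2 * s + 2)"] s
      by (auto simp: prime_factor_powr_def)
    have "(\<lambda>N. (\<Prod>p<N. sing_factor p s) * (\<Prod>p<N. inverse (prime_factor_powr (2 * s + 2) p))) \<longlonglongrightarrow> L s * (zeta1 (2 * s + 2) / (2 * s + 2 - 1))"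
      by (intro tendsto_mult L(2) Z s)
    moreover have "eventually (\<lambda>N. (\<Prod>p<N. sing_factor p s) * (\<Prod>p<N. inverse (prime_factor_powr (2 * s + 2) p)) = ?c * (\<Prod>p<N. sing_factor' p s)) sequentially"
      using eventually_gt_at_top[of 5]
    proof eventually_elim
      case (elim N)
      have "(\<Prod>p<N. prime_factor_powr (2 * s + 2) p) * (\<Prod>p<N. inverse (prime_factor_powr (2 * s + 2) p)) = 1"
        using nz by (simp flip: prod.distrib)
      then show ?case unfolding sing_factor_eq[OF s elim] by (simp add: mult.assoc)
    qed
    ultimately have "(\<lambda>N. ?c * (\<Prod>p<N. sing_factor' p s)) \<longlonglongrightarrow> L s * (zeta1 (2 * s + 2) / (2 * s + 2 - 1))"
      by (rule Lim_transform_eventually)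
    moreover have "(\<lambda>N. ?c * (\<Prod>p<N. sing_factor' p s)) \<longlonglongrightarrow> ?c * K s"
      using s by (intro tendsto_mult_left K(2)) auto
    ultimately have eq: "L s * (zeta1 (2 * s + 2) / (2 * s + 2 - 1)) = ?c * K s" by (rule LIMSEQ_unique)
    have "2 * s + 1 \<noteq> 0"
    proof
      assume "2 * s + 1 = 0"
      then have "Re (2 * s + 1) = 0" by (simp only: zero_complex.sel)
      then show False using s by simp
    qed
    moreover have "2 * s + 2 - 1 = 2 * s + 1" by simp
    ultimately have "L s * zeta1 (2 * s + 2) = (2 * s + 1) * (L s * (zeta1 (2 * s + 2) / (2 * s + 2 - 1)))"
      by (simp only: times_divide_eq_right nonzero_mult_div_cancel_left not_False_eq_True)
    then show ?thesis unfolding eq by (simp add: mult_ac)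
  qed
  define P where "P = (\<lambda>s::complex. pochhammer (s + 1) m)"
  define c where "c = complex_of_real (2 * twin_prime_const * fact m)"
  define U where "U = {s. Re s > -1} \<inter> {s. zeta1 (2 * s + 2) \<noteq> 0}"
  (* N is (s - 1) s^2 times the transform *)
  define N where "N = (\<lambda>s. err_num m K s / (P s * zeta1 (2 * s + 2)) + err_poly m s)"
  have Z_hol: "(\<lambda>s. zeta1 (2 * s + 2)) holomorphic_on {s. Re s > -1}"
    by (rule holomorphic_on_compose_gen[OF _ zeta1_holomorphic, unfolded o_def]) (auto intro!: holomorphic_intros)
  have z1_hol: "(\<lambda>s. zeta1 (s + 1)) holomorphic_on {s. Re s > -1}"
    by (rule holomorphic_on_compose_gen[OF _ zeta1_holomorphic, unfolded o_def]) (auto intro!: holomorphic_intros)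
  have U: "open U"
  proof -
    have "open ({s. Re s > -1} \<inter> (\<lambda>s. zeta1 (2 * s + 2)) -` (- {0}))"
      by (intro continuous_open_preimage holomorphic_on_imp_continuous_on[OF Z_hol] open_halfspace_Re_gt) auto
    then show ?thesis by (simp add: U_def vimage_def)
  qed
  have P0: "P s \<noteq> 0" if "Re s > -1" for s unfolding P_def by (rule pochhammer_Suc_nonzero[OF that])
  have num_hol: "err_num m K holomorphic_on {s. Re s > -1}"
    unfolding err_num_def by (intro holomorphic_intros K(1) z1_hol zeta1_holomorphic) auto
  have P_hol: "P holomorphic_on A" for A unfolding P_def by (intro holomorphic_intros)
  have N_hol: "N holomorphic_on U"
    unfolding N_def err_poly_def
    by (intro holomorphic_intros holomorphic_on_subset[OF num_hol] P_hol holomorphic_on_subset[OF Z_hol])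
       (use P0 in \<open>auto simp: U_def\<close>)
  have Ugt: "s \<in> U" if "Re s > -1/2" for s
    using zeta1_nonzero[of "2 * s + 2"] that by (simp add: U_def)
  have N_eq: "N s = c * zeta1 s * zeta1 (s + 1) * L s / P s + err_poly m s" if s: "Re s > -1/2" for s
  proof -
    have "zeta1 (2 * s + 2) \<noteq> 0" using Ugt[OF s] by (simp add: U_def)
    moreover have "err_num m K s = c * zeta1 s * zeta1 (s + 1) * L s * zeta1 (2 * s + 2)"
      unfolding err_num_def LK[OF s, symmetric] by (simp add: c_def mult_ac)
    ultimately show ?thesis by (simp add: N_def)
  qed
  have L01: "of_real (2 * twin_prime_const) * L 0 = 1" "of_real (2 * twin_prime_const) * zeta1 2 * L 1 = 1"
    using sing_factor_product_0_1[OF L(2)[of 0] L(2)[of 1]] by simp_all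
  have c_eq: "c = of_real (2 * twin_prime_const) * fact m" by (simp add: c_def)
  have cL: "c * L 0 = fact m" "c * zeta1 2 * L 1 = fact m"
    unfolding c_eq using L01 by algebra+
  have P0_eq: "P 0 = fact m" by (simp add: P_def pochhammer_fact)
  have N0: "N 0 = 0"
  proof -
    have "c * zeta1 0 * zeta1 (0 + 1) * L 0 = fact m / 2" using cL(1) by (simp add: zeta1_0 zeta1_1)
    then show ?thesis using N_eq[of 0] by (simp add: P0_eq err_poly_def)
  qed
  have N1: "N 1 = 0"
  proof -
    have "c * zeta1 1 * zeta1 (1 + 1) * L 1 = fact m" using cL(2) by (simp add: zeta1_1)
    moreover have "P 1 = fact m * (of_nat m + 1)"
    proof -
      have "pochhammer (1::complex) (Suc m) = 1 * pochhammer (1 + 1) m" by (rule pochhammer_rec)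
      then show ?thesis by (simp add: P_def flip: pochhammer_fact) (simp add: pochhammer_fact algebra_simps)
    qed
    moreover have "of_nat m + 1 \<noteq> (0::complex)" by (rule of_nat_plus_1_nonzero)
    ultimately have "N 1 = fact m / (fact m * (of_nat m + 1)) + (- 1\<^sup>2 / (of_nat m + 1) + (1 - 1) * (1 + of_real (err_kappa m) * 1) / 2)"
      using N_eq[of 1] by (simp only: err_poly_def) simp
    also have "\<dots> = 0" by simp
    finally show ?thesis .
  qed
  have dN0: "deriv N 0 = 0"
  proof (rule DERIV_imp_deriv)
    let ?g = "complex_of_real euler_mascheroni" and ?l = "complex_of_real (ln (2 * pi))" and ?h = "complex_of_real (harm m)"
    have dz: "(zeta1 has_field_derivative deriv zeta1 s) (at s)" if "Re s > -1" for s
      using zeta1_holomorphic that by (intro holomorphic_derivI[of _ "{s. Re s > -1}"] open_halfspace_Re_gt) auto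
    have z0: "(zeta1 has_field_derivative (?l - 1) / 2) (at 0)"
      using dz[of 0] by (simp add: deriv_zeta1_0)
    have z1: "((\<lambda>s. zeta1 (s + 1)) has_field_derivative ?g * 1) (at 0)"
      using dz[of 1] unfolding deriv_zeta1_1 by (intro DERIV_chain2[where f = zeta1]) (auto intro!: derivative_eq_intros)
    have l0: "(L has_field_derivative 0) (at 0)"
    proof -
      have "deriv L 0 = 0"
        using L(3)[of 0] DERIV_imp_deriv[OF deriv_sing_factor_product_0] LIMSEQ_unique[OF _ tendsto_const] by simp
      then show ?thesis using holomorphic_derivI[OF L(1) open_halfspace_Re_gt, of 0] by simp
    qed
    have p0: "(P has_field_derivative fact m * ?h) (at 0)"
      unfolding P_def by (rule deriv_pochhammer_Suc_0)
    have r0: "(err_poly m has_field_derivative (1 - of_real (err_kappa m)) / 2) (at 0)"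
      unfolding err_poly_def using of_nat_plus_1_nonzero[of m] by (auto intro!: derivative_eq_intros)
    have q: "((\<lambda>s. c * zeta1 s * zeta1 (s + 1) * L s) has_field_derivative
        (((0 * zeta1 0 + (?l - 1) / 2 * c) * zeta1 (0 + 1) + ?g * 1 * (c * zeta1 0)) * L 0 + 0 * (c * zeta1 0 * zeta1 (0 + 1)))) (at 0)"
      by (intro DERIV_mult z0 z1 l0 DERIV_const)
    have qv: "((0 * zeta1 0 + (?l - 1) / 2 * c) * zeta1 (0 + 1) + ?g * 1 * (c * zeta1 0)) * L 0 + 0 * (c * zeta1 0 * zeta1 (0 + 1)) = fact m * (?l - 1 + ?g) / 2"
    proof -
      have "((0 * zeta1 0 + (?l - 1) / 2 * c) * zeta1 (0 + 1) + ?g * 1 * (c * zeta1 0)) * L 0 + 0 * (c * zeta1 0 * zeta1 (0 + 1)) = (c * L 0) * (?l - 1 + ?g) / 2"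
        by (simp add: zeta1_0 zeta1_1 field_simps)
      then show ?thesis unfolding cL(1) .
    qed
    have q0: "c * zeta1 0 * zeta1 (0 + 1) * L 0 = fact m / 2" using cL(1) by (simp add: zeta1_0 zeta1_1)
    have "((\<lambda>s. c * zeta1 s * zeta1 (s + 1) * L s / P s + err_poly m s) has_field_derivative
        (fact m * (?l - 1 + ?g) / 2 * P 0 - c * zeta1 0 * zeta1 (0 + 1) * L 0 * (fact m * ?h)) / (P 0 * P 0) + (1 - of_real (err_kappa m)) / 2) (at 0)"
      by (intro DERIV_add DERIV_divide q[unfolded qv] p0 r0) (use P0[of 0] in auto)
    moreover have "(fact m * (?l - 1 + ?g) / 2 * P 0 - c * zeta1 0 * zeta1 (0 + 1) * L 0 * (fact m * ?h)) / (P 0 * P 0) + (1 - of_real (err_kappa m)) / 2 = 0"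
      unfolding q0 P0_eq err_kappa_def by (simp add: field_simps)
    ultimately have D: "((\<lambda>s. c * zeta1 s * zeta1 (s + 1) * L s / P s + err_poly m s) has_field_derivative 0) (at 0)" by (simp only:)
    show "(N has_field_derivative 0) (at 0)"
      by (rule has_field_derivative_transform_within_open[OF D open_halfspace_Re_gt[of "-1/2"]]) (use N_eq in auto)
  qed
  obtain g1 where g1: "g1 holomorphic_on U" "g1 0 = deriv N 0" "\<And>z. N z = (z - 0) * g1 z"
    using holomorphic_factor[OF N_hol U N0] by blast
  obtain g2 where g2: "g2 holomorphic_on U" "\<And>z. g1 z = (z - 0) * g2 z"
    using holomorphic_factor[OF g1(1) U] g1(2) dN0 by metis
  have g21: "g2 1 = 0" using N1 g1(3)[of 1] g2(2)[of 1] by simp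
  obtain \<Psi> where \<Psi>: "\<Psi> holomorphic_on U" "\<And>z. g2 z = (z - 1) * \<Psi> z"
    using holomorphic_factor[OF g2(1) U g21] by metis
  have N\<Psi>: "N s = \<Psi> s * ((s - 1) * s\<^sup>2)" for s
    unfolding g1(3)[of s] g2(2)[of s] \<Psi>(2)[of s] by (simp add: power2_eq_square)
  show ?thesis
  proof (rule witness[OF K(1) K0])
    show "\<Psi> holomorphic_on {s. Re s > -1} \<inter> {s. zeta1 (2 * s + 2) \<noteq> 0}" using \<Psi>(1) unfolding U_def .
    show "\<Psi> s * ((s - 1) * s\<^sup>2 * pochhammer (s + 1) m * zeta1 (2 * s + 2)) = err_num m K s + pochhammer (s + 1) m * zeta1 (2 * s + 2) * err_poly m s"
      if "Re s > -1" "zeta1 (2 * s + 2) \<noteq> 0" for s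
    proof -
      have "\<Psi> s * ((s - 1) * s\<^sup>2 * pochhammer (s + 1) m * zeta1 (2 * s + 2)) = N s * (P s * zeta1 (2 * s + 2))"
        unfolding N\<Psi> P_def by (simp add: mult_ac)
      also have "\<dots> = err_num m K s + P s * zeta1 (2 * s + 2) * err_poly m s"
      proof -
        define W where "W = P s * zeta1 (2 * s + 2)"
        have "W \<noteq> 0" using P0[OF that(1)] that(2) by (simp add: W_def)
        then have "(err_num m K s / W + err_poly m s) * W = err_num m K s + W * err_poly m s"
          by (simp add: field_simps)
        then show ?thesis unfolding N_def W_def .
      qed
      finally show ?thesis by (simp add: P_def)
    qed
    fix \<sigma> :: real assume \<sigma>: "\<sigma> > 2"
    define T where "T = (\<Sum>k. singular_series (Suc k) * real (Suc k) powr (- \<sigma>))"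
    define R where "R = T * (fact m / pochhammer \<sigma> (Suc m))
       - 1 / (real m + 1) * (1 / (\<sigma> - 1)) + 1 / 2 * (1 / \<sigma>\<^sup>2) + err_kappa m / 2 * (1 / \<sigma>)"
    have LI: "(LINT x|lborel. indicator {1..} x * (E_err m x * x powr (- real m - 1) * x powr (- \<sigma>))) = R"
      using E_err_transform[OF \<sigma>, of m] by (simp add: has_bochner_integral_iff R_def T_def)
    let ?s = "complex_of_real \<sigma>"
    have s1: "?s - 1 \<noteq> 0" "?s \<noteq> 0" using \<sigma> by auto
    have T: "of_real T = of_real (2 * twin_prime_const) * (zeta1 ?s / (?s - 1) * (zeta1 (?s + 1) / ?s) * L ?s)"
    proof -
      have "of_real T = (\<Sum>k. complex_of_real (singular_series (Suc k) * real (Suc k) powr (- \<sigma>)))"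
        unfolding T_def by (rule suminf_of_real[OF S_sum_transform(2)[OF \<sigma>]])
      also have "\<dots> = (\<Sum>k. of_real (singular_series (Suc k)) * of_nat (Suc k) powr (- ?s))"
      proof (intro suminf_cong)
        fix k
        have "of_nat (Suc k) powr (- ?s) = complex_of_real (real (Suc k) powr (- \<sigma>))"
          using powr_of_real[of "real (Suc k)" "- \<sigma>"] by (simp del: of_nat_Suc)
        then show "complex_of_real (singular_series (Suc k) * real (Suc k) powr (- \<sigma>)) = of_real (singular_series (Suc k)) * of_nat (Suc k) powr (- ?s)"
          by (simp only: of_real_mult)
      qed
      also have "\<dots> = of_real (2 * twin_prime_const) * (2 powr (- ?s) * (\<Sum>n. of_real (sing_weight (Suc n)) * of_nat (Suc n) powr (- ?s)))"
        by (subst singular_series_Dirichlet(2)) (use \<sigma> in \<open>auto simp: mult.assoc\<close>)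
      also have "2 powr (- ?s) * (\<Sum>n. of_real (sing_weight (Suc n)) * of_nat (Suc n) powr (- ?s)) = zeta1 ?s / (?s - 1) * (zeta1 (?s + 1) / ?s) * L ?s"
        by (rule sing_weight_Euler) (use \<sigma> L(2) in auto)
      finally show ?thesis .
    qed
    have m1: "of_nat m + 1 \<noteq> (0::complex)" by (rule of_nat_plus_1_nonzero)
    have p: "of_real (pochhammer \<sigma> (Suc m)) = ?s * P ?s"
      by (simp add: P_def pochhammer_rec flip: pochhammer_of_real)
    have "of_real R = of_real T * (fact m / (?s * P ?s)) - 1 / (of_nat m + 1) * (1 / (?s - 1)) + 1 / 2 * (1 / ?s\<^sup>2) + of_real (err_kappa m) / 2 * (1 / ?s)"
      unfolding R_def by (simp flip: p)
    also have "\<dots> = c * zeta1 ?s * zeta1 (?s + 1) * L ?s / (P ?s * ((?s - 1) * ?s\<^sup>2)) - 1 / (of_nat m + 1) * (1 / (?s - 1)) + 1 / 2 * (1 / ?s\<^sup>2) + of_real (err_kappa m) / 2 * (1 / ?s)"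
      unfolding T c_eq by (simp add: power2_eq_square mult_ac)
    finally have R: "of_real R = c * zeta1 ?s * zeta1 (?s + 1) * L ?s / (P ?s * ((?s - 1) * ?s\<^sup>2)) - 1 / (of_nat m + 1) * (1 / (?s - 1)) + 1 / 2 * (1 / ?s\<^sup>2) + of_real (err_kappa m) / 2 * (1 / ?s)" .
    have "\<Psi> ?s = N ?s / ((?s - 1) * ?s\<^sup>2)" unfolding N\<Psi> using s1 by simp
    also have "\<dots> = c * zeta1 ?s * zeta1 (?s + 1) * L ?s / (P ?s * ((?s - 1) * ?s\<^sup>2)) + err_poly m ?s / ((?s - 1) * ?s\<^sup>2)"
      using N_eq[of ?s] \<sigma> by (simp add: add_divide_distrib)
    also have "err_poly m ?s / ((?s - 1) * ?s\<^sup>2) = - 1 / (of_nat m + 1) * (1 / (?s - 1)) + 1 / 2 * (1 / ?s\<^sup>2) + of_real (err_kappa m) / 2 * (1 / ?s)"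
    proof -
      have "(err_poly m w) / ((w - 1) * w\<^sup>2) = - 1 / n * (1 / (w - 1)) + 1 / 2 * (1 / w\<^sup>2) + k / 2 * (1 / w)"
        if "w - 1 \<noteq> 0" "w \<noteq> 0" "n \<noteq> 0" "n = of_nat m + 1" "k = of_real (err_kappa m)" for w n k
        unfolding err_poly_def that(4)[symmetric] that(5)[symmetric] using that(1-3)
        by (simp add: divide_simps power2_eq_square) algebra
      from this[OF s1 m1 refl refl] show ?thesis .
    qed
    finally show "\<Psi> ?s = of_real (LINT x|lborel. indicator {1..} x * (E_err m x * x powr (- real m - 1) * x powr (- \<sigma>)))"
      unfolding LI R by simp
  qed
qed

section \<open>Oscillation of the error term\<close>

lemma S_sum_nonneg: "S_sum m x \<ge> 0"
  unfolding S_sum_def using singular_series_nonneg by (intro sum_nonneg mult_nonneg_nonneg) auto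

lemma S_sum_mono:
  assumes "x \<le> y"
  shows "S_sum m x \<le> S_sum m y"
proof -
  have fin: "finite {k. 1 \<le> k \<and> real k \<le> y}"
    by (rule finite_subset[of _ "{..nat \<lceil>y\<rceil>}"]) (auto simp: le_nat_iff le_ceiling_iff)
  have "S_sum m x \<le> (\<Sum>k | 1 \<le> k \<and> real k \<le> x. (y - real k) ^ m * singular_series k)"
    unfolding S_sum_def using assms singular_series_nonneg by (intro sum_mono mult_right_mono power_mono) auto
  also have "\<dots> \<le> S_sum m y"
    unfolding S_sum_def using assms singular_series_nonneg by (intro sum_mono2 fin) auto
  finally show ?thesis .
qed

lemma E_err_bounded: "\<exists>B. \<forall>x\<in>{1..X}. \<bar>E_err m x * x powr (- real m - 1)\<bar> \<le> B"
proof -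
  let ?p = "\<lambda>x. x ^ (m + 1) / (real m + 1) - x ^ m / 2 * (ln x - harm m + euler_mascheroni + ln (2 * pi))"
  have "compact (?p ` {1..X})"
    by (intro compact_continuous_image continuous_intros) auto
  then obtain B where B: "\<And>x. x \<in> {1..X} \<Longrightarrow> \<bar>?p x\<bar> \<le> B"
  proof -
    from \<open>compact (?p ` {1..X})\<close> have "bounded (?p ` {1..X})" by (rule compact_imp_bounded)
    then obtain B where "\<forall>y\<in>?p ` {1..X}. norm y \<le> B" unfolding bounded_iff ..
    then show ?thesis using that[of B] by (simp only: ball_simps real_norm_def)
  qed
  have "\<bar>E_err m x * x powr (- real m - 1)\<bar> \<le> S_sum m X + B" if x: "x \<in> {1..X}" for x
  proof -
    have "\<bar>E_err m x\<bar> \<le> S_sum m X + B"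
      using S_sum_nonneg[of m x] S_sum_mono[of x X m] B[OF x] x unfolding E_err_def by auto
    moreover have "x powr (- real m - 1) \<le> 1"
    proof -
      have "x powr (- real m - 1) \<le> x powr 0" using x by (intro powr_mono) auto
      then show ?thesis using x by simp
    qed
    ultimately have "\<bar>E_err m x\<bar> * x powr (- real m - 1) \<le> (S_sum m X + B) * 1"
      by (intro mult_mono) auto
    then show ?thesis by (simp add: abs_mult)
  qed
  then show ?thesis by blast
qed

lemma E_err_measurable [measurable]: "(\<lambda>x. indicator {1..} x * E_err m x) \<in> borel_measurable borel"
proof -
  have "(\<lambda>x::real. indicator {1..} x * E_err m x) = (\<lambda>x. indicator {1..} x * S_sum m x - indicator {1..} x *
      (x ^ (m + 1) / (real m + 1) - x ^ m / 2 * (ln x - harm m + euler_mascheroni + ln (2 * pi))))"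
    by (simp add: E_err_def right_diff_distrib)
  then show ?thesis by simp
qed

lemma filterlim_add_of_real_at_right:
  "filterlim (\<lambda>h. z + complex_of_real h) (at z) (at_right 0)"
proof -
  have "((\<lambda>h. z + complex_of_real h) \<longlongrightarrow> z + of_real 0) (at_right 0)" by (intro tendsto_intros)
  moreover have "eventually (\<lambda>h. z + complex_of_real h \<noteq> z) (at_right 0)"
    by (auto simp: eventually_at_filter)
  ultimately show ?thesis by (simp add: filterlim_at)
qed

text \<open>The Gamma factor and the power of \<open>\<pi>\<close> relating the two functions have no zeros there.\<close>

lemma xi_order_imp_zeta1_order:
  assumes "has_order xi z n" "Re z > -1"
  shows "has_order zeta1 z n"
proof -
  define H where "H = (\<lambda>s. complex_of_real pi powr (s / 2) * rGamma (s / 2 + 1))"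
  have "H holomorphic_on UNIV"
    unfolding H_def by (intro holomorphic_intros) auto
  then have "isCont H z"
    using holomorphic_on_imp_continuous_on continuous_on_eq_continuous_at[OF open_UNIV] by blast
  moreover have "H z \<noteq> 0"
    using half_plus_1_not_nonpos_Int[of z] assms(2) by (simp add: H_def rGamma_eq_zero_iff)
  ultimately have "has_order H z 0" by (rule has_order_nonzero)
  from has_order_mult[OF assms(1) this] have o: "has_order (\<lambda>w. xi w * H w) z n" by simp
  have eq: "xi w * H w = zeta1 w" if "Re w > -1" for w
  proof -
    have "complex_of_real pi powr (- w / 2) * complex_of_real pi powr (w / 2) = 1"
      by (simp flip: powr_add)
    moreover have "Gamma (w / 2 + 1) * rGamma (w / 2 + 1) = 1"
      using half_plus_1_not_nonpos_Int[of w] that by (simp add: rGamma_inverse_Gamma Gamma_eq_zero_iff)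
    ultimately show ?thesis unfolding xi_eq_xi0[OF that] xi0_def H_def by algebra
  qed
  have "eventually (\<lambda>w. w \<in> {w. Re w > -1}) (at z)"
    using assms(2) by (intro eventually_at_in_open' open_halfspace_Re_gt) auto
  then have "eventually (\<lambda>w. xi w * H w = zeta1 w) (at z)"
    by eventually_elim (simp add: eq)
  from has_order_cong[OF this] o show ?thesis by simp
qed

lemma twin_prime_const_nonzero: "twin_prime_const \<noteq> 0"
proof -
  obtain L where "L holomorphic_on {s. Re s > -1/2}"
    and L: "\<And>s. Re s > -1/2 \<Longrightarrow> (\<lambda>N. \<Prod>p<N. sing_factor p s) \<longlonglongrightarrow> L s"
    and "\<And>s. Re s > -1/2 \<Longrightarrow> (\<lambda>N. deriv (\<lambda>z. \<Prod>p<N. sing_factor p z) s) \<longlonglongrightarrow> deriv L s"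
    using sing_factor_product by blast
  show ?thesis
    using sing_factor_product_0_1(1)[OF L[of 0] L[of 1]] by auto
qed

text \<open>Otherwise the transform would satisfy \<open>h \<Phi>(s\<^sub>0 + h) \<longrightarrow> 0\<close> as \<open>h\<close> decreases to \<open>0\<close> for
\<open>s\<^sub>0 = \<rho>/2 - 1\<close> with \<open>\<rho>\<close> an uncancelled zero. In
\<open>\<Phi>(s) (s - 1) s\<^sup>2 (s + 1) \<dots> (s + m) Z(s) = num(s) + \<dots> Z(s)\<close> with \<open>Z(s) = (2s + 1) \<zeta>(2s + 2)\<close>, the order \<open>q\<close> of \<open>num\<close> at \<open>s\<^sub>0\<close>
is smaller than the order \<open>n\<close> of \<open>Z\<close>; after division by \<open>h\<^bsup>q\<^esup>\<close> all terms but the first on the right tend to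
\<open>0\<close>, a contradiction. Taking \<open>\<epsilon>\<close> as \<open>1\<close> or \<open>-1\<close> treats both signs.\<close>

lemma E_err_oscillates:
  assumes \<epsilon>: "\<epsilon> \<noteq> (0::real)"
  shows "\<exists>c>0. \<not> eventually (\<lambda>x. \<epsilon> * E_err m x \<le> c * x powr (real m - 3 / 4)) at_top"
proof (rule ccontr)
  assume "\<not> ?thesis"
  then have small: "eventually (\<lambda>x. \<epsilon> * E_err m x \<le> c * x powr (real m - 3 / 4)) at_top" if "c > 0" for c
    using that by blast
  obtain K \<Psi> where K: "K holomorphic_on {s. Re s > -1}" "\<And>s. -3/4 \<le> Re s \<Longrightarrow> Re s \<le> -1/2 \<Longrightarrow> K s \<noteq> 0"
    and \<Psi>: "\<Psi> holomorphic_on {s. Re s > -1} \<inter> {s. zeta1 (2 * s + 2) \<noteq> 0}"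
    "\<And>s. Re s > -1 \<Longrightarrow> zeta1 (2 * s + 2) \<noteq> 0 \<Longrightarrow>
       \<Psi> s * ((s - 1) * s\<^sup>2 * pochhammer (s + 1) m * zeta1 (2 * s + 2)) = err_num m K s + pochhammer (s + 1) m * zeta1 (2 * s + 2) * err_poly m s"
    "\<And>\<sigma>. \<sigma> > 2 \<Longrightarrow> \<Psi> (of_real \<sigma>) = of_real (LINT x|lborel. indicator {1..} x * (E_err m x * x powr (- real m - 1) * x powr (- \<sigma>)))"
    using E_err_continuation[of m] by blast
  define P where "P = (\<lambda>s::complex. pochhammer (s + 1) m)"
  define Z where "Z = (\<lambda>s. zeta1 (2 * s + 2))"
  have Z_hol: "Z holomorphic_on {s. Re s > -1}" unfolding Z_def
    by (rule holomorphic_on_compose_gen[OF _ zeta1_holomorphic, unfolded o_def]) (auto intro!: holomorphic_intros)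
  have z1_hol: "(\<lambda>s. zeta1 (s + 1)) holomorphic_on {s. Re s > -1}"
    by (rule holomorphic_on_compose_gen[OF _ zeta1_holomorphic, unfolded o_def]) (auto intro!: holomorphic_intros)
  have P_hol: "P holomorphic_on A" for A unfolding P_def by (intro holomorphic_intros)
  have num_hol: "err_num m K holomorphic_on {s. Re s > -1}"
    unfolding err_num_def by (intro holomorphic_intros K(1) z1_hol zeta1_holomorphic) auto
  have R_hol: "err_poly m holomorphic_on A" for A
  proof -
    have "of_nat m + 1 \<noteq> (0::complex)" by (rule of_nat_plus_1_nonzero)
    then show ?thesis unfolding err_poly_def by (intro holomorphic_intros) auto
  qed
  define U where "U = {s. Re s > -1} \<inter> {s. Z s \<noteq> 0}"
  have U: "open U"
  proof -
    have "open ({s. Re s > -1} \<inter> Z -` (- {0}))"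
      by (intro continuous_open_preimage holomorphic_on_imp_continuous_on[OF Z_hol] open_halfspace_Re_gt) auto
    then show ?thesis by (simp add: U_def vimage_def)
  qed
  have Z_real: "Z (of_real \<sigma>) \<noteq> 0" if "\<sigma> \<ge> -3/4" for \<sigma>
    using zeta1_real_pos[of "2 * \<sigma> + 2"] that by (auto simp: Z_def)
  define e where "e = (\<lambda>x. \<epsilon> * (indicator {1..} x * E_err m x) * x powr (- real m - 1))"
  have e_eq: "indicator {1..} x * (e x * x powr (- \<sigma>)) = \<epsilon> * (indicator {1..} x * (E_err m x * x powr (- real m - 1) * x powr (- \<sigma>)))" for x \<sigma>
    by (simp add: e_def indicator_def)
  obtain \<Phi> where \<Phi>: "\<Phi> holomorphic_on {s. -3/4 < Re s}" "\<And>\<sigma>. 2 < \<sigma> \<Longrightarrow> \<Phi> (of_real \<sigma>) = of_real \<epsilon> * \<Psi> (of_real \<sigma>)"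
    "\<And>t. ((\<lambda>h. of_real h * \<Phi> (Complex (-3/4 + h) t)) \<longlongrightarrow> 0) (at_right 0)"
  proof (rule Landau_oscillation[of e "-3/4" 2 U "\<lambda>s. of_real \<epsilon> * \<Psi> s"])
    show "e \<in> borel_measurable borel" unfolding e_def by measurable
    show "\<exists>B. \<forall>x\<in>{1..X}. \<bar>e x\<bar> \<le> B" for X
    proof -
      obtain B where B: "\<And>x. x \<in> {1..X} \<Longrightarrow> \<bar>E_err m x * x powr (- real m - 1)\<bar> \<le> B"
        using E_err_bounded by blast
      have "\<bar>e x\<bar> \<le> \<bar>\<epsilon>\<bar> * B" if "x \<in> {1..X}" for x
        using mult_left_mono[OF B[OF that], of "\<bar>\<epsilon>\<bar>"] that by (simp add: e_def abs_mult mult_ac)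
      then show ?thesis by blast
    qed
    show "integrable lborel (\<lambda>x. indicator {1..} x * (e x * x powr (- \<sigma>)))" if "2 < \<sigma>" for \<sigma>
      unfolding e_eq using E_err_transform[OF that, of m]
      by (intro integrable_mult_right) (simp add: has_bochner_integral_iff)
    show "of_real \<sigma> \<in> U" if "-3/4 \<le> \<sigma>" for \<sigma> using Z_real[of \<sigma>] that by (simp add: U_def)
    show "(\<lambda>s. of_real \<epsilon> * \<Psi> s) holomorphic_on U"
      using \<Psi>(1) unfolding U_def Z_def by (intro holomorphic_intros)
    show "of_real \<epsilon> * \<Psi> (of_real \<sigma>) = of_real (LINT x|lborel. indicator {1..} x * (e x * x powr (- \<sigma>)))" if "2 < \<sigma>" for \<sigma>
      unfolding e_eq \<Psi>(3)[OF that] by simp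
    show "eventually (\<lambda>x. e x \<le> c * x powr (-3/4 - 1)) at_top" if "c > 0" for c
      using small[OF that] eventually_ge_at_top[of 1]
    proof eventually_elim
      case (elim x)
      have "e x = \<epsilon> * E_err m x * x powr (- real m - 1)" using elim by (simp add: e_def)
      also have "\<dots> \<le> c * x powr (real m - 3 / 4) * x powr (- real m - 1)" using elim by (intro mult_right_mono) auto
      also have "\<dots> = c * x powr (-3/4 - 1)" by (simp add: mult.assoc flip: powr_add)
      finally show ?case .
    qed
  qed (use U in auto)
  have ident: "\<Phi> s * ((s - 1) * s\<^sup>2 * P s * Z s) = of_real \<epsilon> * (err_num m K s + P s * Z s * err_poly m s)" if s: "Re s > -3/4" for s
  proof (rule holomorphic_eq_if_eq_on_real_interval[where S = "{s. -3/4 < Re s}" and p = 2 and q = 3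
        and f = "\<lambda>s. \<Phi> s * ((s - 1) * s\<^sup>2 * P s * Z s)" and g = "\<lambda>s. of_real \<epsilon> * (err_num m K s + P s * Z s * err_poly m s)"])
    have Z': "Z holomorphic_on {s. -3/4 < Re s}" by (rule holomorphic_on_subset[OF Z_hol]) auto
    have n': "err_num m K holomorphic_on {s. -3/4 < Re s}" by (rule holomorphic_on_subset[OF num_hol]) auto
    show "(\<lambda>s. \<Phi> s * ((s - 1) * s\<^sup>2 * P s * Z s)) holomorphic_on {s. -3/4 < Re s}"
      by (intro holomorphic_intros \<Phi>(1) Z' P_hol)
    show "(\<lambda>s. of_real \<epsilon> * (err_num m K s + P s * Z s * err_poly m s)) holomorphic_on {s. -3/4 < Re s}"
      by (intro holomorphic_intros Z' n' P_hol R_hol)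
    show "\<Phi> (of_real x) * ((of_real x - 1) * (of_real x)\<^sup>2 * P (of_real x) * Z (of_real x))
        = of_real \<epsilon> * (err_num m K (of_real x) + P (of_real x) * Z (of_real x) * err_poly m (of_real x))" if "2 < x" "x < 3" for x
    proof -
      have "\<Psi> (of_real x) * ((of_real x - 1) * (of_real x)\<^sup>2 * P (of_real x) * Z (of_real x)) = err_num m K (of_real x) + P (of_real x) * Z (of_real x) * err_poly m (of_real x)"
        unfolding P_def Z_def by (rule \<Psi>(2)) (use that Z_real[of x] in \<open>auto simp: Z_def\<close>)
      then show ?thesis unfolding \<Phi>(2)[OF that(1)] by (metis mult.assoc)
    qed
    show "connected {s. -3/4 < Re s}" by (intro convex_connected convex_halfspace_Re_gt)
  qed (use s in \<open>auto intro: open_halfspace_Re_gt\<close>)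
  obtain \<rho> n k where \<rho>: "xi \<rho> = 0" "1 / 2 \<le> Re \<rho>" "Re \<rho> \<le> 1" "has_order xi \<rho> n" "has_order xi (halving \<rho>) k"
    "n > k + (if exceptional \<rho> then 1 else 0)"
    using xi_uncancelled_zero by blast
  define s0 where "s0 = \<rho> / 2 - 1"
  have Re0: "-3/4 \<le> Re s0" "Re s0 \<le> -1/2" using \<rho> by (auto simp: s0_def)
  have \<rho>1: "\<rho> \<noteq> 1" using \<rho>(1) xi_real_nonzero[of 1] by auto
  define q where "q = k + (if exceptional \<rho> then 1 else 0 :: nat)"
  have cont: "isCont f s0" if "f holomorphic_on {s. Re s > -1}" for f
    by (rule holomorphic_halfplane_isCont[OF that]) (use Re0 in auto)
  have Zo: "has_order Z s0 n"
  proof -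
    have "2 * s0 + 2 = \<rho>" by (simp add: s0_def)
    then have "has_order zeta1 (2 * s0 + 2) n" using xi_order_imp_zeta1_order[OF \<rho>(4)] \<rho>(2) by simp
    from has_order_affine[OF this] show ?thesis unfolding Z_def by simp
  qed
  have numo: "has_order (err_num m K) s0 q"
  proof -
    have C: "complex_of_real (2 * twin_prime_const * fact m) \<noteq> 0"
      using twin_prime_const_nonzero by simp
    have o1: "has_order zeta1 s0 0"
    proof (rule has_order_nonzero[OF cont[OF zeta1_holomorphic]])
      have "xi s0 \<noteq> 0" using xi_zero_Re(1)[of s0] Re0 by auto
      then show "zeta1 s0 \<noteq> 0" using xi_eq_0_iff[of s0] Re0 by simp
    qed
    have o2: "has_order (\<lambda>s. zeta1 (s + 1)) s0 k"
    proof -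
      have e: "1 - halving \<rho> = 1 * s0 + 1" by (simp add: halving_def s0_def)
      have "has_order xi (1 * s0 + 1) k" using \<rho>(5) unfolding e[symmetric] xi_has_order_reflect .
      then have "has_order zeta1 (1 * s0 + 1) k" using xi_order_imp_zeta1_order Re0 by simp
      from has_order_affine[OF this] show ?thesis by simp
    qed
    have o3: "has_order (\<lambda>s. of_real (2 * twin_prime_const * fact m) * ((2 * s + 1) * 2 powr (- s) * K s)) s0 0"
    proof (rule has_order_nonzero)
      show "isCont (\<lambda>s. of_real (2 * twin_prime_const * fact m) * ((2 * s + 1) * 2 powr (- s) * K s)) s0"
        by (rule cont) (auto intro!: holomorphic_intros K(1))
      have "2 * s0 + 1 \<noteq> 0" using \<rho>1 by (simp add: s0_def)
      then show "of_real (2 * twin_prime_const * fact m) * ((2 * s0 + 1) * 2 powr (- s0) * K s0) \<noteq> 0"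
        using C K(2)[OF Re0] by simp
    qed
    have o4: "has_order (\<lambda>s. 1 + 5 powr (- s) / 3) s0 (if exceptional \<rho> then 1 else 0)"
    proof -
      have exc: "exceptional \<rho> \<longleftrightarrow> 1 + 5 powr (- s0) / 3 = 0"
      proof -
        have "5 powr (- s0) = exp ((1 - \<rho> / 2) * of_real (ln 5))"
          by (simp add: powr_def s0_def Ln_of_real[of 5, simplified])
        then show ?thesis unfolding exceptional_def by (auto simp: field_simps add_eq_0_iff)
      qed
      have D: "((\<lambda>s. 1 + 5 powr (- s) / 3) has_field_derivative - (Ln 5 * 5 powr (- s0) / 3)) (at s0)"
      proof -
        have "((\<lambda>s. 5 powr (- s)) has_field_derivative Ln 5 * 5 powr (- s0) * (- 1)) (at s0)"
          by (rule DERIV_chain2[OF has_field_derivative_powr_right DERIV_minus[OF DERIV_ident]]) simp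
        from DERIV_add[OF DERIV_const DERIV_cdivide[OF this]] show ?thesis by simp
      qed
      show ?thesis
      proof (cases "exceptional \<rho>")
        case True
        have "((\<lambda>s. ((1 + 5 powr (- s) / 3) - (1 + 5 powr (- s0) / 3)) / (s - s0)) \<longlongrightarrow> - (Ln 5 * 5 powr (- s0) / 3)) (at s0)"
          using D by (simp add: has_field_derivative_iff)
        moreover have "1 + 5 powr (- s0) / 3 = 0" using True exc by simp
        moreover have "- (Ln 5 * 5 powr (- s0) / 3) \<noteq> 0" by (simp add: Ln_of_real[of 5, simplified])
        ultimately show ?thesis using True unfolding has_order_def
          by (intro exI[of _ "- (Ln 5 * 5 powr (- s0) / 3)"]) simp
      next
        case False
        then show ?thesis using exc DERIV_isCont[OF D] by (simp add: has_order_nonzero)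
      qed
    qed
    have "has_order (\<lambda>s. of_real (2 * twin_prime_const * fact m) * ((2 * s + 1) * 2 powr (- s) * K s) * zeta1 s * zeta1 (s + 1) * (1 + 5 powr (- s) / 3)) s0
      (0 + 0 + k + (if exceptional \<rho> then 1 else 0))"
      by (intro has_order_mult o1 o2 o3 o4)
    moreover have "(\<lambda>s. of_real (2 * twin_prime_const * fact m) * ((2 * s + 1) * 2 powr (- s) * K s) * zeta1 s * zeta1 (s + 1) * (1 + 5 powr (- s) / 3)) = err_num m K"
      by (simp add: fun_eq_iff err_num_def mult_ac)
    ultimately show ?thesis by (simp add: q_def)
  qed
  obtain d where d: "d \<noteq> 0" "((\<lambda>w. err_num m K w / (w - s0) ^ q) \<longlongrightarrow> d) (at s0)" using numo unfolding has_order_def by blast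
  obtain z where z: "((\<lambda>w. Z w / (w - s0) ^ n) \<longlongrightarrow> z) (at s0)" using Zo unfolding has_order_def by blast
  let ?w = "\<lambda>h. s0 + complex_of_real h"
  note path = filterlim_add_of_real_at_right[of s0]
  have d': "((\<lambda>h. err_num m K (?w h) / of_real h ^ q) \<longlongrightarrow> d) (at_right 0)"
    using filterlim_compose[OF d(2) path] by simp
  have z': "((\<lambda>h. Z (?w h) / of_real h ^ n) \<longlongrightarrow> z) (at_right 0)"
    using filterlim_compose[OF z path] by simp
  have along: "((\<lambda>h. f (?w h)) \<longlongrightarrow> f s0) (at_right 0)" if "isCont f s0" for f :: "complex \<Rightarrow> complex"
    using filterlim_compose[OF that[unfolded isCont_def] path] .
  have h0: "((\<lambda>h. complex_of_real h) \<longlongrightarrow> 0) (at_right 0)"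
    using tendsto_of_real[OF tendsto_ident_at[of 0 "{0<..}"]] by simp
  have \<Phi>0: "((\<lambda>h. of_real h * \<Phi> (?w h)) \<longlongrightarrow> 0) (at_right 0)"
  (* On the boundary line this is Landau's estimate; to the right of it the transform is
     even continuous. *)
  proof (cases "Re s0 = -3/4")
    case True
    then have "?w h = Complex (-3/4 + h) (Im s0)" for h by (simp add: complex_eq_iff)
    then show ?thesis using \<Phi>(3)[of "Im s0"] by simp
  next
    case False
    then have "isCont \<Phi> s0"
      by (intro holomorphic_halfplane_isCont[OF \<Phi>(1)]) (use Re0 in auto)
    from tendsto_mult[OF h0 along[OF this]] show ?thesis by simp
  qed
  define B where "B = (\<lambda>s. (s - 1) * s\<^sup>2 * P s)"
  have B: "isCont B s0" unfolding B_def by (rule cont) (intro holomorphic_intros P_hol)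
  have PR: "isCont (\<lambda>s. P s * err_poly m s) s0" by (rule cont) (intro holomorphic_intros P_hol R_hol)
  have nq: "n = Suc (q + (n - Suc q))" using \<rho>(6) by (simp add: q_def)
  have T1: "((\<lambda>h. (of_real h * \<Phi> (?w h)) * B (?w h) * (Z (?w h) / of_real h ^ n) * of_real h ^ (n - Suc q)) \<longlongrightarrow> 0 * B s0 * z * 0 ^ (n - Suc q)) (at_right 0)"
    by (intro tendsto_mult tendsto_power \<Phi>0 along B z' h0)
  have T2: "((\<lambda>h. (Z (?w h) / of_real h ^ n) * of_real h ^ (n - q) * (P (?w h) * err_poly m (?w h))) \<longlongrightarrow> z * 0 ^ (n - q) * (P s0 * err_poly m s0)) (at_right 0)"
    by (intro tendsto_mult tendsto_power along[OF PR] z' h0)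
  have "((\<lambda>h. (of_real h * \<Phi> (?w h)) * B (?w h) * (Z (?w h) / of_real h ^ n) * of_real h ^ (n - Suc q)
      - of_real \<epsilon> * ((Z (?w h) / of_real h ^ n) * of_real h ^ (n - q) * (P (?w h) * err_poly m (?w h))))
      \<longlongrightarrow> 0 * B s0 * z * 0 ^ (n - Suc q) - of_real \<epsilon> * (z * 0 ^ (n - q) * (P s0 * err_poly m s0))) (at_right 0)"
    by (intro tendsto_diff tendsto_mult_left T1 T2)
  moreover have "n - q \<noteq> 0" using nq by linarith
  ultimately have "((\<lambda>h. (of_real h * \<Phi> (?w h)) * B (?w h) * (Z (?w h) / of_real h ^ n) * of_real h ^ (n - Suc q)
      - of_real \<epsilon> * ((Z (?w h) / of_real h ^ n) * of_real h ^ (n - q) * (P (?w h) * err_poly m (?w h)))) \<longlongrightarrow> 0) (at_right 0)"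
    by (simp add: power_0_left)
  moreover have "eventually (\<lambda>h. (of_real h * \<Phi> (?w h)) * B (?w h) * (Z (?w h) / of_real h ^ n) * of_real h ^ (n - Suc q)
      - of_real \<epsilon> * ((Z (?w h) / of_real h ^ n) * of_real h ^ (n - q) * (P (?w h) * err_poly m (?w h)))
      = of_real \<epsilon> * (err_num m K (?w h) / of_real h ^ q)) (at_right 0)"
    unfolding eventually_at_filter
  proof (rule always_eventually, intro allI impI)
    fix h :: real assume "h \<noteq> 0" "h \<in> {0<..}"
    then have h: "h > 0" by simp
    define H where "H = complex_of_real h"
    have H: "H \<noteq> 0" using h by (simp add: H_def)
    have e1: "H * X * Y * (W / H ^ n) * H ^ (n - Suc q) = X * Y * W / H ^ q" for X Y W
    proof -
      have "H ^ n = H * H ^ q * H ^ (n - Suc q)" by (subst nq) (simp add: power_add)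
      then show ?thesis using H by simp
    qed
    have e2: "W / H ^ n * H ^ (n - q) = W / H ^ q" for W
    proof -
      have "H ^ n = H ^ q * H ^ (n - q)" using nq by (subst power_add[symmetric]) simp
      then show ?thesis using H by simp
    qed
    have "\<Phi> (?w h) * B (?w h) * Z (?w h) = of_real \<epsilon> * (err_num m K (?w h) + P (?w h) * Z (?w h) * err_poly m (?w h))"
      using ident[of "?w h"] h Re0 by (simp add: B_def mult.assoc)
    then have "\<Phi> (?w h) * B (?w h) * Z (?w h) / H ^ q = of_real \<epsilon> * (err_num m K (?w h) / H ^ q) + of_real \<epsilon> * (Z (?w h) / H ^ q * (P (?w h) * err_poly m (?w h)))"
      by (simp add: distrib_left add_divide_distrib mult_ac)
    then show "(of_real h * \<Phi> (?w h)) * B (?w h) * (Z (?w h) / of_real h ^ n) * of_real h ^ (n - Suc q)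
      - of_real \<epsilon> * ((Z (?w h) / of_real h ^ n) * of_real h ^ (n - q) * (P (?w h) * err_poly m (?w h)))
      = of_real \<epsilon> * (err_num m K (?w h) / of_real h ^ q)"
      unfolding H_def[symmetric] e1 e2 by simp
  qed
  ultimately have "((\<lambda>h. of_real \<epsilon> * (err_num m K (?w h) / of_real h ^ q)) \<longlongrightarrow> 0) (at_right 0)"
    by (rule Lim_transform_eventually)
  moreover have "((\<lambda>h. of_real \<epsilon> * (err_num m K (?w h) / of_real h ^ q)) \<longlongrightarrow> of_real \<epsilon> * d) (at_right 0)"
    by (intro tendsto_mult_left d')
  ultimately have "of_real \<epsilon> * d = 0" using tendsto_unique[of "at_right (0::real)"] by (metis trivial_limit_at_right_real)
  then show False using \<epsilon> d(1) by simp
qed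

theorem theorem4:
  fixes m :: nat
  assumes "m \<ge> 1"
  shows "Limsup at_top (\<lambda>x::real. ereal (E_err m x / x powr (real m - 3 / 4))) > 0 \<and>
         Liminf at_top (\<lambda>x::real. ereal (E_err m x / x powr (real m - 3 / 4))) < 0"
proof
  let ?f = "\<lambda>x::real. ereal (E_err m x / x powr (real m - 3 / 4))"
  show "Limsup at_top ?f > 0"
  proof (rule ccontr)
    assume "\<not> Limsup at_top ?f > 0"
    then have le: "Limsup at_top ?f \<le> 0" by simp
    obtain c where c: "c > 0" "\<not> eventually (\<lambda>x. 1 * E_err m x \<le> c * x powr (real m - 3 / 4)) at_top"
      using E_err_oscillates[of 1 m] by auto
    have "Limsup at_top ?f < ereal c" using le c(1) by (metis ereal_less(2) le_less_trans)
    then have "eventually (\<lambda>x. ?f x < ereal c) at_top" by (rule Limsup_lessD)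
    then have "eventually (\<lambda>x. 1 * E_err m x \<le> c * x powr (real m - 3 / 4)) at_top"
      using eventually_gt_at_top[of 0] by eventually_elim (simp add: divide_less_eq)
    then show False using c(2) by contradiction
  qed
  show "Liminf at_top ?f < 0"
  proof (rule ccontr)
    assume "\<not> Liminf at_top ?f < 0"
    then have le: "0 \<le> Liminf at_top ?f" by simp
    obtain c where c: "c > 0" "\<not> eventually (\<lambda>x. - 1 * E_err m x \<le> c * x powr (real m - 3 / 4)) at_top"
      using E_err_oscillates[of "-1" m] by auto
    have "ereal (- c) < 0" using c(1) by simp
    then have "ereal (- c) < Liminf at_top ?f" using le by (rule less_le_trans)
    then have "eventually (\<lambda>x. ereal (- c) < ?f x) at_top" by (rule less_LiminfD)
    then have "eventually (\<lambda>x. - 1 * E_err m x \<le> c * x powr (real m - 3 / 4)) at_top"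
      using eventually_gt_at_top[of 0] by eventually_elim (simp add: less_divide_eq)
    then show False using c(2) by contradiction
  qed
qed

end
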